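(* Let $\theta>0$ and $\gamma>0$, and let $B=\{B_t,t\ge0\}$ be a standard Brownian motion. For $T>0$ let $$f_T(t,s)=\frac{\gamma^2}{2\sqrt T}e^{-\theta|t-s|},\quad s,t\in[0,T],\qquad F_T=I_2(f_T)=\int_0^T\int_0^Tf_T(t,s)\,dB_t\,dB_s .$$ Let $\phi$ be the density of $N(0,\sigma^2)$, where $\sigma^2=\frac{\gamma^4}{2\theta}$. Then for each $T>0$, $F_T$ has a smooth probability density $f_{F_T}$, and for any $k\ge0$, $$\sup_{x\in\mathbb R}\left|f_{F_T}^{(k)}(x)-\phi^{(k)}(x)\right|\le C\,T^{-\frac12},$$ where the constant $C$ depends on $k,\gamma$ and $\theta$.
   Context: $I_2(f_T)$ denotes the double Wiener–Itô integral of the symmetric kernel $f_T\in L^2([0,T]^2)$ with respect to $B$, i.e. the multiple stochastic integral of order 2 for the isonormal Gaussian process with Hilbert space $L^2([0,T])$, normalized so that $I_2(h^{\otimes2})=\left(\int_0^Th\,dB\right)^2-1$ for $\|h\|_{L^2([0,T])}=1$ and $E[I_2(f)^2]=2\|f\|^2_{L^2([0,T]^2)}$.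
   Formalization: The bound is proved for all T ≥ T_0, for every T_0 > 0, with C depending also on T_0 (and formally on the type of the sample space): uniformly over all T > 0 it fails as T → 0, since F_T/√T tends to a multiple of N²−1, whose density is unbounded. *)

theory Defs
  imports "HOL-Probability.Probability"
begin

definition standard_brownian_motion :: "'a measure \<Rightarrow> (real \<Rightarrow> 'a \<Rightarrow> real) \<Rightarrow> bool" where
  "standard_brownian_motion M B \<longleftrightarrow>
     prob_space M \<and>
     (\<forall>t\<ge>0. B t \<in> borel_measurable M) \<and>
     (AE \<omega> in M. B 0 \<omega> = 0) \<and>
     (\<forall>(n::nat) t. 0 \<le> t 0 \<and> (\<forall>i<n. t i \<le> t (Suc i)) \<longrightarrow>
        prob_space.indep_vars M (\<lambda>_. borel) (\<lambda>i \<omega>. B (t (Suc i)) \<omega> - B (t i) \<omega>) {..<n}) \<and>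
     (\<forall>s t. 0 \<le> s \<and> s < t \<longrightarrow>
        distributed M lborel (\<lambda>\<omega>. B t \<omega> - B s \<omega>) (normal_density 0 (sqrt (t - s)))) \<and>
     (AE \<omega> in M. continuous_on {0..} (\<lambda>t. B t \<omega>))"

definition L2 :: "'a measure \<Rightarrow> ('a \<Rightarrow> real) set" where
  "L2 N = {f \<in> borel_measurable N. integrable N (\<lambda>x. (f x)\<^sup>2)}"

definition L2_tendsto :: "'a measure \<Rightarrow> (nat \<Rightarrow> 'a \<Rightarrow> real) \<Rightarrow> ('a \<Rightarrow> real) \<Rightarrow> bool" where
  "L2_tendsto N f g \<longleftrightarrow> (\<forall>n. f n \<in> L2 N) \<and> g \<in> L2 N \<and>
     (\<lambda>n. \<integral>x. (f n x - g x)\<^sup>2 \<partial>N) \<longlonglongrightarrow> 0"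

abbreviation lebesgue_interval :: "real \<Rightarrow> real measure" where
  "lebesgue_interval T \<equiv> restrict_space lborel {0..T}"

abbreviation lebesgue_square :: "real \<Rightarrow> (real \<times> real) measure" where
  "lebesgue_square T \<equiv> restrict_space lborel ({0..T} \<times> {0..T})"

text \<open>The isonormal process over \<open>L\<^sup>2([0,T])\<close> generated by \<open>B\<close>: \<open>has_wiener_integral M B T h X\<close>
  says that \<open>X\<close> is a version of \<open>\<integral>\<^sub>0\<^sup>T h dB\<close>. It is given by its graph, the smallest
  \<open>L\<^sup>2\<close>-closed linear relation that maps the indicator of \<open>(s,t]\<close> to \<open>B\<^sub>t - B\<^sub>s\<close>.
  The rule \<open>limit\<close>, applied to constant sequences, also makes the relation independent of the
  choice of representatives of \<open>h\<close> and \<open>X\<close> modulo null sets.\<close>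

inductive has_wiener_integral ::
  "'a measure \<Rightarrow> (real \<Rightarrow> 'a \<Rightarrow> real) \<Rightarrow> real \<Rightarrow> (real \<Rightarrow> real) \<Rightarrow> ('a \<Rightarrow> real) \<Rightarrow> bool"
  for M B T where
  interval: "\<lbrakk>0 \<le> s; s \<le> t; t \<le> T\<rbrakk> \<Longrightarrow>
     has_wiener_integral M B T (indicator {s<..t}) (\<lambda>\<omega>. B t \<omega> - B s \<omega>)"
| linear: "\<lbrakk>has_wiener_integral M B T g X; has_wiener_integral M B T h Y\<rbrakk> \<Longrightarrow>
     has_wiener_integral M B T (\<lambda>t. a * g t + b * h t) (\<lambda>\<omega>. a * X \<omega> + b * Y \<omega>)"
| limit: "\<lbrakk>\<And>n::nat. has_wiener_integral M B T (h n) (X n);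
     L2_tendsto (lebesgue_interval T) h g; L2_tendsto M X Y\<rbrakk> \<Longrightarrow>
     has_wiener_integral M B T g Y"

text \<open>The double integral \<open>I\<^sub>2\<close> on symmetric kernels in \<open>L\<^sup>2([0,T]\<^sup>2)\<close>: the continuous linear
  extension of \<open>I\<^sub>2(h \<otimes> h) = (\<integral>\<^sub>0\<^sup>T h dB)\<^sup>2 - 1\<close> for \<open>\<parallel>h\<parallel> = 1\<close>, again given by its graph.
  With this normalization \<open>E[I\<^sub>2(f)\<^sup>2] = 2 \<parallel>f\<parallel>\<^sup>2\<close>.\<close>

inductive has_double_wiener_integral ::
  "'a measure \<Rightarrow> (real \<Rightarrow> 'a \<Rightarrow> real) \<Rightarrow> real \<Rightarrow> (real \<times> real \<Rightarrow> real) \<Rightarrow> ('a \<Rightarrow> real) \<Rightarrow> bool"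
  for M B T where
  square: "\<lbrakk>h \<in> L2 (lebesgue_interval T); (\<integral>t. (h t)\<^sup>2 \<partial>lebesgue_interval T) = 1;
     has_wiener_integral M B T h X\<rbrakk> \<Longrightarrow>
     has_double_wiener_integral M B T (\<lambda>(t, s). h t * h s) (\<lambda>\<omega>. (X \<omega>)\<^sup>2 - 1)"
| linear: "\<lbrakk>has_double_wiener_integral M B T f X; has_double_wiener_integral M B T g Y\<rbrakk> \<Longrightarrow>
     has_double_wiener_integral M B T (\<lambda>p. a * f p + b * g p) (\<lambda>\<omega>. a * X \<omega> + b * Y \<omega>)"
| limit: "\<lbrakk>\<And>n::nat. has_double_wiener_integral M B T (f n) (X n);
     L2_tendsto (lebesgue_square T) f g; L2_tendsto M X Y\<rbrakk> \<Longrightarrow>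
     has_double_wiener_integral M B T g Y"

text \<open>A version of \<open>I\<^sub>2(f)\<close>, which is determined up to almost sure equality.\<close>

definition double_wiener_integral ::
  "'a measure \<Rightarrow> (real \<Rightarrow> 'a \<Rightarrow> real) \<Rightarrow> real \<Rightarrow> (real \<times> real \<Rightarrow> real) \<Rightarrow> 'a \<Rightarrow> real" where
  "double_wiener_integral M B T f = (SOME X. has_double_wiener_integral M B T f X)"

definition smooth :: "(real \<Rightarrow> real) \<Rightarrow> bool" where
  "smooth f \<longleftrightarrow> (\<forall>k x. (deriv ^^ k) f field_differentiable at x)"

text \<open>Nonnegativity is required separately, since \<open>ennreal\<close> truncates negative values.
  A smooth density is unique.\<close>

definition has_smooth_density :: "'a measure \<Rightarrow> ('a \<Rightarrow> real) \<Rightarrow> (real \<Rightarrow> real) \<Rightarrow> bool" where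
  "has_smooth_density M X p \<longleftrightarrow>
     smooth p \<and> (\<forall>x. 0 \<le> p x) \<and> distributed M lborel X (\<lambda>x. ennreal (p x))"

definition exp_kernel :: "real \<Rightarrow> real \<Rightarrow> real \<Rightarrow> real \<times> real \<Rightarrow> real" where
  "exp_kernel \<theta> \<gamma> T = (\<lambda>(t, s). \<gamma>\<^sup>2 / (2 * sqrt T) * exp (- \<theta> * \<bar>t - s\<bar>))"

end

theory Submission
  imports Defs "HOL-Complex_Analysis.Complex_Analysis" "HOL-Real_Asymp.Real_Asymp"
begin

text \<open>The variable \<open>F\<^sub>T\<close> lies in the second Wiener chaos, so it behaves like a weighted sum
  \<open>\<Sum>j. \<lambda>\<^sub>j (\<eta>\<^sub>j\<^sup>2 - 1)\<close> with independent standard normal \<open>\<eta>\<^sub>j\<close>, the weights being the eigenvalues of the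
  integral operator with kernel \<open>f\<^sub>T\<close>. Its characteristic function is therefore
  \<open>\<phi>(u) = \<Prod>j. e\<^bsup>-iu\<lambda>\<^sub>j\<^esup> (1 - 2iu\<lambda>\<^sub>j)\<^bsup>-1/2\<^esup>\<close>, and the theorem follows by Fourier inversion from two
  properties of this product.

  Rate. Differentiating the logarithm gives \<open>\<phi>'(u) = - 2u \<phi>(u) \<Sum>j. \<lambda>\<^sub>j\<^sup>2 / (1 - 2iu\<lambda>\<^sub>j)\<close>, whereas
  \<open>e\<^bsup>-su\<^sup>2\<^esup>\<close> satisfies the same equation with \<open>s\<close> in place of the sum. The two functions thus
  differ by at most a multiple of \<open>\<bar>s - \<Sum>j. \<lambda>\<^sub>j\<^sup>2\<bar> + \<Sum>j. \<bar>\<lambda>\<^sub>j\<bar>\<^sup>3\<close> (lemma \<open>chi_gaussian\<close>). For the exponential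
  kernel and \<open>s = \<sigma>\<^sup>2/2\<close> the first term is of order \<open>1/T\<close>, and the second one is of order
  \<open>T\<^bsup>-1/2\<^esup>\<close>, because the largest eigenvalue is of that order while the sum of squares stays bounded.

  Decay. Derivatives of the density need integrability of \<open>\<bar>u\<bar>\<^sup>k \<phi>(u)\<close>, with constants uniform in
  \<open>T \<ge> T\<^sub>0\<close>. Since \<open>\<bar>\<phi>(u)\<bar>\<^sup>4 = \<Prod>j. 1/(1 + 4u\<^sup>2\<lambda>\<^sub>j\<^sup>2)\<close>, it suffices to know that a number of eigenvalues
  proportional to \<open>T\<close>, with an arbitrarily large factor, are at least a constant times \<open>T\<^bsup>-1/2\<^esup>\<close>
  (lemma \<open>eigval_count\<close>). This is a min-max argument on functions supported in disjoint blocks.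

  All spectral theory is done on finite symmetric matrices: the kernel is replaced by its values on
  a uniform grid of \<open>n\<close> cells, where it becomes a multiple of the autoregressive matrix
  \<open>q\<^bsup>\<bar>i-m\<bar>\<^esup>\<close>, whose quadratic form and Frobenius norm have closed forms. The isometry of the double
  integral carries the resulting estimates over to \<open>F\<^sub>T\<close> as \<open>n \<rightarrow> \<infinity>\<close>, and it also shows that \<open>F\<^sub>T\<close>
  exists and has a well-defined law.\<close>

section \<open>Square-integrable functions\<close>

lemma L2_D [dest]: "f \<in> L2 N \<Longrightarrow> f \<in> borel_measurable N" "f \<in> L2 N \<Longrightarrow> integrable N (\<lambda>x. (f x)\<^sup>2)"
  by (auto simp: L2_def)

lemma L2_integrable_mult:
  assumes "f \<in> L2 N" "g \<in> L2 N"
  shows "integrable N (\<lambda>x. f x * g x)"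
proof (rule Bochner_Integration.integrable_bound)
  show "integrable N (\<lambda>x. (f x)\<^sup>2 + (g x)\<^sup>2)" using assms by auto
  show "(\<lambda>x. f x * g x) \<in> borel_measurable N" using assms by (auto dest!: L2_D(1))
  have "\<bar>a * b\<bar> \<le> a\<^sup>2 + b\<^sup>2" for a b :: real
    using sum_squares_bound[of a b] sum_squares_bound[of a "- b"] zero_le_power2[of a] zero_le_power2[of b]
    unfolding abs_le_iff power2_minus mult_minus_right by linarith
  then show "AE x in N. norm (f x * g x) \<le> norm ((f x)\<^sup>2 + (g x)\<^sup>2)"
    by (intro AE_I2) (simp add: order_trans[OF _ abs_ge_self])
qed

lemma L2_lincomb:
  assumes "f \<in> L2 N" "g \<in> L2 N"
  shows "(\<lambda>x. a * f x + b * g x) \<in> L2 N"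
proof -
  have m: "f \<in> borel_measurable N" "g \<in> borel_measurable N" using assms by auto
  have "(\<lambda>x. (a * f x + b * g x)\<^sup>2) = (\<lambda>x. a\<^sup>2 * (f x)\<^sup>2 + 2 * a * b * (f x * g x) + b\<^sup>2 * (g x)\<^sup>2)"
    by (auto simp: power2_eq_square algebra_simps)
  moreover have i: "integrable N (\<lambda>x. a\<^sup>2 * (f x)\<^sup>2 + 2 * a * b * (f x * g x) + b\<^sup>2 * (g x)\<^sup>2)"
    by (intro Bochner_Integration.integrable_add integrable_mult_right L2_D(2) L2_integrable_mult assms)
  ultimately have "integrable N (\<lambda>x. (a * f x + b * g x)\<^sup>2)" by (simp only:)
  then show ?thesis using m unfolding L2_def by simp
qed

lemma L2_add: "f \<in> L2 N \<Longrightarrow> g \<in> L2 N \<Longrightarrow> (\<lambda>x. f x + g x) \<in> L2 N"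
  and L2_diff: "f \<in> L2 N \<Longrightarrow> g \<in> L2 N \<Longrightarrow> (\<lambda>x. f x - g x) \<in> L2 N"
  and L2_scale: "f \<in> L2 N \<Longrightarrow> (\<lambda>x. a * f x) \<in> L2 N"
  using L2_lincomb[of f N g 1 1] L2_lincomb[of f N g 1 "-1"] L2_lincomb[of f N f a 0] by auto

lemma L2_zero: "(\<lambda>x. 0) \<in> L2 N"
  by (simp add: L2_def)

lemma L2_sum: "(\<And>i. i \<in> I \<Longrightarrow> f i \<in> L2 N) \<Longrightarrow> (\<lambda>x. \<Sum>i\<in>I. f i x) \<in> L2 N"
  by (induction I rule: infinite_finite_induct) (auto intro: L2_zero L2_add)

lemma integral_sq_lincomb:
  assumes "f \<in> L2 N" "g \<in> L2 N"
  shows "(\<integral>x. (a * f x + b * g x)\<^sup>2 \<partial>N) =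
     a\<^sup>2 * (\<integral>x. (f x)\<^sup>2 \<partial>N) + 2 * a * b * (\<integral>x. f x * g x \<partial>N) + b\<^sup>2 * (\<integral>x. (g x)\<^sup>2 \<partial>N)"
proof -
  have "(\<integral>x. (a * f x + b * g x)\<^sup>2 \<partial>N) = (\<integral>x. a\<^sup>2 * (f x)\<^sup>2 + 2 * a * b * (f x * g x) + b\<^sup>2 * (g x)\<^sup>2 \<partial>N)"
    by (intro Bochner_Integration.integral_cong) (auto simp: power2_eq_square algebra_simps)
  also have "\<dots> = a\<^sup>2 * (\<integral>x. (f x)\<^sup>2 \<partial>N) + 2 * a * b * (\<integral>x. f x * g x \<partial>N) + b\<^sup>2 * (\<integral>x. (g x)\<^sup>2 \<partial>N)"
    using assms L2_integrable_mult[OF assms] L2_D(2)[OF assms(1)] L2_D(2)[OF assms(2)] by simp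
  finally show ?thesis .
qed

lemma integral_mult_lincomb:
  assumes "f \<in> L2 N" "g \<in> L2 N" "h \<in> L2 N"
  shows "(\<integral>x. (a * f x + b * g x) * h x \<partial>N) = a * (\<integral>x. f x * h x \<partial>N) + b * (\<integral>x. g x * h x \<partial>N)"
proof -
  have "(\<integral>x. (a * f x + b * g x) * h x \<partial>N) = (\<integral>x. a * (f x * h x) + b * (g x * h x) \<partial>N)"
    by (simp add: algebra_simps)
  also have "\<dots> = a * (\<integral>x. f x * h x \<partial>N) + b * (\<integral>x. g x * h x \<partial>N)"
    using L2_integrable_mult[OF assms(1,3)] L2_integrable_mult[OF assms(2,3)] by simp
  finally show ?thesis .
qed

lemma L2_cauchy_schwarz:
  assumes "f \<in> L2 N" "g \<in> L2 N"
  shows "(\<integral>x. f x * g x \<partial>N)\<^sup>2 \<le> (\<integral>x. (f x)\<^sup>2 \<partial>N) * (\<integral>x. (g x)\<^sup>2 \<partial>N)"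
proof -
  define A where "A = (\<integral>x. (f x)\<^sup>2 \<partial>N)"
  define B where "B = (\<integral>x. f x * g x \<partial>N)"
  define C where "C = (\<integral>x. (g x)\<^sup>2 \<partial>N)"
  have q: "0 \<le> a\<^sup>2 * A + 2 * a * b * B + b\<^sup>2 * C" for a b
    unfolding A_def B_def C_def integral_sq_lincomb[OF assms, symmetric] by simp
  have nn: "0 \<le> A" "0 \<le> C" using q[of 1 0] q[of 0 1] by auto
  have "B\<^sup>2 \<le> A * C"
  proof (cases "C = 0")
    case True
    have "B = 0"
    proof (rule ccontr)
      assume "B \<noteq> 0"
      then have "2 * 1 * (- (A + 1) / (2 * B)) * B = - (A + 1)" by simp
      then show False using q[of 1 "- (A + 1) / (2 * B)"] nn True by simp
    qed
    then show ?thesis using nn by simp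
  next
    case False
    then have "C > 0" using nn by simp
    have "0 \<le> C * (A * C - B\<^sup>2)" using q[of C "- B"] by (simp add: power2_eq_square algebra_simps)
    then show ?thesis using \<open>C > 0\<close> by (simp add: zero_le_mult_iff)
  qed
  then show ?thesis unfolding A_def B_def C_def .
qed

lemma integral_sq_triangle:
  assumes "f \<in> L2 N" "g \<in> L2 N"
  shows "(\<integral>x. (f x + g x)\<^sup>2 \<partial>N) \<le> 2 * (\<integral>x. (f x)\<^sup>2 \<partial>N) + 2 * (\<integral>x. (g x)\<^sup>2 \<partial>N)"
proof -
  have "0 \<le> (\<integral>x. (1 * f x + (-1) * g x)\<^sup>2 \<partial>N)" by simp
  then show ?thesis
    unfolding integral_sq_lincomb[OF assms]
    using integral_sq_lincomb[OF assms, of 1 1] by simp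
qed

lemma L2_tendsto_D:
  assumes "L2_tendsto N f g"
  shows "f n \<in> L2 N" "g \<in> L2 N" "(\<lambda>n. \<integral>x. (f n x - g x)\<^sup>2 \<partial>N) \<longlonglongrightarrow> 0"
  using assms by (auto simp: L2_tendsto_def)

lemma L2_tendsto_integral_mult:
  assumes "L2_tendsto N f g" "h \<in> L2 N"
  shows "(\<lambda>n. \<integral>x. f n x * h x \<partial>N) \<longlonglongrightarrow> (\<integral>x. g x * h x \<partial>N)"
proof -
  note t = L2_tendsto_D[OF assms(1)]
  have "(\<lambda>n. (\<integral>x. f n x * h x \<partial>N) - (\<integral>x. g x * h x \<partial>N)) \<longlonglongrightarrow> 0"
  proof (rule Lim_null_comparison)
    show "\<forall>\<^sub>F n in sequentially. norm ((\<integral>x. f n x * h x \<partial>N) - (\<integral>x. g x * h x \<partial>N))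
       \<le> sqrt ((\<integral>x. (f n x - g x)\<^sup>2 \<partial>N) * (\<integral>x. (h x)\<^sup>2 \<partial>N))"
    proof (intro always_eventually allI)
      fix n
      have "(\<integral>x. f n x * h x \<partial>N) - (\<integral>x. g x * h x \<partial>N) = (\<integral>x. (f n x - g x) * h x \<partial>N)"
        using integral_mult_lincomb[OF t(1)[of n] t(2) assms(2), of 1 "-1"] by simp
      moreover have "\<bar>\<integral>x. (f n x - g x) * h x \<partial>N\<bar> \<le> sqrt ((\<integral>x. (f n x - g x)\<^sup>2 \<partial>N) * (\<integral>x. (h x)\<^sup>2 \<partial>N))"
        using L2_cauchy_schwarz[OF L2_diff[OF t(1) t(2)] assms(2), of n] by (intro real_le_rsqrt) simp
      ultimately show "norm ((\<integral>x. f n x * h x \<partial>N) - (\<integral>x. g x * h x \<partial>N))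
       \<le> sqrt ((\<integral>x. (f n x - g x)\<^sup>2 \<partial>N) * (\<integral>x. (h x)\<^sup>2 \<partial>N))" by simp
    qed
    show "(\<lambda>n. sqrt ((\<integral>x. (f n x - g x)\<^sup>2 \<partial>N) * (\<integral>x. (h x)\<^sup>2 \<partial>N))) \<longlonglongrightarrow> 0"
      using tendsto_real_sqrt[OF tendsto_mult_right[OF t(3), of "\<integral>x. (h x)\<^sup>2 \<partial>N"]] by simp
  qed
  then show ?thesis by (rule LIM_zero_cancel)
qed

lemma L2_tendsto_integral_sq:
  assumes "L2_tendsto N f g"
  shows "(\<lambda>n. \<integral>x. (f n x)\<^sup>2 \<partial>N) \<longlonglongrightarrow> (\<integral>x. (g x)\<^sup>2 \<partial>N)"
proof -
  note t = L2_tendsto_D[OF assms]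
  have "(\<integral>x. (f n x)\<^sup>2 \<partial>N) = (\<integral>x. (f n x - g x)\<^sup>2 \<partial>N) + 2 * (\<integral>x. f n x * g x \<partial>N) - (\<integral>x. (g x)\<^sup>2 \<partial>N)" for n
    using integral_sq_lincomb[OF t(1)[of n] t(2), of 1 "-1"] by simp
  moreover have "(\<lambda>n. (\<integral>x. (f n x - g x)\<^sup>2 \<partial>N) + 2 * (\<integral>x. f n x * g x \<partial>N) - (\<integral>x. (g x)\<^sup>2 \<partial>N))
     \<longlonglongrightarrow> 0 + 2 * (\<integral>x. g x * g x \<partial>N) - (\<integral>x. (g x)\<^sup>2 \<partial>N)"
    by (intro tendsto_intros t(3) L2_tendsto_integral_mult[OF assms t(2)])
  ultimately show ?thesis by (simp add: power2_eq_square)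
qed

lemma (in prob_space) L2_integrable:
  assumes "f \<in> L2 M" shows "integrable M f"
proof -
  have "(\<lambda>x. 1) \<in> L2 M" by (simp add: L2_def)
  from L2_integrable_mult[OF assms this] show ?thesis by simp
qed

lemma (in prob_space) L2_integral_abs_le:
  assumes "f \<in> L2 M" shows "(\<integral>x. \<bar>f x\<bar> \<partial>M)\<^sup>2 \<le> (\<integral>x. (f x)\<^sup>2 \<partial>M)"
proof -
  have "(\<lambda>x. 1) \<in> L2 M" by (simp add: L2_def)
  moreover have "(\<lambda>x. \<bar>f x\<bar>) \<in> L2 M" using assms by (auto simp: L2_def)
  ultimately show ?thesis using L2_cauchy_schwarz[of "\<lambda>x. \<bar>f x\<bar>" M "\<lambda>x. 1"] by (simp add: prob_space)
qed

text \<open>Since \<open>\<bar>e\<^bsup>ia\<^esup> - e\<^bsup>ib\<^esup>\<bar> \<le> \<bar>a -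
  b\<bar>\<close>, mean-square convergence gives convergence of characteristic functions.\<close>

lemma (in prob_space) char_diff_L2:
  assumes "X \<in> L2 M" "Y \<in> L2 M"
  shows "(cmod ((\<integral>\<omega>. iexp (u * X \<omega>) \<partial>M) - (\<integral>\<omega>. iexp (u * Y \<omega>) \<partial>M)))\<^sup>2 \<le> u\<^sup>2 * (\<integral>\<omega>. (X \<omega> - Y \<omega>)\<^sup>2 \<partial>M)"
proof -
  have [measurable]: "X \<in> borel_measurable M" "Y \<in> borel_measurable M" using assms by auto
  have d: "(\<lambda>\<omega>. X \<omega> - Y \<omega>) \<in> L2 M" by (rule L2_diff[OF assms])
  have i: "integrable M (\<lambda>\<omega>. iexp (u * X \<omega>))" "integrable M (\<lambda>\<omega>. iexp (u * Y \<omega>))"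
    by (auto intro!: integrable_const_bound[where B=1])
  have "cmod ((\<integral>\<omega>. iexp (u * X \<omega>) \<partial>M) - (\<integral>\<omega>. iexp (u * Y \<omega>) \<partial>M))
      = cmod (\<integral>\<omega>. iexp (u * X \<omega>) - iexp (u * Y \<omega>) \<partial>M)" using i by simp
  also have "\<dots> \<le> (\<integral>\<omega>. cmod (iexp (u * X \<omega>) - iexp (u * Y \<omega>)) \<partial>M)"
    by (rule integral_norm_bound)
  also have "\<dots> \<le> (\<integral>\<omega>. \<bar>u\<bar> * \<bar>X \<omega> - Y \<omega>\<bar> \<partial>M)"
  proof (rule integral_mono)
    fix \<omega>
    have "iexp (u * X \<omega>) - iexp (u * Y \<omega>) = iexp (u * Y \<omega>) * (iexp (u * (X \<omega> - Y \<omega>)) - 1)"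
      by (simp add: right_diff_distrib exp_diff)
    then have "cmod (iexp (u * X \<omega>) - iexp (u * Y \<omega>)) = cmod (iexp (u * (X \<omega> - Y \<omega>)) - 1)"
      by (simp add: norm_mult)
    also have "\<dots> \<le> \<bar>u * (X \<omega> - Y \<omega>)\<bar>"
      using iexp_approx1[of "u * (X \<omega> - Y \<omega>)" 0] by simp
    finally show "cmod (iexp (u * X \<omega>) - iexp (u * Y \<omega>)) \<le> \<bar>u\<bar> * \<bar>X \<omega> - Y \<omega>\<bar>" by (simp add: abs_mult)
  qed (use i L2_integrable[OF d] in auto)
  also have "\<dots> = \<bar>u\<bar> * (\<integral>\<omega>. \<bar>X \<omega> - Y \<omega>\<bar> \<partial>M)" by simp
  finally have "(cmod ((\<integral>\<omega>. iexp (u * X \<omega>) \<partial>M) - (\<integral>\<omega>. iexp (u * Y \<omega>) \<partial>M)))\<^sup>2 \<le> (\<bar>u\<bar> * (\<integral>\<omega>. \<bar>X \<omega> - Y \<omega>\<bar> \<partial>M))\<^sup>2"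
    by (intro power_mono) auto
  also have "\<dots> \<le> u\<^sup>2 * (\<integral>\<omega>. (X \<omega> - Y \<omega>)\<^sup>2 \<partial>M)"
    using L2_integral_abs_le[OF d] by (simp add: power_mult_distrib mult_left_mono)
  finally show ?thesis .
qed

lemma (in prob_space) L2_tendsto_char:
  assumes "L2_tendsto M X Y"
  shows "(\<lambda>n. (\<integral>\<omega>. iexp (u * X n \<omega>) \<partial>M)) \<longlonglongrightarrow> (\<integral>\<omega>. iexp (u * Y \<omega>) \<partial>M)"
proof (rule LIM_zero_cancel, rule Lim_null_comparison)
  note t = L2_tendsto_D[OF assms]
  show "\<forall>\<^sub>F n in sequentially. norm ((\<integral>\<omega>. iexp (u * X n \<omega>) \<partial>M) - (\<integral>\<omega>. iexp (u * Y \<omega>) \<partial>M))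
      \<le> sqrt (u\<^sup>2 * (\<integral>\<omega>. (X n \<omega> - Y \<omega>)\<^sup>2 \<partial>M))"
    by (intro always_eventually allI real_le_rsqrt char_diff_L2 t)
  show "(\<lambda>n. sqrt (u\<^sup>2 * (\<integral>\<omega>. (X n \<omega> - Y \<omega>)\<^sup>2 \<partial>M))) \<longlonglongrightarrow> 0"
    using tendsto_real_sqrt[OF tendsto_mult_left[OF t(3), of "u\<^sup>2"]] by simp
qed

text \<open>Geometric decay makes the increments summable in mean, hence almost surely; Fatou's lemma
  identifies the pointwise limit as the mean-square limit.\<close>

lemma (in prob_space) L2_complete:
  fixes X :: "nat \<Rightarrow> 'a \<Rightarrow> real"
  assumes X: "\<And>n. X n \<in> L2 M"
    and cau: "\<And>m n. m \<le> n \<Longrightarrow> (\<integral>\<omega>. (X m \<omega> - X n \<omega>)\<^sup>2 \<partial>M) \<le> c * (1/4) ^ m"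
  obtains Y where "L2_tendsto M X Y"
proof -
  have [measurable]: "X n \<in> borel_measurable M" for n using X by auto
  define D where "D n \<omega> = \<bar>X (Suc n) \<omega> - X n \<omega>\<bar>" for n \<omega>
  have c: "c \<ge> 0" using cau[of 0 0] by simp
  have D2: "(\<lambda>\<omega>. X (Suc n) \<omega> - X n \<omega>) \<in> L2 M" for n by (intro L2_diff X)
  have Di: "integrable M (D n)" for n unfolding D_def using L2_integrable[OF D2] by simp
  have Db: "(\<integral>\<omega>. D n \<omega> \<partial>M) \<le> sqrt c * (1/2) ^ n" for n
  proof (rule power2_le_imp_le)
    have "(\<integral>\<omega>. D n \<omega> \<partial>M)\<^sup>2 \<le> (\<integral>\<omega>. (X (Suc n) \<omega> - X n \<omega>)\<^sup>2 \<partial>M)"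
      unfolding D_def by (rule L2_integral_abs_le[OF D2])
    also have "\<dots> \<le> c * (1/4) ^ n" using cau[of n "Suc n"] by (simp add: power2_commute)
    also have "\<dots> = (sqrt c * (1/2) ^ n)\<^sup>2" using c
      by (simp add: power_mult_distrib power2_eq_square power_divide flip: power_mult_distrib)
    finally show "(\<integral>\<omega>. D n \<omega> \<partial>M)\<^sup>2 \<le> (sqrt c * (1/2) ^ n)\<^sup>2" .
  qed (use c in simp)
  have "(\<integral>\<^sup>+\<omega>. (\<Sum>n. ennreal (D n \<omega>)) \<partial>M) = (\<Sum>n. \<integral>\<^sup>+\<omega>. ennreal (D n \<omega>) \<partial>M)"
    unfolding D_def by (rule nn_integral_suminf) measurable
  also have "\<dots> \<le> (\<Sum>n. ennreal (sqrt c * (1/2) ^ n))"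
  proof (intro suminf_le)
    show "(\<integral>\<^sup>+\<omega>. ennreal (D n \<omega>) \<partial>M) \<le> ennreal (sqrt c * (1/2) ^ n)" for n
      using Db[of n] by (subst nn_integral_eq_integral[OF Di]) (auto simp: D_def[abs_def] intro!: ennreal_leI)
  qed auto
  also have "\<dots> = ennreal (\<Sum>n. sqrt c * (1/2) ^ n)"
    using c by (intro suminf_ennreal2) (auto intro!: summable_mult summable_geometric)
  also have "\<dots> < \<infinity>" by simp
  finally have "(\<integral>\<^sup>+\<omega>. (\<Sum>n. ennreal (D n \<omega>)) \<partial>M) \<noteq> \<infinity>" by simp
  then have "AE \<omega> in M. (\<Sum>n. ennreal (D n \<omega>)) \<noteq> \<infinity>"
    by (intro nn_integral_noteq_infinite) (auto simp: D_def)
  then have conv: "AE \<omega> in M. convergent (\<lambda>n. X n \<omega>)"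
  proof eventually_elim
    case (elim \<omega>)
    then have "summable (\<lambda>n. D n \<omega>)"
      by (intro summable_suminf_not_top) (auto simp: D_def)
    then have "summable (\<lambda>n. X (Suc n) \<omega> - X n \<omega>)"
      unfolding D_def by (rule summable_rabs_cancel)
    moreover have "(\<lambda>n. \<Sum>i<n. X (Suc i) \<omega> - X i \<omega>) = (\<lambda>n. X n \<omega> - X 0 \<omega>)"
      by (simp add: sum_lessThan_telescope[of "\<lambda>i. X i \<omega>"])
    ultimately show ?case
      by (simp add: summable_iff_convergent convergent_diff_const_right_iff)
  qed
  define Y where "Y \<omega> = lim (\<lambda>n. X n \<omega>)" for \<omega>
  have [measurable]: "Y \<in> borel_measurable M" unfolding Y_def by measurable
  have lim: "AE \<omega> in M. (\<lambda>n. X n \<omega>) \<longlonglongrightarrow> Y \<omega>"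
    using conv unfolding Y_def by eventually_elim (simp add: convergent_LIMSEQ_iff)
  have fat: "(\<integral>\<^sup>+\<omega>. ennreal ((X m \<omega> - Y \<omega>)\<^sup>2) \<partial>M) \<le> ennreal (c * (1/4) ^ m)" for m
  proof -
    have "(\<integral>\<^sup>+\<omega>. ennreal ((X m \<omega> - Y \<omega>)\<^sup>2) \<partial>M) = (\<integral>\<^sup>+\<omega>. liminf (\<lambda>n. ennreal ((X m \<omega> - X n \<omega>)\<^sup>2)) \<partial>M)"
    proof (rule nn_integral_cong_AE, use lim in eventually_elim)
      case (elim \<omega>)
      have l: "(\<lambda>n. ennreal ((X m \<omega> - X n \<omega>)\<^sup>2)) \<longlonglongrightarrow> ennreal ((X m \<omega> - Y \<omega>)\<^sup>2)"
        by (intro tendsto_intros elim)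
      then show ?case using lim_imp_Liminf[OF sequentially_bot l] by simp
    qed
    also have "\<dots> \<le> liminf (\<lambda>n. \<integral>\<^sup>+\<omega>. ennreal ((X m \<omega> - X n \<omega>)\<^sup>2) \<partial>M)"
      by (rule nn_integral_liminf) measurable
    also have "\<dots> \<le> ennreal (c * (1/4) ^ m)"
    proof (rule Liminf_le)
      show "\<forall>\<^sub>F n in sequentially. (\<integral>\<^sup>+\<omega>. ennreal ((X m \<omega> - X n \<omega>)\<^sup>2) \<partial>M) \<le> ennreal (c * (1/4) ^ m)"
        using eventually_ge_at_top[of m]
      proof eventually_elim
        case (elim n)
        have "integrable M (\<lambda>\<omega>. (X m \<omega> - X n \<omega>)\<^sup>2)" by (intro L2_D(2) L2_diff X)
        then show ?case using cau[OF elim] by (simp add: nn_integral_eq_integral ennreal_leI)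
      qed
    qed simp
    finally show ?thesis by blast
  qed
  have XY: "(\<lambda>\<omega>. X m \<omega> - Y \<omega>) \<in> L2 M" for m
  proof -
    have "integrable M (\<lambda>\<omega>. (X m \<omega> - Y \<omega>)\<^sup>2)"
    proof (rule integrableI_nonneg)
      show "(\<integral>\<^sup>+\<omega>. ennreal ((X m \<omega> - Y \<omega>)\<^sup>2) \<partial>M) < \<infinity>"
        using fat[of m] le_less_trans ennreal_less_top infinity_ennreal_def by metis
    qed auto
    moreover have "(\<lambda>\<omega>. X m \<omega> - Y \<omega>) \<in> borel_measurable M" by measurable
    ultimately show ?thesis unfolding L2_def by blast
  qed
  have "Y \<in> L2 M" using L2_lincomb[OF X[of 0] XY[of 0], of 1 "-1"] by simp
  moreover have "(\<lambda>n. \<integral>\<omega>. (X n \<omega> - Y \<omega>)\<^sup>2 \<partial>M) \<longlonglongrightarrow> 0"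
  proof (rule Lim_null_comparison)
    show "\<forall>\<^sub>F n in sequentially. norm (\<integral>\<omega>. (X n \<omega> - Y \<omega>)\<^sup>2 \<partial>M) \<le> c * (1/4) ^ n"
    proof (intro always_eventually allI)
      fix n
      have "ennreal (\<integral>\<omega>. (X n \<omega> - Y \<omega>)\<^sup>2 \<partial>M) \<le> ennreal (c * (1/4) ^ n)"
        using fat[of n] L2_D(2)[OF XY[of n]] by (subst (asm) nn_integral_eq_integral) auto
      then show "norm (\<integral>\<omega>. (X n \<omega> - Y \<omega>)\<^sup>2 \<partial>M) \<le> c * (1/4) ^ n" using c by simp
    qed
    show "(\<lambda>n. c * (1/4) ^ n) \<longlonglongrightarrow> 0"
      by (auto intro!: tendsto_mult_right_zero LIMSEQ_realpow_zero)
  qed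
  ultimately show thesis using X by (intro that[of Y]) (auto simp: L2_tendsto_def)
qed

section \<open>Wiener integrals against Brownian motion\<close>

lemma char_scaled_std_normal:
  "char (distr std_normal_distribution borel (\<lambda>z. c * z)) u = char std_normal_distribution (u * c)"
proof -
  have "char (distr std_normal_distribution borel (\<lambda>z. c * z)) u
      = (\<integral>z. iexp (u * (c * z)) \<partial>std_normal_distribution)"
    unfolding char_def by (rule integral_distr) simp_all
  then show ?thesis unfolding char_def by (simp only: mult.assoc)
qed

locale brownian =
  fixes M :: "'a measure" and B :: "real \<Rightarrow> 'a \<Rightarrow> real" and T :: real
  assumes bm: "standard_brownian_motion M B" and T_pos: "0 < T"
begin

sublocale prob_space M
  using bm by (simp add: standard_brownian_motion_def)

lemma B_measurable: "0 \<le> t \<Longrightarrow> B t \<in> borel_measurable M"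
  using bm by (simp add: standard_brownian_motion_def)

lemma increment_std_normal:
  assumes "0 \<le> s" "s < t"
  shows "distr M borel (\<lambda>\<omega>. (B t \<omega> - B s \<omega>) / sqrt (t - s)) = std_normal_distribution"
proof -
  have "distributed M lborel (\<lambda>\<omega>. B t \<omega> - B s \<omega>) (normal_density 0 (sqrt (t - s)))"
    using bm assms by (simp add: standard_brownian_motion_def)
  then have "distributed M lborel (\<lambda>\<omega>. (B t \<omega> - B s \<omega> - 0) / sqrt (t - s)) std_normal_density"
    using assms by (subst (asm) normal_standard_normal_convert) auto
  then have "distr M lborel (\<lambda>\<omega>. (B t \<omega> - B s \<omega>) / sqrt (t - s)) = std_normal_distribution"
    by (simp add: distributed_def)
  then show ?thesis by (simp cong: distr_cong)
qed

lemma increment_expectation: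
  fixes f :: "real \<Rightarrow> 'b::{banach, second_countable_topology}"
  assumes "0 \<le> s" "s < t" and f[measurable]: "f \<in> borel_measurable borel"
  shows "expectation (\<lambda>\<omega>. f (B t \<omega> - B s \<omega>)) = integral\<^sup>L std_normal_distribution (\<lambda>x. f (sqrt (t - s) * x))"
    and "integrable std_normal_distribution (\<lambda>x. f (sqrt (t - s) * x)) \<Longrightarrow> integrable M (\<lambda>\<omega>. f (B t \<omega> - B s \<omega>))"
proof -
  have [measurable]: "B t \<in> borel_measurable M" "B s \<in> borel_measurable M" using assms by (auto intro: B_measurable)
  have eq: "f (B t \<omega> - B s \<omega>) = f (sqrt (t - s) * ((B t \<omega> - B s \<omega>) / sqrt (t - s)))" for \<omega>
    using assms by simp
  show "expectation (\<lambda>\<omega>. f (B t \<omega> - B s \<omega>)) = integral\<^sup>L std_normal_distribution (\<lambda>x. f (sqrt (t - s) * x))"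
    unfolding increment_std_normal[OF assms(1,2), symmetric] by (subst integral_distr) (use eq in auto)
  show "integrable M (\<lambda>\<omega>. f (B t \<omega> - B s \<omega>))" if "integrable std_normal_distribution (\<lambda>x. f (sqrt (t - s) * x))"
    using that unfolding increment_std_normal[OF assms(1,2), symmetric] by (subst (asm) integrable_distr_eq) (use eq in auto)
qed

lemma std_normal_square: "integral\<^sup>L std_normal_distribution (\<lambda>x. x\<^sup>2) = 1"
  using std_normal_distribution_even_moments(1)[of 1] by (simp add: fact_numeral)

lemma std_normal_fourth: "integral\<^sup>L std_normal_distribution (\<lambda>x. x ^ 4) = 3"
  using std_normal_distribution_even_moments(1)[of 2] by (simp add: fact_numeral)

lemma increment_square:
  assumes "0 \<le> s" "s \<le> t"
  shows "expectation (\<lambda>\<omega>. (B t \<omega> - B s \<omega>)\<^sup>2) = t - s" and "(\<lambda>\<omega>. B t \<omega> - B s \<omega>) \<in> L2 M"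
proof -
  have "expectation (\<lambda>\<omega>. (B t \<omega> - B s \<omega>)\<^sup>2) = t - s \<and> integrable M (\<lambda>\<omega>. (B t \<omega> - B s \<omega>)\<^sup>2)"
  proof (cases "s = t")
    case False
    have "integrable std_normal_distribution (\<lambda>x. (sqrt (t - s) * x)\<^sup>2)"
      by (simp add: power_mult_distrib integrable_std_normal_distribution_moment)
    then show ?thesis
      using increment_expectation[of s t "\<lambda>x. x\<^sup>2"] assms False std_normal_square
      by (simp add: power_mult_distrib)
  qed simp
  then show "expectation (\<lambda>\<omega>. (B t \<omega> - B s \<omega>)\<^sup>2) = t - s" "(\<lambda>\<omega>. B t \<omega> - B s \<omega>) \<in> L2 M"
    using B_measurable[of s] B_measurable[of t] assms by (auto simp: L2_def)
qed

lemma increment_char: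
  assumes "0 \<le> s" "s \<le> t"
  shows "expectation (\<lambda>\<omega>. iexp (u * (B t \<omega> - B s \<omega>))) = exp (- (u\<^sup>2 * (t - s) / 2))"
proof (cases "s = t")
  case False
  have "expectation (\<lambda>\<omega>. iexp (u * (B t \<omega> - B s \<omega>))) = char std_normal_distribution (u * sqrt (t - s))"
    using increment_expectation(1)[of s t "\<lambda>x. iexp (u * x)"] assms False
    by (simp add: char_def mult.assoc)
  then show ?thesis using assms by (simp add: char_std_normal_distribution power_mult_distrib exp_of_real)
qed (simp add: prob_space)

subsection \<open>Step functions on a uniform grid\<close>

definition grid :: "nat \<Rightarrow> nat \<Rightarrow> real" where
  "grid n k = T * real k / real n"

definition cell :: "nat \<Rightarrow> nat \<Rightarrow> real set" where
  "cell n k = {grid n k<..grid n (Suc k)}"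

definition step :: "nat \<Rightarrow> (nat \<Rightarrow> real) \<Rightarrow> real \<Rightarrow> real" where
  "step n c t = (\<Sum>k<n. c k * indicator (cell n k) t)"

definition step_integral :: "nat \<Rightarrow> (nat \<Rightarrow> real) \<Rightarrow> 'a \<Rightarrow> real" where
  "step_integral n c \<omega> = (\<Sum>k<n. c k * (B (grid n (Suc k)) \<omega> - B (grid n k) \<omega>))"

lemma grid_0: "grid n 0 = 0" by (simp add: grid_def)

lemma grid_nonneg: "0 \<le> grid n k"
  using T_pos by (simp add: grid_def)

lemma grid_mono: "j \<le> k \<Longrightarrow> grid n j \<le> grid n k"
  using T_pos by (simp add: grid_def divide_right_mono)

lemma grid_le_T: "k \<le> n \<Longrightarrow> grid n k \<le> T"
  using T_pos by (cases "n = 0") (simp_all add: grid_def pos_divide_le_eq)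

lemma grid_Suc_diff: "grid n (Suc k) - grid n k = T / real n"
  by (simp add: grid_def algebra_simps add_divide_distrib)

abbreviation I :: "real measure" where "I \<equiv> lebesgue_interval T"

lemma measure_I: "A \<in> sets borel \<Longrightarrow> A \<subseteq> {0..T} \<Longrightarrow> measure I A = measure lborel A"
  by (rule measure_restrict_space) auto

lemma finite_measure_I: "finite_measure I"
  by (rule finite_measureI) (use T_pos in \<open>simp add: space_restrict_space emeasure_restrict_space\<close>)

lemma indicator_measurable_I: "A \<in> sets borel \<Longrightarrow> (indicator A :: real \<Rightarrow> real) \<in> borel_measurable I"
  by (intro measurable_restrict_space1) auto

lemma indicator_L2_I: "A \<in> sets borel \<Longrightarrow> (indicator A :: real \<Rightarrow> real) \<in> L2 I"
proof -
  assume A: "A \<in> sets borel"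
  interpret I: finite_measure I by (rule finite_measure_I)
  have "(\<lambda>x. (indicator A x :: real)\<^sup>2) = indicator A" by (auto simp: indicator_def)
  moreover have "integrable I (indicator A :: real \<Rightarrow> real)"
    using indicator_measurable_I[OF A]
    by (intro I.integrable_const_bound[where B=1]) (auto simp: indicator_def)
  ultimately have "integrable I (\<lambda>x. (indicator A x :: real)\<^sup>2)" by simp
  then show ?thesis using indicator_measurable_I[OF A] by (simp add: L2_def)
qed

lemma integral_indicator_I:
  assumes "A \<in> sets borel" "A \<subseteq> {0..T}"
  shows "(\<integral>t. indicator A t \<partial>I) = measure lborel A"
proof -
  have "(\<integral>t. indicator A t \<partial>I) = measure I (A \<inter> space I)" by (rule Bochner_Integration.integral_indicator)
  also have "A \<inter> space I = A" using assms by (auto simp: space_restrict_space)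
  finally show ?thesis using measure_I[OF assms] by simp
qed

lemma cell_subset: "k < n \<Longrightarrow> cell n k \<subseteq> {0..T}"
  using grid_nonneg[of n k] grid_le_T[of "Suc k" n] by (auto simp: cell_def)

lemma cell_disjoint: "j \<noteq> k \<Longrightarrow> cell n j \<inter> cell n k = {}"
proof -
  have "cell n j \<inter> cell n k = {}" if "j < k" for j k
    using grid_mono[of "Suc j" k n] that by (auto simp: cell_def)
  then show "j \<noteq> k \<Longrightarrow> cell n j \<inter> cell n k = {}" by (metis Int_commute linorder_neqE_nat)
qed

lemma cell_sets: "cell n k \<in> sets borel" by (simp add: cell_def)

lemma measure_cell: "measure lborel (cell n k) = T / n"
  unfolding cell_def using grid_mono[of k "Suc k" n] grid_Suc_diff[of n k] by simp

lemma step_L2: "step n c \<in> L2 I"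
proof -
  have "(\<lambda>t. \<Sum>k<n. c k * indicator (cell n k) t) \<in> L2 I"
    by (intro L2_sum L2_scale indicator_L2_I cell_sets)
  then show ?thesis unfolding step_def[abs_def] .
qed

lemma step_mult: "step n c t * step n d t = step n (\<lambda>k. c k * d k) t"
proof -
  have "step n c t * step n d t = (\<Sum>k<n. \<Sum>l<n. (c k * d l) * (indicator (cell n k) t * indicator (cell n l) t))"
    unfolding step_def sum_product by (simp add: mult_ac)
  also have "\<dots> = (\<Sum>k<n. \<Sum>l<n. if l = k then c k * d k * indicator (cell n k) t else 0)"
  proof (intro sum.cong refl)
    fix k l
    show "(c k * d l) * (indicator (cell n k) t * indicator (cell n l) t) =
      (if l = k then c k * d k * indicator (cell n k) t else 0)"
      using cell_disjoint[of k l n] by (auto simp: indicator_def)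
  qed
  also have "\<dots> = step n (\<lambda>k. c k * d k) t" by (simp add: step_def)
  finally show ?thesis .
qed

lemma integral_step: "(\<integral>t. step n c t \<partial>I) = T / n * (\<Sum>k<n. c k)"
proof -
  have "(\<integral>t. step n c t \<partial>I) = (\<Sum>k<n. c k * (\<integral>t. indicator (cell n k) t \<partial>I))"
    unfolding step_def
  proof (subst Bochner_Integration.integral_sum)
    interpret I: finite_measure I by (rule finite_measure_I)
    show "integrable I (\<lambda>x. c k * indicator (cell n k) x)" for k
      by (intro integrable_mult_right I.integrable_const_bound[where B=1] indicator_measurable_I cell_sets) auto
  qed simp
  also have "\<dots> = (\<Sum>k<n. c k * (T / n))"
    by (intro sum.cong refl) (metis cell_subset cell_sets integral_indicator_I measure_cell lessThan_iff)
  also have "\<dots> = (\<Sum>k<n. c k) * (T / n)" by (rule sum_distrib_right[symmetric])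
  finally show ?thesis by (simp only: mult.commute)
qed

lemma integral_step_mult: "(\<integral>t. step n c t * step n d t \<partial>I) = T / n * (\<Sum>k<n. c k * d k)"
  by (simp add: step_mult integral_step)

lemma step_integral_L2: "step_integral n c \<in> L2 M"
proof -
  have "(\<lambda>\<omega>. \<Sum>k<n. c k * (B (grid n (Suc k)) \<omega> - B (grid n k) \<omega>)) \<in> L2 M"
    by (intro L2_sum L2_scale increment_square grid_nonneg grid_mono) simp
  then show ?thesis unfolding step_integral_def[abs_def] .
qed

lemma step_lincomb: "step n (\<lambda>k. a * c k + b * d k) t = a * step n c t + b * step n d t"
  unfolding step_def sum_distrib_left sum.distrib[symmetric] by (simp only: distrib_right mult.assoc)

lemma step_integral_lincomb:
  "step_integral n (\<lambda>k. a * c k + b * d k) \<omega> = a * step_integral n c \<omega> + b * step_integral n d \<omega>"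
  by (simp add: step_integral_def sum_distrib_left sum.distrib distrib_right mult.assoc)

text \<open>The increments over the cells are independent, so the characteristic function factorises.\<close>

lemma step_integral_char:
  "expectation (\<lambda>\<omega>. iexp (u * step_integral n c \<omega>)) = exp (- (u\<^sup>2 * (T / n * (\<Sum>k<n. (c k)\<^sup>2)) / 2))"
proof -
  define D where "D k \<omega> = B (grid n (Suc k)) \<omega> - B (grid n k) \<omega>" for k \<omega>
  have [measurable]: "D k \<in> borel_measurable M" for k
    unfolding D_def using B_measurable grid_nonneg by measurable
  have "indep_vars (\<lambda>_. borel) D {..<n}"
    using bm grid_0 grid_mono unfolding D_def[abs_def] standard_brownian_motion_def by auto
  then have ind: "indep_vars (\<lambda>_. borel) (\<lambda>k \<omega>. c k * D k \<omega>) {..<n}"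
    by (rule indep_vars_compose2) simp
  have "expectation (\<lambda>\<omega>. iexp (u * step_integral n c \<omega>)) = char (distr M borel (\<lambda>\<omega>. \<Sum>k<n. c k * D k \<omega>)) u"
    unfolding char_def step_integral_def D_def[symmetric] by (subst integral_distr) auto
  also have "\<dots> = (\<Prod>k<n. char (distr M borel (\<lambda>\<omega>. c k * D k \<omega>)) u)"
    by (rule char_distr_sum[OF ind])
  also have "\<dots> = (\<Prod>k<n. complex_of_real (exp (- ((u * c k)\<^sup>2 * (T / n) / 2))))"
  proof (rule prod.cong[OF refl])
    fix k
    have "char (distr M borel (\<lambda>\<omega>. c k * D k \<omega>)) u = expectation (\<lambda>\<omega>. iexp ((u * c k) * D k \<omega>))"
      unfolding char_def by (subst integral_distr) (auto simp: mult.assoc)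
    also have "\<dots> = complex_of_real (exp (- ((u * c k)\<^sup>2 * (T / n) / 2)))"
      unfolding D_def using increment_char[of "grid n k" "grid n (Suc k)" "u * c k"] grid_nonneg grid_mono[of k "Suc k" n]
      by (simp only: grid_Suc_diff simp_thms)
    finally show "char (distr M borel (\<lambda>\<omega>. c k * D k \<omega>)) u = complex_of_real (exp (- ((u * c k)\<^sup>2 * (T / n) / 2)))" .
  qed
  also have "\<dots> = complex_of_real (exp (\<Sum>k<n. - ((u * c k)\<^sup>2 * (T / n) / 2)))"
    by (simp only: exp_sum[OF finite_lessThan] of_real_prod)
  also have "(\<Sum>k<n. - ((u * c k)\<^sup>2 * (T / n) / 2)) = - (u\<^sup>2 * (T / n * (\<Sum>k<n. (c k)\<^sup>2)) / 2)"
    by (simp add: sum_negf sum_distrib_left sum_divide_distrib power_mult_distrib mult_ac)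
  finally show ?thesis .
qed

lemma has_wiener_integral_zero: "has_wiener_integral M B T (\<lambda>t. 0) (\<lambda>\<omega>. 0)"
  using has_wiener_integral.linear[OF has_wiener_integral.interval has_wiener_integral.interval,
      of 0 0 T 0 0 M B 0 0] T_pos by simp

lemma has_wiener_integral_sum:
  "(\<And>i::nat. i < n \<Longrightarrow> has_wiener_integral M B T (h i) (X i)) \<Longrightarrow>
   has_wiener_integral M B T (\<lambda>t. \<Sum>i<n. c i * h i t) (\<lambda>\<omega>. \<Sum>i<n. c i * X i \<omega>)"
proof (induction n)
  case (Suc n)
  have "has_wiener_integral M B T (\<lambda>t. 1 * (\<Sum>i<n. c i * h i t) + c n * h n t) (\<lambda>\<omega>. 1 * (\<Sum>i<n. c i * X i \<omega>) + c n * X n \<omega>)"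
    by (intro has_wiener_integral.linear Suc) auto
  then show ?case by simp
qed (simp add: has_wiener_integral_zero)

lemma has_wiener_integral_step: "has_wiener_integral M B T (step n c) (step_integral n c)"
  unfolding step_def[abs_def] step_integral_def[abs_def] cell_def
  by (intro has_wiener_integral_sum has_wiener_integral.interval grid_nonneg grid_mono grid_le_T) auto

subsection \<open>Every Wiener integral is a limit of step integrals\<close>

text \<open>Approximation is required on every sufficiently fine grid rather than along some sequence of
  grids. Two approximations can then be taken on a common grid, which makes the property closed
  under linear combinations, and an \<open>\<epsilon>/4\<close> argument makes it closed under
  limits.\<close>

definition approximable :: "(real \<Rightarrow> real) \<Rightarrow> ('a \<Rightarrow> real) \<Rightarrow> bool" where
  "approximable h X \<longleftrightarrow> h \<in> L2 I \<and> X \<in> L2 M \<and>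
     (\<forall>e>0. \<forall>\<^sub>F n in sequentially. \<exists>c. (\<integral>t. (h t - step n c t)\<^sup>2 \<partial>I) < e \<and>
        expectation (\<lambda>\<omega>. (X \<omega> - step_integral n c \<omega>)\<^sup>2) < e)"

lemma scaled_error_bound:
  fixes a b x y e :: real
  assumes "0 \<le> x" "x < e / (2 * a\<^sup>2 + 2 * b\<^sup>2 + 1)" "0 \<le> y" "y < e / (2 * a\<^sup>2 + 2 * b\<^sup>2 + 1)" "0 < e"
  shows "2 * (a\<^sup>2 * x) + 2 * (b\<^sup>2 * y) < e"
proof -
  define d where "d = e / (2 * a\<^sup>2 + 2 * b\<^sup>2 + 1)"
  have p: "0 < 2 * a\<^sup>2 + 2 * b\<^sup>2 + 1" by (simp add: add_nonneg_pos)
  have d: "0 < d" "d * (2 * a\<^sup>2 + 2 * b\<^sup>2 + 1) = e" using p \<open>0 < e\<close> by (auto simp: d_def)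
  have "x \<le> d" "y \<le> d" using assms unfolding d_def by linarith+
  then have "a\<^sup>2 * x \<le> a\<^sup>2 * d" "b\<^sup>2 * y \<le> b\<^sup>2 * d" by (auto intro: mult_left_mono)
  then have "2 * (a\<^sup>2 * x) + 2 * (b\<^sup>2 * y) \<le> d * (2 * a\<^sup>2 + 2 * b\<^sup>2)" by (simp add: algebra_simps)
  also have "\<dots> < d * (2 * a\<^sup>2 + 2 * b\<^sup>2 + 1)" using d(1) by (simp add: distrib_left)
  finally show ?thesis using d(2) by simp
qed

lemma integral_sq_lincomb_error:
  assumes "g \<in> L2 N" "h \<in> L2 N" "p \<in> L2 N" "q \<in> L2 N" "0 < e"
    "(\<integral>t. (g t - p t)\<^sup>2 \<partial>N) < e / (2 * a\<^sup>2 + 2 * b\<^sup>2 + 1)"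
    "(\<integral>t. (h t - q t)\<^sup>2 \<partial>N) < e / (2 * a\<^sup>2 + 2 * b\<^sup>2 + 1)"
  shows "(\<integral>t. ((a * g t + b * h t) - (a * p t + b * q t))\<^sup>2 \<partial>N) < e"
proof -
  have "(\<integral>t. ((a * g t + b * h t) - (a * p t + b * q t))\<^sup>2 \<partial>N)
      = (\<integral>t. (a * (g t - p t) + b * (h t - q t))\<^sup>2 \<partial>N)"
    by (simp add: algebra_simps)
  also have "\<dots> \<le> 2 * (\<integral>t. (a * (g t - p t))\<^sup>2 \<partial>N) + 2 * (\<integral>t. (b * (h t - q t))\<^sup>2 \<partial>N)"
    by (intro integral_sq_triangle L2_scale L2_diff assms)
  also have "\<dots> = 2 * (a\<^sup>2 * (\<integral>t. (g t - p t)\<^sup>2 \<partial>N)) + 2 * (b\<^sup>2 * (\<integral>t. (h t - q t)\<^sup>2 \<partial>N))"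
    by (simp add: power_mult_distrib)
  also have "\<dots> < e" by (rule scaled_error_bound) (use assms in auto)
  finally show ?thesis .
qed

lemma approximable_linear:
  assumes "approximable g X" "approximable h Y"
  shows "approximable (\<lambda>t. a * g t + b * h t) (\<lambda>\<omega>. a * X \<omega> + b * Y \<omega>)"
  unfolding approximable_def
proof (intro conjI allI impI)
  show "(\<lambda>t. a * g t + b * h t) \<in> L2 I" "(\<lambda>\<omega>. a * X \<omega> + b * Y \<omega>) \<in> L2 M"
    using assms by (auto simp: approximable_def intro: L2_lincomb)
  fix e :: real assume e: "0 < e"
  define d where "d = e / (2 * a\<^sup>2 + 2 * b\<^sup>2 + 1)"
  have d: "0 < d" unfolding d_def using e by (simp add: add_nonneg_pos)
  have "\<forall>\<^sub>F n in sequentially. \<exists>c. (\<integral>t. (g t - step n c t)\<^sup>2 \<partial>I) < d \<and> expectation (\<lambda>\<omega>. (X \<omega> - step_integral n c \<omega>)\<^sup>2) < d"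
       "\<forall>\<^sub>F n in sequentially. \<exists>c. (\<integral>t. (h t - step n c t)\<^sup>2 \<partial>I) < d \<and> expectation (\<lambda>\<omega>. (Y \<omega> - step_integral n c \<omega>)\<^sup>2) < d"
    using assms d by (auto simp: approximable_def)
  then show "\<forall>\<^sub>F n in sequentially. \<exists>c. (\<integral>t. (a * g t + b * h t - step n c t)\<^sup>2 \<partial>I) < e \<and>
        expectation (\<lambda>\<omega>. (a * X \<omega> + b * Y \<omega> - step_integral n c \<omega>)\<^sup>2) < e"
  proof eventually_elim
    case (elim n)
    then obtain c c' where c: "(\<integral>t. (g t - step n c t)\<^sup>2 \<partial>I) < d" "expectation (\<lambda>\<omega>. (X \<omega> - step_integral n c \<omega>)\<^sup>2) < d"
      "(\<integral>t. (h t - step n c' t)\<^sup>2 \<partial>I) < d" "expectation (\<lambda>\<omega>. (Y \<omega> - step_integral n c' \<omega>)\<^sup>2) < d" by blast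
    show ?case
      by (rule exI[of _ "\<lambda>k. a * c k + b * c' k"], unfold step_lincomb step_integral_lincomb, intro conjI integral_sq_lincomb_error)
         (use c assms e step_L2 step_integral_L2 in \<open>auto simp: d_def approximable_def\<close>)
  qed
qed

lemma approximable_limit:
  assumes "\<And>n::nat. approximable (h n) (X n)" "L2_tendsto I h g" "L2_tendsto M X Y"
  shows "approximable g Y"
  unfolding approximable_def
proof (intro conjI allI impI)
  note t = L2_tendsto_D[OF assms(2)] L2_tendsto_D[OF assms(3)]
  show "g \<in> L2 I" "Y \<in> L2 M" using t by auto
  fix e :: real assume e: "0 < e"
  have "\<forall>\<^sub>F m in sequentially. (\<integral>x. (h m x - g x)\<^sup>2 \<partial>I) < e / 4"
    using order_tendstoD(2)[OF t(3), of "e / 4"] e by simp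
  moreover have "\<forall>\<^sub>F m in sequentially. expectation (\<lambda>\<omega>. (X m \<omega> - Y \<omega>)\<^sup>2) < e / 4"
    using order_tendstoD(2)[OF t(6), of "e / 4"] e by simp
  ultimately have "\<forall>\<^sub>F m in sequentially. (\<integral>x. (h m x - g x)\<^sup>2 \<partial>I) < e / 4 \<and> expectation (\<lambda>\<omega>. (X m \<omega> - Y \<omega>)\<^sup>2) < e / 4"
    by eventually_elim simp
  then obtain m where m: "(\<integral>x. (h m x - g x)\<^sup>2 \<partial>I) < e / 4" "expectation (\<lambda>\<omega>. (X m \<omega> - Y \<omega>)\<^sup>2) < e / 4"
    using eventually_sequentially by auto
  have "\<forall>\<^sub>F n in sequentially. \<exists>c. (\<integral>t. (h m t - step n c t)\<^sup>2 \<partial>I) < e / 4 \<and>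
      expectation (\<lambda>\<omega>. (X m \<omega> - step_integral n c \<omega>)\<^sup>2) < e / 4"
    using assms(1)[of m, unfolded approximable_def, THEN conjunct2, THEN conjunct2, rule_format, of "e / 4"] e by simp
  then show "\<forall>\<^sub>F n in sequentially. \<exists>c. (\<integral>t. (g t - step n c t)\<^sup>2 \<partial>I) < e \<and>
        expectation (\<lambda>\<omega>. (Y \<omega> - step_integral n c \<omega>)\<^sup>2) < e"
  proof eventually_elim
    case (elim n)
    then obtain c where c: "(\<integral>t. (h m t - step n c t)\<^sup>2 \<partial>I) < e / 4"
      "expectation (\<lambda>\<omega>. (X m \<omega> - step_integral n c \<omega>)\<^sup>2) < e / 4" by blast
    have "(\<integral>t. (g t - step n c t)\<^sup>2 \<partial>I) \<le> 2 * (\<integral>t. (g t - h m t)\<^sup>2 \<partial>I) + 2 * (\<integral>t. (h m t - step n c t)\<^sup>2 \<partial>I)"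
      using integral_sq_triangle[OF L2_diff[OF t(2) t(1)[of m]] L2_diff[OF t(1)[of m] step_L2[of n c]]] by simp
    moreover have "expectation (\<lambda>\<omega>. (Y \<omega> - step_integral n c \<omega>)\<^sup>2)
        \<le> 2 * expectation (\<lambda>\<omega>. (Y \<omega> - X m \<omega>)\<^sup>2) + 2 * expectation (\<lambda>\<omega>. (X m \<omega> - step_integral n c \<omega>)\<^sup>2)"
      using integral_sq_triangle[OF L2_diff[OF t(5) t(4)[of m]] L2_diff[OF t(4)[of m] step_integral_L2[of n c]]] by simp
    ultimately show ?case using c m by (intro exI[of _ c]) (simp add: power2_commute[of "g _"] power2_commute[of "Y _"])
  qed
qed

lemma step_initial:
  assumes "m \<le> n"
  shows "step n (\<lambda>k. if k < m then 1 else 0) t = indicator {0<..grid n m} t"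
    and "step_integral n (\<lambda>k. if k < m then 1 else 0) \<omega> = B (grid n m) \<omega> - B 0 \<omega>"
proof -
  have r: "(\<Sum>k<n. (if k < m then 1 else 0) * f k) = (\<Sum>k<m. f k)" for f :: "nat \<Rightarrow> real"
  proof -
    have "(\<Sum>k<n. (if k < m then 1 else 0) * f k) = (\<Sum>k\<in>{..<n} \<inter> {k. k < m}. f k)"
      by (subst sum.inter_restrict) (auto intro!: sum.cong)
    also have "{..<n} \<inter> {k. k < m} = {..<m}" using assms by auto
    finally show ?thesis .
  qed
  have "(\<Sum>k<m. indicator (cell n k) t) = (indicator {0<..grid n m} t :: real)"
  proof (induction m)
    case (Suc m)
    have "{0<..grid n (Suc m)} = {0<..grid n m} \<union> cell n m" "{0<..grid n m} \<inter> cell n m = {}"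
      using grid_nonneg[of n m] grid_mono[of m "Suc m" n] by (auto simp: cell_def)
    then show ?case using Suc by (simp add: indicator_add[symmetric] indicator_disj_union)
  qed (simp add: grid_0)
  then show "step n (\<lambda>k. if k < m then 1 else 0) t = indicator {0<..grid n m} t"
    by (simp add: step_def r)
  show "step_integral n (\<lambda>k. if k < m then 1 else 0) \<omega> = B (grid n m) \<omega> - B 0 \<omega>"
    unfolding step_integral_def r using sum_lessThan_telescope[of "\<lambda>k. B (grid n k) \<omega>" m] by (simp add: grid_0)
qed

text \<open>Rounding the end point down to the grid costs at most one cell, both for the indicator and for the
  increment of the Brownian motion.\<close>

lemma approximable_initial:
  assumes t: "0 \<le> t" "t \<le> T"
  shows "approximable (indicator {0<..t}) (\<lambda>\<omega>. B t \<omega> - B 0 \<omega>)"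
  unfolding approximable_def
proof (intro conjI allI impI)
  show "indicator {0<..t} \<in> L2 I" by (rule indicator_L2_I) simp
  show "(\<lambda>\<omega>. B t \<omega> - B 0 \<omega>) \<in> L2 M" using t by (intro increment_square) auto
  fix e :: real assume e: "0 < e"
  have "(\<lambda>n. T / real n) \<longlonglongrightarrow> 0" by (rule lim_const_over_n)
  then have "\<forall>\<^sub>F n in sequentially. T / real n < e" by (rule order_tendstoD(2)) (rule e)
  then show "\<forall>\<^sub>F n in sequentially. \<exists>c. (\<integral>x. (indicator {0<..t} x - step n c x)\<^sup>2 \<partial>I) < e \<and>
        expectation (\<lambda>\<omega>. (B t \<omega> - B 0 \<omega> - step_integral n c \<omega>)\<^sup>2) < e"
    using eventually_gt_at_top[of 0]
  proof eventually_elim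
    case (elim n)
    \<comment> \<open>the last grid point up to \<open>t\<close>\<close>
    define m where "m = nat \<lfloor>t * n / T\<rfloor>"
    have "real m \<le> t * n / T" "t * n / T < real m + 1"
      unfolding m_def using t T_pos by auto
    then have g: "grid n m \<le> t" "t < grid n m + T / n"
      using T_pos elim by (auto simp: grid_def field_simps)
    have "t * n / T \<le> n" using t T_pos by (simp add: pos_divide_le_eq mult.commute[of n] mult_right_mono mult.commute[of "real n"])
    then have mn: "m \<le> n" using \<open>real m \<le> t * n / T\<close> by linarith
    let ?c = "\<lambda>k. if k < m then 1 else 0"
    have "(\<integral>x. (indicator {0<..t} x - step n ?c x)\<^sup>2 \<partial>I) = (\<integral>x. indicator {grid n m<..t} x \<partial>I)"
    proof (rule Bochner_Integration.integral_cong[OF refl])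
      fix x
      have "step n ?c x = indicator {0<..grid n m} x" by (rule step_initial(1)[OF mn])
      then show "(indicator {0<..t} x - step n ?c x)\<^sup>2 = (indicator {grid n m<..t} x :: real)"
        using g(1) grid_nonneg[of n m] by (simp only:) (auto simp: indicator_def)
    qed
    also have "\<dots> = t - grid n m"
      using g grid_nonneg[of n m] t by (subst integral_indicator_I) auto
    finally have 1: "(\<integral>x. (indicator {0<..t} x - step n ?c x)\<^sup>2 \<partial>I) < e" using g elim by linarith
    have "expectation (\<lambda>\<omega>. (B t \<omega> - B 0 \<omega> - step_integral n ?c \<omega>)\<^sup>2) = expectation (\<lambda>\<omega>. (B t \<omega> - B (grid n m) \<omega>)\<^sup>2)"
      unfolding step_initial(2)[OF mn] by simp
    also have "\<dots> = t - grid n m" by (intro increment_square grid_nonneg g)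
    finally have "expectation (\<lambda>\<omega>. (B t \<omega> - B 0 \<omega> - step_integral n ?c \<omega>)\<^sup>2) < e" using g elim by linarith
    with 1 show ?case by blast
  qed
qed

lemma has_wiener_integral_approximable:
  "has_wiener_integral M B T h X \<Longrightarrow> approximable h X"
proof (induction rule: has_wiener_integral.induct)
  case (interval s t)
  have "approximable (\<lambda>x. 1 * indicator {0<..t} x + (-1) * indicator {0<..s} x)
      (\<lambda>\<omega>. 1 * (B t \<omega> - B 0 \<omega>) + (-1) * (B s \<omega> - B 0 \<omega>))"
    using interval by (intro approximable_linear approximable_initial) auto
  moreover have "(\<lambda>x. 1 * indicator {0<..t} x + (-1) * indicator {0<..s} x) = (indicator {s<..t} :: real \<Rightarrow> real)"
    using interval by (intro ext) (auto simp: indicator_def)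
  ultimately show ?case by simp
qed (auto intro: approximable_linear approximable_limit)

lemma has_wiener_integral_L2:
  "has_wiener_integral M B T h X \<Longrightarrow> h \<in> L2 I"
  "has_wiener_integral M B T h X \<Longrightarrow> X \<in> L2 M"
  using has_wiener_integral_approximable by (auto simp: approximable_def)

text \<open>Step integrals are Gaussian, and both sides of the formula are continuous under the approximation.\<close>

lemma has_wiener_integral_char:
  assumes "has_wiener_integral M B T h X"
  shows "expectation (\<lambda>\<omega>. iexp (u * X \<omega>)) = exp (- (u\<^sup>2 * (\<integral>t. (h t)\<^sup>2 \<partial>I) / 2))"
proof -
  have ap: "h \<in> L2 I" "X \<in> L2 M" "\<And>e. e > 0 \<Longrightarrow> \<exists>n c. (\<integral>t. (h t - step n c t)\<^sup>2 \<partial>I) < e \<and>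
        expectation (\<lambda>\<omega>. (X \<omega> - step_integral n c \<omega>)\<^sup>2) < e"
    using has_wiener_integral_approximable[OF assms] eventually_happens'[OF sequentially_bot]
    unfolding approximable_def by blast+
  have "\<forall>j::nat. \<exists>n c. (\<integral>t. (h t - step n c t)\<^sup>2 \<partial>I) < 1 / real (Suc j) \<and>
        expectation (\<lambda>\<omega>. (X \<omega> - step_integral n c \<omega>)\<^sup>2) < 1 / real (Suc j)"
    by (intro allI ap(3)) simp
  from this[unfolded choice_iff] obtain n c where
    "\<forall>j. (\<integral>t. (h t - step (n j) (c j) t)\<^sup>2 \<partial>I) < 1 / real (Suc j) \<and>
     expectation (\<lambda>\<omega>. (X \<omega> - step_integral (n j) (c j) \<omega>)\<^sup>2) < 1 / real (Suc j)" by (elim exE)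
  then have nc: "\<And>j. (\<integral>t. (h t - step (n j) (c j) t)\<^sup>2 \<partial>I) < 1 / real (Suc j)"
     "\<And>j. expectation (\<lambda>\<omega>. (X \<omega> - step_integral (n j) (c j) \<omega>)\<^sup>2) < 1 / real (Suc j)" by auto
  have 0: "(\<lambda>j. 1 / real (Suc j)) \<longlonglongrightarrow> 0" using LIMSEQ_inverse_real_of_nat by (simp add: inverse_eq_divide)
  have 1: "L2_tendsto I (\<lambda>j. step (n j) (c j)) h"
    unfolding L2_tendsto_def
  proof (intro conjI allI step_L2 ap(1) tendsto_sandwich[OF _ _ tendsto_const 0])
    show "\<forall>\<^sub>F j in sequentially. 0 \<le> (\<integral>x. (step (n j) (c j) x - h x)\<^sup>2 \<partial>I)" by simp
    show "\<forall>\<^sub>F j in sequentially. (\<integral>x. (step (n j) (c j) x - h x)\<^sup>2 \<partial>I) \<le> 1 / real (Suc j)"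
      using nc(1) by (simp add: power2_commute[of _ "h _"] less_imp_le)
  qed
  have 2: "L2_tendsto M (\<lambda>j. step_integral (n j) (c j)) X"
    unfolding L2_tendsto_def
  proof (intro conjI allI step_integral_L2 ap(2) tendsto_sandwich[OF _ _ tendsto_const 0])
    show "\<forall>\<^sub>F j in sequentially. 0 \<le> expectation (\<lambda>x. (step_integral (n j) (c j) x - X x)\<^sup>2)" by simp
    show "\<forall>\<^sub>F j in sequentially. expectation (\<lambda>x. (step_integral (n j) (c j) x - X x)\<^sup>2) \<le> 1 / real (Suc j)"
      using nc(2) by (simp add: power2_commute[of _ "X _"] less_imp_le)
  qed
  have "(\<integral>x. (step (n j) (c j) x)\<^sup>2 \<partial>I) = T / n j * (\<Sum>k<n j. (c j k)\<^sup>2)" for j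
    using integral_step_mult[of "n j" "c j" "c j"] by (simp add: power2_eq_square)
  then have "(\<lambda>j. T / n j * (\<Sum>k<n j. (c j k)\<^sup>2)) \<longlonglongrightarrow> (\<integral>t. (h t)\<^sup>2 \<partial>I)"
    using L2_tendsto_integral_sq[OF 1] by simp
  then have "(\<lambda>j. complex_of_real (exp (- (u\<^sup>2 * (T / n j * (\<Sum>k<n j. (c j k)\<^sup>2)) / 2))))
     \<longlonglongrightarrow> exp (- (u\<^sup>2 * (\<integral>t. (h t)\<^sup>2 \<partial>I) / 2))"
    by (intro tendsto_intros) simp_all
  moreover have "(\<lambda>j. complex_of_real (exp (- (u\<^sup>2 * (T / n j * (\<Sum>k<n j. (c j k)\<^sup>2)) / 2))))
      \<longlonglongrightarrow> expectation (\<lambda>\<omega>. iexp (u * X \<omega>))"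
    using L2_tendsto_char[OF 2, of u] unfolding step_integral_char .
  ultimately show ?thesis by (rule LIMSEQ_unique[rotated])
qed

text \<open>The law is expressed as a scaled standard normal law instead of a normal density, so that the
  degenerate case of a null integrand is included.\<close>

lemma has_wiener_integral_expectation:
  fixes f :: "real \<Rightarrow> 'b::{banach, second_countable_topology}"
  assumes X: "has_wiener_integral M B T h X" and f[measurable]: "f \<in> borel_measurable borel"
  defines "v \<equiv> \<integral>t. (h t)\<^sup>2 \<partial>I"
  shows "expectation (\<lambda>\<omega>. f (X \<omega>)) = integral\<^sup>L std_normal_distribution (\<lambda>z. f (sqrt v * z))"
    and "integrable std_normal_distribution (\<lambda>z. f (sqrt v * z)) \<Longrightarrow> integrable M (\<lambda>\<omega>. f (X \<omega>))"
proof -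
  have [measurable]: "X \<in> borel_measurable M" using has_wiener_integral_L2(2)[OF X] by auto
  interpret N: prob_space std_normal_distribution by (rule prob_space_normal_density) simp
  have v: "0 \<le> v" unfolding v_def by simp
  have c: "char (distr M borel X) = char (distr std_normal_distribution borel (\<lambda>z. sqrt v * z))"
  proof
    fix u
    have "char (distr M borel X) u = expectation (\<lambda>\<omega>. iexp (u * X \<omega>))"
      unfolding char_def by (subst integral_distr) auto
    also have "\<dots> = char std_normal_distribution (u * sqrt v)"
    proof -
      have "(u * sqrt v)\<^sup>2 = u\<^sup>2 * v" using v by (simp add: power_mult_distrib)
      then show ?thesis
        unfolding has_wiener_integral_char[OF X] char_std_normal_distribution v_def[symmetric]
        by (simp only: minus_divide_left)
    qed
    also have "\<dots> = char (distr std_normal_distribution borel (\<lambda>z. sqrt v * z)) u"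
      by (rule char_scaled_std_normal[symmetric])
    finally show "char (distr M borel X) u = char (distr std_normal_distribution borel (\<lambda>z. sqrt v * z)) u" .
  qed
  have r: "real_distribution (distr M borel X)" by (rule real_distribution_distr) simp
  have r': "real_distribution (distr std_normal_distribution borel (\<lambda>z. sqrt v * z))"
    by (rule N.real_distribution_distr) simp
  have eq: "distr M borel X = distr std_normal_distribution borel (\<lambda>z. sqrt v * z)"
    by (rule Levy_uniqueness[OF r r' c])
  show "expectation (\<lambda>\<omega>. f (X \<omega>)) = integral\<^sup>L std_normal_distribution (\<lambda>z. f (sqrt v * z))"
  proof -
    have "expectation (\<lambda>\<omega>. f (X \<omega>)) = integral\<^sup>L (distr M borel X) f"
      by (rule integral_distr[symmetric]) auto
    also have "\<dots> = integral\<^sup>L std_normal_distribution (\<lambda>z. f (sqrt v * z))"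
      unfolding eq by (rule integral_distr) auto
    finally show ?thesis .
  qed
  show "integrable M (\<lambda>\<omega>. f (X \<omega>))" if "integrable std_normal_distribution (\<lambda>z. f (sqrt v * z))"
  proof -
    have "integrable (distr std_normal_distribution borel (\<lambda>z. sqrt v * z)) f"
      using that by (subst integrable_distr_eq) auto
    then have "integrable (distr M borel X) f" unfolding eq .
    then show ?thesis by (subst (asm) integrable_distr_eq) auto
  qed
qed

lemma has_wiener_integral_square:
  assumes X: "has_wiener_integral M B T h X"
  shows "expectation (\<lambda>\<omega>. (X \<omega>)\<^sup>2) = (\<integral>t. (h t)\<^sup>2 \<partial>I)"
  using has_wiener_integral_expectation(1)[OF X, of "\<lambda>x. x\<^sup>2"] std_normal_square
  by (simp add: power_mult_distrib)

lemma has_wiener_integral_fourth: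
  assumes X: "has_wiener_integral M B T h X"
  shows "expectation (\<lambda>\<omega>. (X \<omega>) ^ 4) = 3 * (\<integral>t. (h t)\<^sup>2 \<partial>I)\<^sup>2" and "(\<lambda>\<omega>. (X \<omega>)\<^sup>2) \<in> L2 M"
proof -
  let ?v = "\<integral>t. (h t)\<^sup>2 \<partial>I"
  have s: "sqrt ?v ^ 4 = ?v\<^sup>2" by (simp add: power4_eq_xxxx power2_eq_square)
  show "expectation (\<lambda>\<omega>. (X \<omega>) ^ 4) = 3 * ?v\<^sup>2"
    using has_wiener_integral_expectation(1)[OF X, of "\<lambda>x. x ^ 4"] std_normal_fourth s
    by (simp add: power_mult_distrib)
  have "integrable M (\<lambda>\<omega>. (X \<omega>) ^ 4)"
    by (rule has_wiener_integral_expectation(2)[OF X]) (auto simp: power_mult_distrib integrable_std_normal_distribution_moment)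
  then show "(\<lambda>\<omega>. (X \<omega>)\<^sup>2) \<in> L2 M"
    using has_wiener_integral_L2(2)[OF X] by (auto simp: L2_def simp flip: power_mult)
qed

text \<open>Polarisation of the fourth moment \<open>E X\<^sup>4 = 3 \<parallel>h\<parallel>\<^sup>4\<close>,
  applied to the sum and the difference of the two integrals.\<close>

lemma has_wiener_integral_square_mult:
  assumes X: "has_wiener_integral M B T h X" and Y: "has_wiener_integral M B T g Y"
  shows "expectation (\<lambda>\<omega>. (X \<omega>)\<^sup>2 * (Y \<omega>)\<^sup>2) =
    (\<integral>t. (h t)\<^sup>2 \<partial>I) * (\<integral>t. (g t)\<^sup>2 \<partial>I) + 2 * (\<integral>t. h t * g t \<partial>I)\<^sup>2"
proof -
  note hg = has_wiener_integral_L2(1)[OF X] has_wiener_integral_L2(1)[OF Y]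
  have P: "has_wiener_integral M B T (\<lambda>t. 1 * h t + 1 * g t) (\<lambda>\<omega>. 1 * X \<omega> + 1 * Y \<omega>)"
    and N: "has_wiener_integral M B T (\<lambda>t. 1 * h t + (-1) * g t) (\<lambda>\<omega>. 1 * X \<omega> + (-1) * Y \<omega>)"
    by (rule has_wiener_integral.linear[OF X Y])+
  have int: "integrable M (\<lambda>\<omega>. (Z \<omega>) ^ 4)" if "has_wiener_integral M B T k Z" for k Z
    using L2_D(2)[OF has_wiener_integral_fourth(2)[OF that]] by (simp flip: power_mult)
  have "expectation (\<lambda>\<omega>. (1 * X \<omega> + 1 * Y \<omega>) ^ 4) + expectation (\<lambda>\<omega>. (1 * X \<omega> + (-1) * Y \<omega>) ^ 4)
     = expectation (\<lambda>\<omega>. (1 * X \<omega> + 1 * Y \<omega>) ^ 4 + (1 * X \<omega> + (-1) * Y \<omega>) ^ 4)"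
    using int[OF P] int[OF N] by simp
  also have "\<dots> = expectation (\<lambda>\<omega>. 2 * (X \<omega>) ^ 4 + 12 * ((X \<omega>)\<^sup>2 * (Y \<omega>)\<^sup>2) + 2 * (Y \<omega>) ^ 4)"
    by (rule Bochner_Integration.integral_cong) (auto simp: power4_eq_xxxx power2_eq_square algebra_simps)
  also have "\<dots> = 2 * expectation (\<lambda>\<omega>. (X \<omega>) ^ 4) + 12 * expectation (\<lambda>\<omega>. (X \<omega>)\<^sup>2 * (Y \<omega>)\<^sup>2) + 2 * expectation (\<lambda>\<omega>. (Y \<omega>) ^ 4)"
    using int[OF X] int[OF Y] L2_integrable_mult[OF has_wiener_integral_fourth(2)[OF X] has_wiener_integral_fourth(2)[OF Y]]
    by simp
  finally have "12 * expectation (\<lambda>\<omega>. (X \<omega>)\<^sup>2 * (Y \<omega>)\<^sup>2) =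
      3 * (\<integral>t. (1 * h t + 1 * g t)\<^sup>2 \<partial>I)\<^sup>2 + 3 * (\<integral>t. (1 * h t + (-1) * g t)\<^sup>2 \<partial>I)\<^sup>2
      - 6 * (\<integral>t. (h t)\<^sup>2 \<partial>I)\<^sup>2 - 6 * (\<integral>t. (g t)\<^sup>2 \<partial>I)\<^sup>2"
    unfolding has_wiener_integral_fourth(1)[OF X] has_wiener_integral_fourth(1)[OF Y]
      has_wiener_integral_fourth(1)[OF P] has_wiener_integral_fourth(1)[OF N] by linarith
  moreover have "E = a * c + 2 * b\<^sup>2" if "12 * E = 3 * (1\<^sup>2 * a + 2 * 1 * 1 * b + 1\<^sup>2 * c)\<^sup>2
      + 3 * (1\<^sup>2 * a + 2 * 1 * (-1) * b + (-1)\<^sup>2 * c)\<^sup>2 - 6 * a\<^sup>2 - 6 * c\<^sup>2" for E a b c :: real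
    using that by (simp add: power2_eq_square algebra_simps)
  ultimately show ?thesis unfolding integral_sq_lincomb[OF hg] by blast
qed

end

section \<open>Spectral decomposition of symmetric matrices\<close>

definition dot :: "nat \<Rightarrow> (nat \<Rightarrow> real) \<Rightarrow> (nat \<Rightarrow> real) \<Rightarrow> real" where
  "dot n x y = (\<Sum>i<n. x i * y i)"

definition orthonormal :: "nat \<Rightarrow> nat \<Rightarrow> (nat \<Rightarrow> nat \<Rightarrow> real) \<Rightarrow> bool" where
  "orthonormal n k e \<longleftrightarrow> (\<forall>i<k. \<forall>j<k. dot n (e i) (e j) = (if i = j then 1 else 0))"

definition matvec :: "nat \<Rightarrow> (nat \<Rightarrow> nat \<Rightarrow> real) \<Rightarrow> (nat \<Rightarrow> real) \<Rightarrow> nat \<Rightarrow> real" where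
  "matvec n a x i = (\<Sum>j<n. a i j * x j)"

lemma dot_commute: "dot n x y = dot n y x"
  by (simp add: dot_def mult.commute)

lemma dot_add_right: "dot n x (\<lambda>i. y i + z i) = dot n x y + dot n x z"
  and dot_diff_right: "dot n x (\<lambda>i. y i - z i) = dot n x y - dot n x z"
  and dot_scale_right: "dot n x (\<lambda>i. c * y i) = c * dot n x y"
  and dot_sum_right: "dot n x (\<lambda>i. \<Sum>j\<in>J. f j i) = (\<Sum>j\<in>J. dot n x (f j))"
  subgoal by (simp add: dot_def distrib_left sum.distrib)
  subgoal by (simp add: dot_def right_diff_distrib sum_subtractf)
  subgoal by (simp add: dot_def sum_distrib_left mult.left_commute)
  subgoal unfolding dot_def sum_distrib_left by (rule sum.swap)
  done

lemma dot_add_left: "dot n (\<lambda>i. y i + z i) x = dot n y x + dot n z x"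
  and dot_diff_left: "dot n (\<lambda>i. y i - z i) x = dot n y x - dot n z x"
  and dot_scale_left: "dot n (\<lambda>i. c * y i) x = c * dot n y x"
  and dot_sum_left: "dot n (\<lambda>i. \<Sum>j\<in>J. f j i) x = (\<Sum>j\<in>J. dot n (f j) x)"
  subgoal by (simp add: dot_def distrib_right sum.distrib)
  subgoal by (simp add: dot_def left_diff_distrib sum_subtractf)
  subgoal by (simp add: dot_def sum_distrib_left mult.assoc)
  subgoal unfolding dot_def sum_distrib_right by (rule sum.swap)
  done

lemmas dot_simps = dot_add_right dot_diff_right dot_scale_right dot_sum_right
  dot_add_left dot_diff_left dot_scale_left dot_sum_left

lemma dot_self_nonneg: "0 \<le> dot n x x"
  by (simp add: dot_def sum_nonneg)

lemma dot_self_eq_0: "dot n x x = 0 \<longleftrightarrow> (\<forall>i<n. x i = 0)"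
  unfolding dot_def by (subst sum_nonneg_eq_0_iff) auto

lemma dot_residual:
  assumes "orthonormal n k e"
  shows "dot n (\<lambda>i. x i - (\<Sum>j<k. dot n (e j) x * e j i)) (\<lambda>i. x i - (\<Sum>j<k. dot n (e j) x * e j i))
     = dot n x x - (\<Sum>j<k. (dot n (e j) x)\<^sup>2)"
proof -
  have "(\<Sum>j<k. \<Sum>l<k. dot n (e j) x * (dot n (e l) x * dot n (e l) (e j))) = (\<Sum>j<k. (dot n (e j) x)\<^sup>2)"
  proof (intro sum.cong refl)
    fix j assume j: "j \<in> {..<k}"
    have "(\<Sum>l<k. dot n (e j) x * (dot n (e l) x * dot n (e l) (e j)))
        = (\<Sum>l<k. if l = j then (dot n (e j) x)\<^sup>2 else 0)"
      using assms j by (intro sum.cong) (auto simp: orthonormal_def power2_eq_square)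
    then show "(\<Sum>l<k. dot n (e j) x * (dot n (e l) x * dot n (e l) (e j))) = (dot n (e j) x)\<^sup>2"
      using j by simp
  qed
  then show ?thesis
    by (simp add: dot_simps sum_distrib_left power2_eq_square dot_commute[of n x "e _"]
        right_diff_distrib sum_subtractf)
qed

lemma bessel: "orthonormal n k e \<Longrightarrow> (\<Sum>j<k. (dot n (e j) x)\<^sup>2) \<le> dot n x x"
  using dot_residual[of n k e x]
    dot_self_nonneg[of n "\<lambda>i. x i - (\<Sum>j<k. dot n (e j) x * e j i)"] by linarith

abbreviation unit_vec :: "nat \<Rightarrow> nat \<Rightarrow> real" where
  "unit_vec m \<equiv> (\<lambda>i. if i = m then 1 else 0)"

lemma dot_unit_vec: "m < n \<Longrightarrow> dot n x (unit_vec m) = x m"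
  by (simp add: dot_def if_distrib[of "(*) _"] cong: if_cong)

lemma orthonormal_sum_squares:
  assumes "orthonormal n k e"
  shows "(\<Sum>m<n. \<Sum>j<k. (e j m)\<^sup>2) = real k"
proof -
  have "(\<Sum>m<n. \<Sum>j<k. (e j m)\<^sup>2) = (\<Sum>j<k. dot n (e j) (e j))"
    by (subst sum.swap) (simp add: dot_def power2_eq_square)
  also have "\<dots> = (\<Sum>j<k. 1)" using assms by (intro sum.cong) (auto simp: orthonormal_def)
  finally show ?thesis by simp
qed

text \<open>The squared lengths of the projections of the coordinate vectors onto the span of \<open>e\<close>
  add up to \<open>k < n\<close>, so some coordinate vector is not in the span; its residual is
  normalised.\<close>

lemma exists_unit_orthogonal:
  assumes e: "orthonormal n k e" and "k < n"
  shows "\<exists>x. dot n x x = 1 \<and> (\<forall>j<k. dot n (e j) x = 0) \<and> (\<forall>i\<ge>n. x i = 0)"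
proof -
  obtain m where m: "m < n" "(\<Sum>j<k. (e j m)\<^sup>2) < 1"
  proof (rule ccontr)
    assume "\<not> thesis"
    then have "(\<Sum>m<n. (1::real)) \<le> (\<Sum>m<n. \<Sum>j<k. (e j m)\<^sup>2)"
      using that by (intro sum_mono) (auto simp: not_less[symmetric])
    then show False using orthonormal_sum_squares[OF e] \<open>k < n\<close> by simp
  qed
  define r where "r i = unit_vec m i - (\<Sum>j<k. dot n (e j) (unit_vec m) * e j i)" for i
  have r: "dot n r r > 0"
    using dot_residual[OF e, of "unit_vec m"] m unfolding r_def by (simp add: dot_unit_vec)
  have ro: "dot n (e l) r = 0" if "l < k" for l
  proof -
    have "(\<Sum>j<k. dot n (e j) (unit_vec m) * dot n (e l) (e j))
       = (\<Sum>j<k. if j = l then dot n (e l) (unit_vec m) else 0)"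
      using e that by (intro sum.cong) (auto simp: orthonormal_def)
    then show ?thesis using that unfolding r_def by (simp add: dot_simps)
  qed
  define x where "x i = (if i < n then 1 / sqrt (dot n r r) * r i else 0)" for i
  have x: "dot n y x = dot n y (\<lambda>i. 1 / sqrt (dot n r r) * r i)" for y
    unfolding dot_def x_def by (intro sum.cong) auto
  have "dot n x x = 1"
    using r by (subst x, subst dot_commute, subst x, simp only: dot_simps) simp
  moreover have "\<forall>j<k. dot n (e j) x = 0" using ro by (simp only: x dot_scale_right) simp
  ultimately show ?thesis by (intro exI[of _ x]) (auto simp: x_def)
qed

text \<open>Vectors are functions that vanish from \<open>n\<close> on, so that the unit sphere is a closed
  subset of a product of compact intervals.\<close>

lemma compact_unit_orthogonal:
  "compact {x. (\<forall>i\<ge>n. x i = 0) \<and> dot n x x = 1 \<and> (\<forall>j<k. dot n (e j) x = 0)}" (is "compact ?S")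
proof -
  have "compactin (product_topology (\<lambda>i. euclidean) UNIV) (PiE UNIV (\<lambda>i::nat. {-1..1::real}))"
    unfolding compactin_PiE by auto
  then have c: "compact (PiE UNIV (\<lambda>i::nat. {-1..1::real}))"
    by (simp add: euclidean_product_topology)
  have cd: "continuous_on UNIV (\<lambda>x. dot n y x)" "continuous_on UNIV (\<lambda>x. dot n x x)" for y
    unfolding dot_def by (auto intro!: continuous_intros)
  have "closed ((\<Inter>i\<in>{n..}. {x. x i = (0::real)}) \<inter> {x. dot n x x = 1} \<inter> (\<Inter>j\<in>{..<k}. {x. dot n (e j) x = 0}))"
    by (intro closed_Int closed_INT ballI closed_Collect_eq cd continuous_on_const
        continuous_on_product_coordinates)
  also have "\<dots> = ?S" by auto
  finally have "closed ?S" .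
  moreover have "?S \<subseteq> PiE UNIV (\<lambda>i::nat. {-1..1::real})"
  proof
    fix x assume x: "x \<in> ?S"
    have "\<bar>x i\<bar> \<le> 1" for i
    proof (cases "i < n")
      case True
      have "(x i)\<^sup>2 \<le> dot n x x" unfolding dot_def power2_eq_square
        using True by (intro member_le_sum) auto
      then show ?thesis using x by (simp add: power2_le_iff_abs_le abs_square_le_1)
    qed (use x in auto)
    then show "x \<in> PiE UNIV (\<lambda>i::nat. {-1..1::real})" by (auto simp: abs_le_iff minus_le_iff)
  qed
  ultimately have "compact (PiE UNIV (\<lambda>i::nat. {-1..1::real}) \<inter> ?S)"
    using c by blast
  then show ?thesis using \<open>?S \<subseteq> _\<close> by (simp add: Int_absorb1)
qed

lemma dot_matvec: "dot n x (matvec n a y) = (\<Sum>i<n. \<Sum>j<n. a i j * x i * y j)"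
  by (simp add: dot_def matvec_def sum_distrib_left mult_ac)

lemma dot_matvec_commute:
  assumes "\<And>i j. a i j = a j i"
  shows "dot n x (matvec n a y) = dot n y (matvec n a x)"
proof -
  have "dot n x (matvec n a y) = (\<Sum>j<n. \<Sum>i<n. a i j * x i * y j)"
    unfolding dot_matvec by (rule sum.swap)
  also have "\<dots> = dot n y (matvec n a x)"
    unfolding dot_matvec by (intro sum.cong refl) (subst assms, simp)
  finally show ?thesis .
qed

lemma matvec_add: "matvec n a (\<lambda>i. x i + c * y i) = (\<lambda>i. matvec n a x i + c * matvec n a y i)"
  by (auto simp: matvec_def algebra_simps sum.distrib sum_distrib_left)

text \<open>First-order optimality condition.\<close>

lemma linear_coeff_zero:
  fixes p q :: real
  assumes "\<And>t. 2 * t * p + t\<^sup>2 * q \<le> 0"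
  shows "p = 0"
proof (rule ccontr)
  assume p: "p \<noteq> 0"
  \<comment> \<open>small enough for the linear term to dominate the quadratic one\<close>
  define t where "t = p / (\<bar>q\<bar> + 1)"
  have "0 < p\<^sup>2 / (\<bar>q\<bar> + 1)" using p by (simp add: pos_divide_less_eq add_nonneg_pos)
  moreover have "2 * t * p + t\<^sup>2 * q \<ge> p\<^sup>2 / (\<bar>q\<bar> + 1)"
  proof -
    have e: "t\<^sup>2 * (\<bar>q\<bar> + 1) = p\<^sup>2 / (\<bar>q\<bar> + 1)" "2 * t * p = 2 * (p\<^sup>2 / (\<bar>q\<bar> + 1))"
      unfolding t_def by (simp_all add: power2_eq_square)
    have "t\<^sup>2 * q \<ge> t\<^sup>2 * (- (\<bar>q\<bar> + 1))" by (intro mult_left_mono) auto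
    then show ?thesis unfolding mult_minus_right e by linarith
  qed
  ultimately show False using assms[of t] by linarith
qed

text \<open>A maximiser of the Rayleigh quotient on the orthogonal complement of the eigenvectors found so
  far: the first-order condition in the direction of \<open>a x - m x\<close>, which lies in this
  complement by symmetry, says that this vector has length zero.\<close>

lemma exists_next_eigenvector:
  assumes sym: "\<And>i j. a i j = a j i" and e: "orthonormal n k e" and k: "k < n"
    and eig: "\<And>j i. j < k \<Longrightarrow> i < n \<Longrightarrow> matvec n a (e j) i = l j * e j i"
  shows "\<exists>x m. dot n x x = 1 \<and> (\<forall>j<k. dot n (e j) x = 0) \<and> (\<forall>i<n. matvec n a x i = m * x i)"
proof -
  let ?S = "{x. (\<forall>i\<ge>n. x i = 0) \<and> dot n x x = 1 \<and> (\<forall>j<k. dot n (e j) x = 0)}"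
  let ?q = "\<lambda>x. dot n x (matvec n a x)"
  have "continuous_on ?S ?q"
    unfolding dot_matvec by (intro continuous_intros continuous_on_subset[OF continuous_on_product_coordinates]) auto
  moreover have "?S \<noteq> {}" using exists_unit_orthogonal[OF e k] by auto
  ultimately have "\<exists>x\<in>?S. \<forall>y\<in>?S. ?q y \<le> ?q x"
    by (intro continuous_attains_sup compact_unit_orthogonal)
  then obtain x where x: "x \<in> ?S" and max: "\<forall>y\<in>?S. ?q y \<le> ?q x"
    by (rule bexE)
  define m where "m = ?q x"
  have ray: "?q y \<le> m * dot n y y" if y: "\<And>i. i \<ge> n \<Longrightarrow> y i = 0" "\<And>j. j < k \<Longrightarrow> dot n (e j) y = 0" for y
  proof (cases "dot n y y = 0")
    case True
    then have "\<forall>i<n. y i = 0" by (simp add: dot_self_eq_0)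
    then have "dot n y z = 0" for z by (simp add: dot_def)
    then show ?thesis using True by simp
  next
    case False
    then have p: "dot n y y > 0" using dot_self_nonneg[of n y] by linarith
    define c where "c = 1 / sqrt (dot n y y)"
    have c2: "c * c = 1 / dot n y y" unfolding c_def using p by simp
    have s: "matvec n a (\<lambda>i. c * y i) = (\<lambda>i. c * matvec n a y i)"
      by (auto simp: matvec_def sum_distrib_left mult_ac)
    have "?q (\<lambda>i. c * y i) \<le> m" unfolding m_def
      by (rule bspec[OF max]) (use y p c2 in \<open>auto simp: dot_simps mult.assoc[symmetric]\<close>)
    then have "?q y / dot n y y \<le> m" by (simp add: s dot_simps mult.assoc[symmetric] c2)
    then show ?thesis using p by (simp add: pos_divide_le_eq)
  qed
  define w where "w i = (if i < n then matvec n a x i - m * x i else 0)" for i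
  have w: "dot n y w = dot n y (matvec n a x) - m * dot n y x" for y
    unfolding dot_def w_def by (simp add: right_diff_distrib sum_subtractf sum_distrib_left mult_ac)
  have wo: "dot n (e j) w = 0" if "j < k" for j
  proof -
    have "dot n (e j) (matvec n a x) = dot n x (matvec n a (e j))" by (rule dot_matvec_commute[OF sym])
    also have "\<dots> = dot n x (\<lambda>i. l j * e j i)" using eig[OF that] by (simp add: dot_def)
    also have "\<dots> = 0" using x that by (simp add: dot_simps dot_commute[of n x "e _"])
    finally show ?thesis using x that by (simp add: w)
  qed
  have "dot n w (matvec n a x) - m * dot n w x = 0"
  proof (rule linear_coeff_zero)
    fix t :: real
    have "?q (\<lambda>i. x i + t * w i) \<le> m * dot n (\<lambda>i. x i + t * w i) (\<lambda>i. x i + t * w i)"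
      by (rule ray) (use x wo in \<open>auto simp: dot_simps\<close>, simp add: w_def)
    moreover have "dot n x (matvec n a w) = dot n w (matvec n a x)" by (rule dot_matvec_commute[OF sym])
    ultimately have "m + 2 * t * dot n w (matvec n a x) + t\<^sup>2 * ?q w \<le> m * (1 + 2 * t * dot n w x + t\<^sup>2 * dot n w w)"
      using x unfolding matvec_add by (simp add: dot_simps m_def dot_commute[of n x w] algebra_simps power2_eq_square)
    then show "2 * t * (dot n w (matvec n a x) - m * dot n w x) + t\<^sup>2 * (?q w - m * dot n w w) \<le> 0"
      by (simp add: algebra_simps)
  qed
  then have "dot n w w = 0" by (simp add: w)
  then have "\<forall>i<n. matvec n a x i = m * x i" by (auto simp: dot_self_eq_0 w_def)
  then show ?thesis using x by blast
qed

lemma exists_orthonormal_eigenvectors: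
  assumes sym: "\<And>i j. a i j = a j i"
  shows "k \<le> n \<Longrightarrow> \<exists>e l. orthonormal n k e \<and> (\<forall>j<k. \<forall>i<n. matvec n a (e j) i = l j * e j i)"
proof (induction k)
  case 0
  then show ?case by (auto simp: orthonormal_def)
next
  case (Suc k)
  then obtain e l where e: "orthonormal n k e" "\<forall>j<k. \<forall>i<n. matvec n a (e j) i = l j * e j i" by auto
  obtain x m where x: "dot n x x = 1" "\<forall>j<k. dot n (e j) x = 0" "\<forall>i<n. matvec n a x i = m * x i"
    using exists_next_eigenvector[of a n k e l] sym e Suc.prems by auto
  have "orthonormal n (Suc k) (e(k := x))"
    using e(1) x by (auto simp: orthonormal_def less_Suc_eq dot_commute[of n x "e _"])
  moreover have "\<forall>j<Suc k. \<forall>i<n. matvec n a ((e(k := x)) j) i = (l(k := m)) j * (e(k := x)) j i"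
    using e(2) x(3) by (auto simp: less_Suc_eq)
  ultimately show ?case by blast
qed

text \<open>By Bessel's inequality each coordinate vector has a projection of length at most 1, and the
  squares of these lengths add up to \<open>n\<close>; hence all of them are equal to 1.\<close>

lemma orthonormal_complete:
  assumes e: "orthonormal n n e" and "i < n" "m < n"
  shows "(\<Sum>j<n. e j i * e j m) = (if i = m then 1 else 0)"
proof -
  have le: "(\<Sum>j<n. (e j p)\<^sup>2) \<le> 1" if "p < n" for p
    using bessel[OF e, of "unit_vec p"] that by (simp add: dot_unit_vec)
  have "(\<Sum>p<n. 1 - (\<Sum>j<n. (e j p)\<^sup>2)) = 0"
    using orthonormal_sum_squares[OF e] by (simp add: sum_subtractf)
  then have "(\<Sum>j<n. (e j m)\<^sup>2) = 1"
    using le \<open>m < n\<close> by (subst (asm) sum_nonneg_eq_0_iff) auto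
  then have "dot n (\<lambda>i. unit_vec m i - (\<Sum>j<n. dot n (e j) (unit_vec m) * e j i))
                   (\<lambda>i. unit_vec m i - (\<Sum>j<n. dot n (e j) (unit_vec m) * e j i)) = 0"
    using \<open>m < n\<close> by (subst dot_residual[OF e]) (simp add: dot_unit_vec)
  then have "unit_vec m i - (\<Sum>j<n. e j m * e j i) = 0"
    using assms unfolding dot_self_eq_0 by (simp add: dot_unit_vec)
  then show ?thesis by (simp add: mult.commute split: if_splits)
qed

theorem symmetric_matrix_spectral:
  assumes sym: "\<And>i j. a i j = a j i"
  obtains e l where "orthonormal n n e"
    "\<And>i m. i < n \<Longrightarrow> m < n \<Longrightarrow> a i m = (\<Sum>j<n. l j * e j i * e j m)"
proof -
  obtain e l where e: "orthonormal n n e" "\<forall>j<n. \<forall>i<n. matvec n a (e j) i = l j * e j i"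
    using exists_orthonormal_eigenvectors[of a n n] sym by auto
  have "a i m = (\<Sum>j<n. l j * e j i * e j m)" if "i < n" "m < n" for i m
  proof -
    have "a i m = (\<Sum>p<n. a i p * (if p = m then 1 else 0))" using that
      by (simp add: if_distrib[of "(*) _"] cong: if_cong)
    also have "\<dots> = (\<Sum>p<n. \<Sum>j<n. a i p * (e j p * e j m))"
      using that by (intro sum.cong refl) (simp add: orthonormal_complete[OF e(1), symmetric] sum_distrib_left)
    also have "\<dots> = (\<Sum>j<n. matvec n a (e j) i * e j m)"
      by (subst sum.swap) (simp add: matvec_def sum_distrib_left mult_ac)
    also have "\<dots> = (\<Sum>j<n. l j * e j i * e j m)" using e(2) that by simp
    finally show ?thesis .
  qed
  with e(1) show thesis by (rule that)
qed

section \<open>Double Wiener integrals and their discretisation\<close>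

lemma (in pair_sigma_finite) integrable_tensor:
  fixes f :: "'a \<Rightarrow> real" and g :: "'b \<Rightarrow> real"
  assumes f: "integrable M1 f" and g: "integrable M2 g"
  shows "integrable (M1 \<Otimes>\<^sub>M M2) (\<lambda>(x, y). f x * g y)"
    and "(\<integral>p. (case p of (x, y) \<Rightarrow> f x * g y) \<partial>(M1 \<Otimes>\<^sub>M M2)) = (\<integral>x. f x \<partial>M1) * (\<integral>y. g y \<partial>M2)"
proof -
  have [measurable]: "f \<in> borel_measurable M1" "g \<in> borel_measurable M2" using f g by auto
  show i: "integrable (M1 \<Otimes>\<^sub>M M2) (\<lambda>(x, y). f x * g y)"
  proof (rule Fubini_integrable)
    show "integrable M1 (\<lambda>x. \<integral>y. norm (case (x, y) of (x, y) \<Rightarrow> f x * g y) \<partial>M2)"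
      using f by (simp add: abs_mult)
    show "AE x in M1. integrable M2 (\<lambda>y. case (x, y) of (x, y) \<Rightarrow> f x * g y)"
      using g by simp
  qed measurable
  show "(\<integral>p. (case p of (x, y) \<Rightarrow> f x * g y) \<partial>(M1 \<Otimes>\<^sub>M M2)) = (\<integral>x. f x \<partial>M1) * (\<integral>y. g y \<partial>M2)"
    using integral_fst'[OF i] by simp
qed

text \<open>The cell width \<open>T / n\<close> makes this the matrix, with respect to the normalised
  indicators of the cells, of the integral operator with the discretised kernel.\<close>

definition kernel_matrix :: "real \<Rightarrow> real \<Rightarrow> real \<Rightarrow> nat \<Rightarrow> nat \<Rightarrow> nat \<Rightarrow> real" where
  "kernel_matrix \<theta> \<gamma> T n i m = T / n * exp_kernel \<theta> \<gamma> T (T * real i / n, T * real m / n)"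

lemma kernel_matrix_sym: "kernel_matrix \<theta> \<gamma> T n i m = kernel_matrix \<theta> \<gamma> T n m i"
  by (simp add: kernel_matrix_def exp_kernel_def abs_minus_commute)

lemma exp_abs_lipschitz:
  fixes x y :: real
  assumes "0 \<le> x" "0 \<le> y"
  shows "\<bar>exp (- x) - exp (- y)\<bar> \<le> \<bar>x - y\<bar>"
proof -
  have *: "\<bar>exp (- x) - exp (- y)\<bar> \<le> \<bar>x - y\<bar>" if "0 \<le> x" "x \<le> y" for x y :: real
  proof -
    have "exp (- y) = exp (- x) * exp (- (y - x))" by (simp flip: exp_add)
    moreover have "1 - (y - x) \<le> exp (- (y - x))" using exp_ge_add_one_self[of "- (y - x)"] by linarith
    moreover have "exp (- x) * (1 - exp (- (y - x))) \<le> 1 * (1 - exp (- (y - x)))"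
      using that by (intro mult_right_mono) auto
    ultimately show ?thesis using that by (simp add: algebra_simps)
  qed
  show ?thesis using *[of x y] *[of y x] assms by (cases "x \<le> y") auto
qed

lemma exp_kernel_lipschitz:
  assumes "0 < T" "0 < \<theta>" "\<bar>t - t'\<bar> \<le> d" "\<bar>s - s'\<bar> \<le> d"
  shows "\<bar>exp_kernel \<theta> \<gamma> T (t, s) - exp_kernel \<theta> \<gamma> T (t', s')\<bar> \<le> \<gamma>\<^sup>2 / (2 * sqrt T) * (2 * \<theta> * d)"
proof -
  have "\<bar>exp (- (\<theta> * \<bar>t - s\<bar>)) - exp (- (\<theta> * \<bar>t' - s'\<bar>))\<bar> \<le> \<bar>\<theta> * \<bar>t - s\<bar> - \<theta> * \<bar>t' - s'\<bar>\<bar>"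
    using assms by (intro exp_abs_lipschitz) auto
  also have "\<dots> = \<theta> * \<bar>\<bar>t - s\<bar> - \<bar>t' - s'\<bar>\<bar>"
    using assms by (simp add: abs_mult flip: right_diff_distrib)
  also have "\<dots> \<le> \<theta> * (2 * d)" using assms by (intro mult_left_mono) auto
  finally have "\<gamma>\<^sup>2 / (2 * sqrt T) * \<bar>exp (- (\<theta> * \<bar>t - s\<bar>)) - exp (- (\<theta> * \<bar>t' - s'\<bar>))\<bar> \<le> \<gamma>\<^sup>2 / (2 * sqrt T) * (2 * \<theta> * d)"
    using assms by (intro mult_left_mono) auto
  moreover have "exp_kernel \<theta> \<gamma> T (t, s) - exp_kernel \<theta> \<gamma> T (t', s')
      = \<gamma>\<^sup>2 / (2 * sqrt T) * (exp (- (\<theta> * \<bar>t - s\<bar>)) - exp (- (\<theta> * \<bar>t' - s'\<bar>)))"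
    unfolding exp_kernel_def right_diff_distrib by simp
  moreover have "0 \<le> \<gamma>\<^sup>2 / (2 * sqrt T)" using assms by simp
  ultimately show ?thesis by (simp only: abs_mult abs_of_nonneg)
qed

context brownian
begin

abbreviation Sq :: "(real \<times> real) measure" where "Sq \<equiv> lebesgue_square T"

lemma integrable_tensor_Sq:
  fixes f g :: "real \<Rightarrow> real"
  assumes f: "integrable I f" and g: "integrable I g"
  shows "integrable Sq (\<lambda>(t, s). f t * g s)"
    and "(\<integral>p. (case p of (t, s) \<Rightarrow> f t * g s) \<partial>Sq) = (\<integral>t. f t \<partial>I) * (\<integral>s. g s \<partial>I)"
proof -
  have f': "integrable lborel (\<lambda>t. indicator {0..T} t * f t)" "(\<integral>t. indicator {0..T} t * f t \<partial>lborel) = (\<integral>t. f t \<partial>I)"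
    using f by (simp_all add: integrable_restrict_space integral_restrict_space)
  have g': "integrable lborel (\<lambda>t. indicator {0..T} t * g t)" "(\<integral>t. indicator {0..T} t * g t \<partial>lborel) = (\<integral>t. g t \<partial>I)"
    using g by (simp_all add: integrable_restrict_space integral_restrict_space)
  have eq: "(\<lambda>(x, y). indicator {0..T} x * f x * (indicator {0..T} y * g y))
      = (\<lambda>p. indicator ({0..T} \<times> {0..T}) p *\<^sub>R (case p of (t, s) \<Rightarrow> f t * g s))"
    by (auto simp: indicator_def)
  note * = lborel_pair.integrable_tensor[OF f'(1) g'(1), unfolded eq lborel_prod]
  have S: "{0..T} \<times> {0..T} \<inter> space lborel \<in> sets lborel" by (simp add: borel_Times)
  show "integrable Sq (\<lambda>(t, s). f t * g s)"
    using *(1) by (subst integrable_restrict_space[OF S])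
  show "(\<integral>p. (case p of (t, s) \<Rightarrow> f t * g s) \<partial>Sq) = (\<integral>t. f t \<partial>I) * (\<integral>s. g s \<partial>I)"
    using *(2) f'(2) g'(2) by (subst integral_restrict_space[OF S]) (simp add: eq)
qed

lemma measurable_tensor_Sq:
  fixes f g :: "real \<Rightarrow> real"
  assumes f: "f \<in> borel_measurable I" and g: "g \<in> borel_measurable I"
  shows "(\<lambda>(t, s). f t * g s) \<in> borel_measurable Sq"
proof -
  have [measurable]: "(\<lambda>t. indicator {0..T} t * f t) \<in> borel_measurable borel" "(\<lambda>t. indicator {0..T} t * g t) \<in> borel_measurable borel"
    using f g by (simp_all add: borel_measurable_restrict_space_iff)
  have eq: "(\<lambda>p. indicator ({0..T} \<times> {0..T}) p *\<^sub>R (case p of (t, s) \<Rightarrow> f t * g s))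
     = (\<lambda>p. indicator {0..T} (fst p) * f (fst p) * (indicator {0..T} (snd p) * g (snd p)))"
    by (auto simp: indicator_def)
  have "(\<lambda>p. indicator {0..T} (fst p) * f (fst p) * (indicator {0..T} (snd p) * g (snd p))) \<in> borel_measurable (borel \<Otimes>\<^sub>M borel)"
    by measurable
  then have "(\<lambda>p. indicator ({0..T} \<times> {0..T}) p *\<^sub>R (case p of (t, s) \<Rightarrow> f t * g s)) \<in> borel_measurable borel"
    unfolding eq borel_prod .
  moreover have S: "{0..T} \<times> {0..T} \<inter> space lborel \<in> sets lborel" by (simp add: borel_Times)
  ultimately show ?thesis by (subst borel_measurable_restrict_space_iff[OF S]) simp
qed

lemma tensor_L2:
  assumes "h \<in> L2 I" "g \<in> L2 I"
  shows "(\<lambda>(t, s). h t * g s) \<in> L2 Sq"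
proof -
  have "(\<lambda>p. (case p of (t, s) \<Rightarrow> h t * g s)\<^sup>2) = (\<lambda>(t, s). (h t)\<^sup>2 * (g s)\<^sup>2)"
    by (auto simp: power_mult_distrib)
  then show ?thesis
    using integrable_tensor_Sq(1)[of "\<lambda>t. (h t)\<^sup>2" "\<lambda>t. (g t)\<^sup>2"] measurable_tensor_Sq[of h g] assms
    by (simp add: L2_def)
qed

lemma integral_tensor_square:
  assumes "h \<in> L2 I" "g \<in> L2 I"
  shows "(\<integral>p. (case p of (t, s) \<Rightarrow> h t * h s) * (case p of (t, s) \<Rightarrow> g t * g s) \<partial>Sq) = (\<integral>t. h t * g t \<partial>I)\<^sup>2"
proof -
  have "(\<lambda>p. (case p of (t, s) \<Rightarrow> h t * h s) * (case p of (t, s) \<Rightarrow> g t * g s)) = (\<lambda>(t, s). (h t * g t) * (h s * g s))"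
    by (auto simp: mult_ac)
  then show ?thesis
    using integrable_tensor_Sq(2)[OF L2_integrable_mult[OF assms] L2_integrable_mult[OF assms]]
    by (simp add: power2_eq_square)
qed

lemma const_L2: "(\<lambda>\<omega>. c) \<in> L2 M" by (simp add: L2_def)

lemma has_double_wiener_integral_L2:
  "has_double_wiener_integral M B T f X \<Longrightarrow> f \<in> L2 Sq \<and> X \<in> L2 M"
proof (induction rule: has_double_wiener_integral.induct)
  case (square h X)
  then show ?case
    using L2_diff[OF has_wiener_integral_fourth(2) const_L2, of h X 1] tensor_L2[of h h] by simp
next
  case (limit f X g Y)
  then show ?case by (auto dest: L2_tendsto_D)
qed (auto intro: L2_lincomb)

text \<open>The isometry is proved by two nested inductions. Here one argument is a square; the base case is
  the fourth moment formula for a pair of Wiener integrals, and the limit case is continuity of the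
  inner product.\<close>

lemma double_isometry_square:
  assumes h: "h \<in> L2 I" "(\<integral>t. (h t)\<^sup>2 \<partial>I) = 1" "has_wiener_integral M B T h Z"
  shows "has_double_wiener_integral M B T f X \<Longrightarrow>
    expectation (\<lambda>\<omega>. X \<omega> * ((Z \<omega>)\<^sup>2 - 1)) = 2 * (\<integral>p. f p * (case p of (t, s) \<Rightarrow> h t * h s) \<partial>Sq)"
proof (induction rule: has_double_wiener_integral.induct)
  case (square g X)
  have i: "integrable M (\<lambda>\<omega>. (X \<omega>)\<^sup>2)" "integrable M (\<lambda>\<omega>. (Z \<omega>)\<^sup>2)"
      "integrable M (\<lambda>\<omega>. (X \<omega>)\<^sup>2 * (Z \<omega>)\<^sup>2)"
    using has_wiener_integral_L2(2)[OF square(3)] has_wiener_integral_L2(2)[OF h(3)]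
      L2_integrable_mult[OF has_wiener_integral_fourth(2)[OF square(3)] has_wiener_integral_fourth(2)[OF h(3)]]
    by auto
  have "expectation (\<lambda>\<omega>. ((X \<omega>)\<^sup>2 - 1) * ((Z \<omega>)\<^sup>2 - 1))
      = expectation (\<lambda>\<omega>. (X \<omega>)\<^sup>2 * (Z \<omega>)\<^sup>2 - (X \<omega>)\<^sup>2 - (Z \<omega>)\<^sup>2 + 1)"
    by (simp add: algebra_simps)
  also have "\<dots> = expectation (\<lambda>\<omega>. (X \<omega>)\<^sup>2 * (Z \<omega>)\<^sup>2) - expectation (\<lambda>\<omega>. (X \<omega>)\<^sup>2) - expectation (\<lambda>\<omega>. (Z \<omega>)\<^sup>2) + 1"
    using i by (simp add: prob_space)
  also have "\<dots> = 2 * (\<integral>t. g t * h t \<partial>I)\<^sup>2"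
    using has_wiener_integral_square[OF square(3)] has_wiener_integral_square[OF h(3)]
      has_wiener_integral_square_mult[OF square(3) h(3)] square(2) h(2) by simp
  finally show ?case using integral_tensor_square[OF square(1) h(1)] by simp
next
  case (linear f X g Y a b)
  have Z: "(\<lambda>\<omega>. (Z \<omega>)\<^sup>2 - 1) \<in> L2 M" by (intro L2_diff has_wiener_integral_fourth(2)[OF h(3)] const_L2)
  show ?case
    using integral_mult_lincomb[of X M Y "\<lambda>\<omega>. (Z \<omega>)\<^sup>2 - 1" a b]
      integral_mult_lincomb[of f Sq g "\<lambda>(t, s). h t * h s" a b] linear.IH Z tensor_L2[OF h(1) h(1)]
      has_double_wiener_integral_L2[OF linear.hyps(1)] has_double_wiener_integral_L2[OF linear.hyps(2)]
    by simp
next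
  case (limit f X g Y)
  have Z: "(\<lambda>\<omega>. (Z \<omega>)\<^sup>2 - 1) \<in> L2 M" by (intro L2_diff has_wiener_integral_fourth(2)[OF h(3)] const_L2)
  have "(\<lambda>n. expectation (\<lambda>\<omega>. X n \<omega> * ((Z \<omega>)\<^sup>2 - 1))) \<longlonglongrightarrow> expectation (\<lambda>\<omega>. Y \<omega> * ((Z \<omega>)\<^sup>2 - 1))"
    by (rule L2_tendsto_integral_mult[OF limit.hyps(3) Z])
  moreover have "(\<lambda>n. 2 * (\<integral>p. f n p * (case p of (t, s) \<Rightarrow> h t * h s) \<partial>Sq)) \<longlonglongrightarrow>
      2 * (\<integral>p. g p * (case p of (t, s) \<Rightarrow> h t * h s) \<partial>Sq)"
    by (intro tendsto_mult_left L2_tendsto_integral_mult[OF limit.hyps(2)] tensor_L2 h)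
  ultimately show ?case unfolding limit.IH by (rule LIMSEQ_unique)
qed

lemma double_isometry_mult:
  assumes f: "has_double_wiener_integral M B T f X"
  shows "has_double_wiener_integral M B T g Y \<Longrightarrow>
    expectation (\<lambda>\<omega>. Y \<omega> * X \<omega>) = 2 * (\<integral>p. g p * f p \<partial>Sq)"
proof (induction rule: has_double_wiener_integral.induct)
  case (square h Z)
  then show ?case using double_isometry_square[OF square f] by (simp add: mult.commute)
next
  case (linear g Y g' Y' a b)
  show ?case
    using integral_mult_lincomb[of Y M Y' X a b]
      integral_mult_lincomb[of g Sq g' f a b] linear.IH has_double_wiener_integral_L2[OF f]
      has_double_wiener_integral_L2[OF linear.hyps(1)] has_double_wiener_integral_L2[OF linear.hyps(2)]
    by simp
next
  case (limit g Y g' Y')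
  have "(\<lambda>n. expectation (\<lambda>\<omega>. Y n \<omega> * X \<omega>)) \<longlonglongrightarrow> expectation (\<lambda>\<omega>. Y' \<omega> * X \<omega>)"
    using has_double_wiener_integral_L2[OF f] by (intro L2_tendsto_integral_mult[OF limit.hyps(3)]) simp
  moreover have "(\<lambda>n. 2 * (\<integral>p. g n p * f p \<partial>Sq)) \<longlonglongrightarrow> 2 * (\<integral>p. g' p * f p \<partial>Sq)"
    using has_double_wiener_integral_L2[OF f] by (intro tendsto_mult_left L2_tendsto_integral_mult[OF limit.hyps(2)]) simp
  ultimately show ?case unfolding limit.IH by (rule LIMSEQ_unique)
qed

lemma double_isometry:
  assumes "has_double_wiener_integral M B T f X" "has_double_wiener_integral M B T g Y"
  shows "expectation (\<lambda>\<omega>. (X \<omega> - Y \<omega>)\<^sup>2) = 2 * (\<integral>p. (f p - g p)\<^sup>2 \<partial>Sq)"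
proof -
  have "has_double_wiener_integral M B T (\<lambda>p. 1 * f p + (-1) * g p) (\<lambda>\<omega>. 1 * X \<omega> + (-1) * Y \<omega>)"
    by (rule has_double_wiener_integral.linear[OF assms])
  from double_isometry_mult[OF this this] show ?thesis by (simp add: power2_eq_square)
qed

subsection \<open>The discretised double integral\<close>

text \<open>The Wiener integral of the normalised step function whose coordinates are \<open>x\<close>.\<close>

definition normal_coord :: "nat \<Rightarrow> (nat \<Rightarrow> real) \<Rightarrow> 'a \<Rightarrow> real" where
  "normal_coord n x = step_integral n (\<lambda>k. sqrt (n / T) * x k)"

definition unit_step :: "nat \<Rightarrow> (nat \<Rightarrow> real) \<Rightarrow> real \<Rightarrow> real" where
  "unit_step n x = step n (\<lambda>k. sqrt (n / T) * x k)"

lemma integral_unit_step: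
  assumes "0 < n"
  shows "(\<integral>t. unit_step n x t * unit_step n y t \<partial>I) = dot n x y"
proof -
  have "(\<Sum>k<n. sqrt (n / T) * x k * (sqrt (n / T) * y k)) = (\<Sum>k<n. n / T * (x k * y k))"
  proof (intro sum.cong refl)
    fix k
    have "sqrt (n / T) * x k * (sqrt (n / T) * y k) = (sqrt (n / T) * sqrt (n / T)) * (x k * y k)"
      by (simp only: mult_ac)
    then show "sqrt (n / T) * x k * (sqrt (n / T) * y k) = n / T * (x k * y k)" using T_pos by simp
  qed
  then have "(\<Sum>k<n. sqrt (n / T) * x k * (sqrt (n / T) * y k)) = n / T * dot n x y"
    by (simp only: dot_def sum_distrib_left)
  then show ?thesis
    using T_pos assms unfolding unit_step_def integral_step_mult by simp
qed

lemma has_wiener_integral_unit_step: "has_wiener_integral M B T (unit_step n x) (normal_coord n x)"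
  unfolding unit_step_def normal_coord_def by (rule has_wiener_integral_step)

text \<open>A linear combination of coordinates is again a Wiener integral, whose variance is the squared
  length of the combined vector.\<close>

lemma normal_coord_joint_char:
  assumes n: "0 < n" and e: "orthonormal n n e"
  shows "expectation (\<lambda>\<omega>. iexp (\<Sum>j<n. z j * normal_coord n (e j) \<omega>)) = exp (- ((\<Sum>j<n. (z j)\<^sup>2) / 2))"
proof -
  let ?x = "\<lambda>k. \<Sum>j<n. z j * e j k"
  have "dot n ?x ?x = (\<Sum>j<n. (z j)\<^sup>2)"
  proof -
    have "dot n ?x ?x = (\<Sum>j<n. z j * (\<Sum>l<n. z l * dot n (e l) (e j)))"
      by (simp only: dot_simps)
    also have "\<dots> = (\<Sum>j<n. z j * (\<Sum>l<n. if l = j then z j else 0))"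
      using e by (intro sum.cong arg_cong2[where f="(*)"] refl) (auto simp: orthonormal_def)
    finally show ?thesis by (simp add: power2_eq_square)
  qed
  moreover have "normal_coord n ?x \<omega> = (\<Sum>j<n. z j * normal_coord n (e j) \<omega>)" for \<omega>
    unfolding normal_coord_def step_integral_def sum_distrib_left sum_distrib_right
    by (subst sum.swap) (simp add: mult_ac)
  ultimately show ?thesis
    using has_wiener_integral_char[OF has_wiener_integral_unit_step, of 1 n ?x] integral_unit_step[OF n, of ?x ?x]
    by (simp add: power2_eq_square)
qed

lemma has_double_wiener_integral_quadratic:
  assumes n: "0 < n" and e: "orthonormal n n e"
  shows "has_double_wiener_integral M B T (\<lambda>p. \<Sum>j<n. l j * (case p of (t, s) \<Rightarrow> unit_step n (e j) t * unit_step n (e j) s))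
    (\<lambda>\<omega>. \<Sum>j<n. l j * ((normal_coord n (e j) \<omega>)\<^sup>2 - 1))"
proof -
  have sq: "has_double_wiener_integral M B T (\<lambda>(t, s). unit_step n (e j) t * unit_step n (e j) s)
    (\<lambda>\<omega>. (normal_coord n (e j) \<omega>)\<^sup>2 - 1)" if "j < n" for j
  proof (rule has_double_wiener_integral.square)
    show "unit_step n (e j) \<in> L2 I" unfolding unit_step_def by (rule step_L2)
    show "(\<integral>t. (unit_step n (e j) t)\<^sup>2 \<partial>I) = 1"
      using integral_unit_step[OF n, of "e j" "e j"] e that by (simp add: power2_eq_square orthonormal_def)
  qed (rule has_wiener_integral_unit_step)
  have "has_double_wiener_integral M B T (\<lambda>p. \<Sum>j<m. l j * (case p of (t, s) \<Rightarrow> unit_step n (e j) t * unit_step n (e j) s))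
    (\<lambda>\<omega>. \<Sum>j<m. l j * ((normal_coord n (e j) \<omega>)\<^sup>2 - 1))" if "m \<le> n" for m
    using that
  proof (induction m)
    case 0
    show ?case using has_double_wiener_integral.linear[OF sq sq, of 0 0 0 0] n by simp
  next
    case (Suc m)
    show ?case using has_double_wiener_integral.linear[OF Suc.IH sq, of m 1 "l m"] Suc.prems by simp
  qed
  then show ?thesis by simp
qed

lemma exists_cell:
  assumes "0 < t" "t \<le> T" "0 < n"
  shows "\<exists>k<n. t \<in> cell n k"
proof -
  \<comment> \<open>cells are closed on the right, hence the ceiling\<close>
  define k where "k = nat (\<lceil>t * n / T\<rceil> - 1)"
  have p: "0 < t * n / T" using assms T_pos by simp
  have "real k = real_of_int \<lceil>t * n / T\<rceil> - 1" unfolding k_def using p by simp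
  then have k: "real k < t * n / T" "t * n / T \<le> real k + 1" by linarith+
  have "t * n / T \<le> n" using assms T_pos by (simp add: pos_divide_le_eq mult_right_mono mult.commute[of "real n"])
  then have "k < n" using k(1) by linarith
  moreover have "t \<in> cell n k" using k T_pos assms by (simp add: cell_def grid_def field_simps)
  ultimately show ?thesis by blast
qed

lemma step_cell: "t \<in> cell n k \<Longrightarrow> k < n \<Longrightarrow> step n c t = c k"
proof -
  assume t: "t \<in> cell n k" "k < n"
  have "step n c t = (\<Sum>j<n. if j = k then c k else 0)"
    unfolding step_def using cell_disjoint[of _ k n] t by (intro sum.cong refl) (auto simp: indicator_def)
  then show ?thesis using t by simp
qed

lemma discretised_kernel_error:
  assumes n: "0 < n" and \<theta>: "0 < \<theta>"
    and a: "\<And>i m. i < n \<Longrightarrow> m < n \<Longrightarrow> kernel_matrix \<theta> \<gamma> T n i m = (\<Sum>j<n. l j * e j i * e j m)"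
    and t: "t \<in> {0<..T}" "s \<in> {0<..T}"
  shows "\<bar>(\<Sum>j<n. l j * (unit_step n (e j) t * unit_step n (e j) s)) - exp_kernel \<theta> \<gamma> T (t, s)\<bar>
    \<le> \<gamma>\<^sup>2 / (2 * sqrt T) * (2 * \<theta> * (T / n))"
proof -
  obtain i where i: "i < n" "t \<in> cell n i" using exists_cell[of t n] t n by auto
  obtain m where m: "m < n" "s \<in> cell n m" using exists_cell[of s n] t n by auto
  have "(\<Sum>j<n. l j * (unit_step n (e j) t * unit_step n (e j) s)) = (\<Sum>j<n. n / T * (l j * e j i * e j m))"
  proof (intro sum.cong refl)
    fix j
    have "l j * ((sqrt (n / T) * e j i) * (sqrt (n / T) * e j m)) = (sqrt (n / T) * sqrt (n / T)) * (l j * e j i * e j m)"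
      by (simp only: mult_ac)
    then show "l j * (unit_step n (e j) t * unit_step n (e j) s) = n / T * (l j * e j i * e j m)"
      using T_pos i m by (simp add: unit_step_def step_cell)
  qed
  also have "\<dots> = n / T * kernel_matrix \<theta> \<gamma> T n i m" using a[OF i(1) m(1)] by (simp add: sum_distrib_left)
  also have "\<dots> = exp_kernel \<theta> \<gamma> T (grid n i, grid n m)" using T_pos n by (simp add: kernel_matrix_def grid_def)
  finally have eq: "(\<Sum>j<n. l j * (unit_step n (e j) t * unit_step n (e j) s)) = exp_kernel \<theta> \<gamma> T (grid n i, grid n m)" .
  have "\<bar>grid n i - t\<bar> \<le> T / n" "\<bar>grid n m - s\<bar> \<le> T / n"
    using i(2) m(2) grid_Suc_diff[of n i] grid_Suc_diff[of n m] unfolding cell_def by auto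
  then show ?thesis unfolding eq using exp_kernel_lipschitz[OF T_pos \<theta>] by blast
qed

lemma finite_measure_Sq: "finite_measure Sq"
  and measure_Sq: "measure Sq (space Sq) = T\<^sup>2"
proof -
  have "emeasure (lborel \<Otimes>\<^sub>M lborel) ({0..T} \<times> {0..T}) = ennreal T * ennreal T"
    using T_pos by (subst lborel.emeasure_pair_measure_Times) auto
  then have e: "emeasure lborel ({0..T} \<times> {0..T}) = ennreal (T\<^sup>2)"
    using T_pos by (simp add: lborel_prod power2_eq_square flip: ennreal_mult)
  have "emeasure Sq (space Sq) = ennreal (T\<^sup>2)"
    using e by (simp add: space_restrict_space emeasure_restrict_space borel_Times)
  then show "finite_measure Sq" "measure Sq (space Sq) = T\<^sup>2"
    by (auto intro!: finite_measureI simp: measure_def)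
qed

text \<open>The cells are open on the left, so that the step functions vanish at the time 0.\<close>

lemma AE_Sq_positive: "AE p in Sq. fst p \<in> {0<..T} \<and> snd p \<in> {0<..T}"
proof -
  have "emeasure (lborel \<Otimes>\<^sub>M lborel) ({0} \<times> (UNIV :: real set)) = 0" "emeasure (lborel \<Otimes>\<^sub>M lborel) ((UNIV :: real set) \<times> {0}) = 0"
    by (subst lborel.emeasure_pair_measure_Times; simp)+
  then have N: "{0} \<times> UNIV \<in> null_sets (lborel :: (real \<times> real) measure)" "UNIV \<times> {0} \<in> null_sets (lborel :: (real \<times> real) measure)"
    by (auto simp: null_sets_def lborel_prod borel_Times)
  have "AE p in lborel. p \<in> {0..T} \<times> {0..T} \<longrightarrow> fst p \<in> {0<..T} \<and> snd p \<in> {0<..T}"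
    using AE_not_in[OF N(1)] AE_not_in[OF N(2)] by eventually_elim auto
  then show ?thesis by (subst AE_restrict_space_iff) (auto simp: borel_Times)
qed

lemma exp_kernel_L2: "exp_kernel \<theta> \<gamma> T \<in> L2 Sq" if "0 < \<theta>"
proof -
  interpret S: finite_measure Sq by (rule finite_measure_Sq)
  have "continuous_on UNIV (exp_kernel \<theta> \<gamma> T)"
    unfolding exp_kernel_def case_prod_beta by (cases "T = 0") (auto intro!: continuous_intros)
  then have m: "exp_kernel \<theta> \<gamma> T \<in> borel_measurable Sq"
    by (intro measurable_restrict_space1) (simp add: borel_measurable_continuous_onI)
  have "\<bar>exp_kernel \<theta> \<gamma> T p\<bar> \<le> \<gamma>\<^sup>2 / (2 * sqrt T)" for p
    using T_pos that mult_left_mono[of "exp (- (\<theta> * \<bar>fst p - snd p\<bar>))" 1 "\<gamma>\<^sup>2 / (2 * sqrt T)"]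
    by (simp add: exp_kernel_def case_prod_beta)
  then have "(exp_kernel \<theta> \<gamma> T p)\<^sup>2 \<le> (\<gamma>\<^sup>2 / (2 * sqrt T))\<^sup>2" for p
    by (metis abs_ge_zero power2_abs power_mono)
  then have "integrable Sq (\<lambda>p. (exp_kernel \<theta> \<gamma> T p)\<^sup>2)"
    using m by (intro S.integrable_const_bound[where B="(\<gamma>\<^sup>2 / (2 * sqrt T))\<^sup>2"]) auto
  then show ?thesis using m by (simp add: L2_def)
qed

lemma discretised_kernel_L2_error:
  assumes n: "0 < n" and \<theta>: "0 < \<theta>" and e: "orthonormal n n e"
    and a: "\<And>i m. i < n \<Longrightarrow> m < n \<Longrightarrow> kernel_matrix \<theta> \<gamma> T n i m = (\<Sum>j<n. l j * e j i * e j m)"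
  shows "(\<integral>p. ((\<Sum>j<n. l j * (case p of (t, s) \<Rightarrow> unit_step n (e j) t * unit_step n (e j) s)) - exp_kernel \<theta> \<gamma> T p)\<^sup>2 \<partial>Sq)
    \<le> (\<gamma>\<^sup>2 / (2 * sqrt T) * (2 * \<theta> * T))\<^sup>2 * T\<^sup>2 / (real n)\<^sup>2"
proof -
  interpret S: finite_measure Sq by (rule finite_measure_Sq)
  let ?d = "\<lambda>p. (\<Sum>j<n. l j * (case p of (t, s) \<Rightarrow> unit_step n (e j) t * unit_step n (e j) s)) - exp_kernel \<theta> \<gamma> T p"
  let ?b = "\<gamma>\<^sup>2 / (2 * sqrt T) * (2 * \<theta> * (T / n))"
  have "?d \<in> L2 Sq"
    using has_double_wiener_integral_L2[OF has_double_wiener_integral_quadratic[OF n e]] exp_kernel_L2[OF \<theta>]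
    by (intro L2_diff) auto
  then have "integrable Sq (\<lambda>p. (?d p)\<^sup>2)" by (rule L2_D)
  moreover have "AE p in Sq. (?d p)\<^sup>2 \<le> ?b\<^sup>2"
    using AE_Sq_positive
  proof eventually_elim
    case (elim p)
    then have "\<bar>?d p\<bar> \<le> ?b" using discretised_kernel_error[OF n \<theta> a, of "fst p" "snd p"] by (simp add: case_prod_beta)
    then have "\<bar>?d p\<bar>\<^sup>2 \<le> ?b\<^sup>2" by (intro power_mono) auto
    then show ?case by simp
  qed
  ultimately have "(\<integral>p. (?d p)\<^sup>2 \<partial>Sq) \<le> (\<integral>p. ?b\<^sup>2 \<partial>Sq)"
    by (intro integral_mono_AE) simp_all
  also have "\<dots> = T\<^sup>2 * ?b\<^sup>2" using measure_Sq by simp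
  also have "\<dots> = (\<gamma>\<^sup>2 / (2 * sqrt T) * (2 * \<theta> * T))\<^sup>2 * T\<^sup>2 / (real n)\<^sup>2"
    by (simp add: power_mult_distrib power_divide)
  finally show ?thesis .
qed

end

text \<open>One choice of an eigensystem, made independently of the probability space.\<close>

definition kernel_eigensystem :: "real \<Rightarrow> real \<Rightarrow> real \<Rightarrow> nat \<Rightarrow> (nat \<Rightarrow> nat \<Rightarrow> real) \<times> (nat \<Rightarrow> real)" where
  "kernel_eigensystem \<theta> \<gamma> T n = (SOME p. orthonormal n n (fst p) \<and>
     (\<forall>i<n. \<forall>m<n. kernel_matrix \<theta> \<gamma> T n i m = (\<Sum>j<n. snd p j * fst p j i * fst p j m)))"

definition eigvec :: "real \<Rightarrow> real \<Rightarrow> real \<Rightarrow> nat \<Rightarrow> nat \<Rightarrow> nat \<Rightarrow> real" where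
  "eigvec \<theta> \<gamma> T n = fst (kernel_eigensystem \<theta> \<gamma> T n)"

definition eigval :: "real \<Rightarrow> real \<Rightarrow> real \<Rightarrow> nat \<Rightarrow> nat \<Rightarrow> real" where
  "eigval \<theta> \<gamma> T n = snd (kernel_eigensystem \<theta> \<gamma> T n)"

lemma eigvec_orthonormal: "orthonormal n n (eigvec \<theta> \<gamma> T n)"
  and kernel_matrix_spectral: "i < n \<Longrightarrow> m < n \<Longrightarrow>
    kernel_matrix \<theta> \<gamma> T n i m = (\<Sum>j<n. eigval \<theta> \<gamma> T n j * eigvec \<theta> \<gamma> T n j i * eigvec \<theta> \<gamma> T n j m)"
proof -
  obtain e l where "orthonormal n n e"
    "\<And>i m. i < n \<Longrightarrow> m < n \<Longrightarrow> kernel_matrix \<theta> \<gamma> T n i m = (\<Sum>j<n. l j * e j i * e j m)"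
    using symmetric_matrix_spectral[of "kernel_matrix \<theta> \<gamma> T n" n] kernel_matrix_sym by blast
  then have "\<exists>p. orthonormal n n (fst p) \<and>
     (\<forall>i<n. \<forall>m<n. kernel_matrix \<theta> \<gamma> T n i m = (\<Sum>j<n. snd p j * fst p j i * fst p j m))"
    by (intro exI[of _ "(e, l)"]) simp
  from someI_ex[OF this]
  have "orthonormal n n (eigvec \<theta> \<gamma> T n) \<and> (\<forall>i<n. \<forall>m<n. kernel_matrix \<theta> \<gamma> T n i m =
      (\<Sum>j<n. eigval \<theta> \<gamma> T n j * eigvec \<theta> \<gamma> T n j i * eigvec \<theta> \<gamma> T n j m))"
    unfolding eigvec_def eigval_def kernel_eigensystem_def .
  then show "orthonormal n n (eigvec \<theta> \<gamma> T n)" "i < n \<Longrightarrow> m < n \<Longrightarrow>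
    kernel_matrix \<theta> \<gamma> T n i m = (\<Sum>j<n. eigval \<theta> \<gamma> T n j * eigvec \<theta> \<gamma> T n j i * eigvec \<theta> \<gamma> T n j m)"
    by auto
qed

context brownian
begin

definition discretised_kernel :: "real \<Rightarrow> real \<Rightarrow> nat \<Rightarrow> real \<times> real \<Rightarrow> real" where
  "discretised_kernel \<theta> \<gamma> n p = (\<Sum>j<n. eigval \<theta> \<gamma> T n j *
     (case p of (t, s) \<Rightarrow> unit_step n (eigvec \<theta> \<gamma> T n j) t * unit_step n (eigvec \<theta> \<gamma> T n j) s))"

definition discretised_integral :: "real \<Rightarrow> real \<Rightarrow> nat \<Rightarrow> 'a \<Rightarrow> real" where
  "discretised_integral \<theta> \<gamma> n \<omega> = (\<Sum>j<n. eigval \<theta> \<gamma> T n j * ((normal_coord n (eigvec \<theta> \<gamma> T n j) \<omega>)\<^sup>2 - 1))"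

lemma has_double_discretised:
  "0 < n \<Longrightarrow> has_double_wiener_integral M B T (discretised_kernel \<theta> \<gamma> n) (discretised_integral \<theta> \<gamma> n)"
  unfolding discretised_kernel_def[abs_def] discretised_integral_def[abs_def]
  by (rule has_double_wiener_integral_quadratic[OF _ eigvec_orthonormal])

lemma discretised_kernel_error_bound:
  assumes "0 < \<theta>"
  shows "\<exists>c. \<forall>n>0. (\<integral>p. (discretised_kernel \<theta> \<gamma> n p - exp_kernel \<theta> \<gamma> T p)\<^sup>2 \<partial>Sq) \<le> c / (real n)\<^sup>2"
  using discretised_kernel_L2_error[OF _ assms eigvec_orthonormal kernel_matrix_spectral]
  unfolding discretised_kernel_def[symmetric] by (intro exI allI impI)

text \<open>On grids with \<open>2\<^sup>n\<close> cells the discretisation error decays geometrically, and by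
  the isometry so do the distances between the discretised integrals, which therefore converge.\<close>

lemma has_double_exp_kernel_exists:
  assumes \<theta>: "0 < \<theta>"
  shows "\<exists>X. has_double_wiener_integral M B T (exp_kernel \<theta> \<gamma> T) X"
proof -
  from discretised_kernel_error_bound[where \<gamma>=\<gamma>, OF \<theta>]
  obtain c where "\<forall>n>0. (\<integral>p. (discretised_kernel \<theta> \<gamma> n p - exp_kernel \<theta> \<gamma> T p)\<^sup>2 \<partial>Sq) \<le> c / (real n)\<^sup>2"
    by (elim exE)
  note c = this[rule_format]
  define K where "K n = discretised_kernel \<theta> \<gamma> (2 ^ n)" for n :: nat
  define X where "X n = discretised_integral \<theta> \<gamma> (2 ^ n)" for n :: nat
  have KX: "has_double_wiener_integral M B T (K n) (X n)" for n
    unfolding K_def X_def by (rule has_double_discretised) simp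
  note KX2 = has_double_wiener_integral_L2[OF KX]
  have err: "(\<integral>p. (K n p - exp_kernel \<theta> \<gamma> T p)\<^sup>2 \<partial>Sq) \<le> c * (1 / 4) ^ n" for n
  proof -
    have "(real (2 ^ n))\<^sup>2 = (2 ^ 2) ^ n" by (simp only: of_nat_power of_nat_numeral power_mult[symmetric] mult.commute)
    then have q: "c / (real (2 ^ n))\<^sup>2 = c * (1 / 4) ^ n" by (simp only: power_one_over) simp
    have "0 < (2 :: nat) ^ n" by simp
    from c[OF this] show ?thesis unfolding q K_def .
  qed
  have c0: "0 \<le> c"
  proof -
    have "0 \<le> (\<integral>p. (K 0 p - exp_kernel \<theta> \<gamma> T p)\<^sup>2 \<partial>Sq)" by simp
    also note err[of 0]
    finally show ?thesis by simp
  qed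
  have "expectation (\<lambda>\<omega>. (X m \<omega> - X n \<omega>)\<^sup>2) \<le> (8 * c) * (1 / 4) ^ m" if "m \<le> n" for m n
  proof -
    have "expectation (\<lambda>\<omega>. (X m \<omega> - X n \<omega>)\<^sup>2) = 2 * (\<integral>p. (K m p - K n p)\<^sup>2 \<partial>Sq)"
      by (rule double_isometry[OF KX KX])
    moreover have "(\<integral>p. (K m p - K n p)\<^sup>2 \<partial>Sq) \<le> 4 * (c * (1 / 4) ^ m)"
    proof -
      have "(\<integral>p. (K m p - K n p)\<^sup>2 \<partial>Sq)
          = (\<integral>p. ((K m p - exp_kernel \<theta> \<gamma> T p) + (exp_kernel \<theta> \<gamma> T p - K n p))\<^sup>2 \<partial>Sq)" by simp
      also have "\<dots> \<le> 2 * (\<integral>p. (K m p - exp_kernel \<theta> \<gamma> T p)\<^sup>2 \<partial>Sq) + 2 * (\<integral>p. (exp_kernel \<theta> \<gamma> T p - K n p)\<^sup>2 \<partial>Sq)"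
        by (intro integral_sq_triangle L2_diff exp_kernel_L2[OF \<theta>] KX2[THEN conjunct1])
      also have "\<dots> \<le> 2 * (c * (1 / 4) ^ m) + 2 * (c * (1 / 4) ^ n)"
        using err[of m] err[of n] by (simp add: power2_commute[of "exp_kernel \<theta> \<gamma> T _"])
      also have "\<dots> \<le> 4 * (c * (1 / 4) ^ m)"
      proof -
        have "(1 / 4 :: real) ^ n \<le> (1 / 4) ^ m" using that by (intro power_decreasing) auto
        then show ?thesis using c0 mult_left_mono[of "(1 / 4) ^ n" "(1 / 4) ^ m" c] by linarith
      qed
      finally show ?thesis .
    qed
    ultimately show ?thesis by simp
  qed
  then obtain Y where Y: "L2_tendsto M X Y"
    using L2_complete[of X "8 * c"] KX2 by blast
  have "L2_tendsto Sq K (exp_kernel \<theta> \<gamma> T)"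
    unfolding L2_tendsto_def
  proof (intro conjI allI)
    have "(\<lambda>n. c * (1 / 4) ^ n) \<longlonglongrightarrow> 0"
      by (auto intro!: tendsto_mult_right_zero LIMSEQ_realpow_zero)
    then show "(\<lambda>n. \<integral>p. (K n p - exp_kernel \<theta> \<gamma> T p)\<^sup>2 \<partial>Sq) \<longlonglongrightarrow> 0"
      by (rule Lim_null_comparison[rotated]) (use err in simp)
  qed (use KX2 exp_kernel_L2[OF \<theta>] in auto)
  from has_double_wiener_integral.limit[OF KX this Y] show ?thesis by blast
qed

lemma double_wiener_integral_exp_kernel:
  assumes "0 < \<theta>"
  shows "has_double_wiener_integral M B T (exp_kernel \<theta> \<gamma> T) (double_wiener_integral M B T (exp_kernel \<theta> \<gamma> T))"
  unfolding double_wiener_integral_def by (rule someI_ex[OF has_double_exp_kernel_exists[OF assms]])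

lemma double_wiener_integral_L2:
  "0 < \<theta> \<Longrightarrow> double_wiener_integral M B T (exp_kernel \<theta> \<gamma> T) \<in> L2 M"
  using has_double_wiener_integral_L2[OF double_wiener_integral_exp_kernel] by blast

lemma discretised_char_tendsto:
  assumes \<theta>: "0 < \<theta>"
  shows "(\<lambda>n. expectation (\<lambda>\<omega>. iexp (u * discretised_integral \<theta> \<gamma> n \<omega>)))
    \<longlonglongrightarrow> expectation (\<lambda>\<omega>. iexp (u * double_wiener_integral M B T (exp_kernel \<theta> \<gamma> T) \<omega>))"
proof -
  from discretised_kernel_error_bound[where \<gamma>=\<gamma>, OF \<theta>]
  obtain c where "\<forall>n>0. (\<integral>p. (discretised_kernel \<theta> \<gamma> n p - exp_kernel \<theta> \<gamma> T p)\<^sup>2 \<partial>Sq) \<le> c / (real n)\<^sup>2"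
    by (elim exE)
  note c = this[rule_format]
  let ?Y = "double_wiener_integral M B T (exp_kernel \<theta> \<gamma> T)"
  let ?X = "\<lambda>n. discretised_integral \<theta> \<gamma> (Suc n)"
  have X: "has_double_wiener_integral M B T (discretised_kernel \<theta> \<gamma> (Suc n)) (?X n)" for n
    by (rule has_double_discretised) simp
  have "L2_tendsto M ?X ?Y"
    unfolding L2_tendsto_def
  proof (intro conjI allI)
    show "?X n \<in> L2 M" for n using has_double_wiener_integral_L2[OF X] by blast
    show "?Y \<in> L2 M" by (rule double_wiener_integral_L2[OF \<theta>])
    have "(\<lambda>n. 2 * (c * inverse (real (Suc n)) ^ 2)) \<longlonglongrightarrow> 2 * (c * 0 ^ 2)"
      by (intro tendsto_intros LIMSEQ_inverse_real_of_nat)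
    moreover have "norm (expectation (\<lambda>\<omega>. (?X n \<omega> - ?Y \<omega>)\<^sup>2)) \<le> 2 * (c * inverse (real (Suc n)) ^ 2)" for n
      using c[of "Suc n"] double_isometry[OF X double_wiener_integral_exp_kernel[OF \<theta>], of n]
      by (simp add: power_inverse divide_inverse)
    moreover have "2 * (c * 0 ^ 2) = 0" by simp
    ultimately show "(\<lambda>n. expectation (\<lambda>\<omega>. (?X n \<omega> - ?Y \<omega>)\<^sup>2)) \<longlonglongrightarrow> 0"
      by (metis (no_types, lifting) Lim_null_comparison always_eventually)
  qed
  from L2_tendsto_char[OF this, of u] show ?thesis by (rule LIMSEQ_imp_Suc)
qed

end

section \<open>Characteristic functions of Gaussian quadratic forms\<close>

lemma integral_exp_square_std_normal:
  assumes "0 \<le> w"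
  shows "(\<integral>y. exp (- (w * y\<^sup>2 / 2)) \<partial>std_normal_distribution) = 1 / sqrt (1 + w)"
proof -
  define s where "s = 1 / sqrt (1 + w)"
  have s: "0 < s" "s\<^sup>2 = 1 / (1 + w)" using assms by (auto simp: s_def power_divide)
  have eq: "std_normal_density y * exp (- (w * y\<^sup>2 / 2)) = s * normal_density 0 s y" for y
  proof -
    have "std_normal_density y * exp (- (w * y\<^sup>2 / 2)) = 1 / sqrt (2 * pi) * exp (- (1 + w) * y\<^sup>2 / 2)"
      by (simp add: std_normal_density_def algebra_simps add_divide_distrib diff_divide_distrib flip: exp_add)
    moreover have "y\<^sup>2 / (2 * s\<^sup>2) = (1 + w) * y\<^sup>2 / 2" unfolding s(2) by simp
    then have "s * normal_density 0 s y = 1 / sqrt (2 * pi) * exp (- (1 + w) * y\<^sup>2 / 2)"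
      using s(1) by (simp add: normal_density_def real_sqrt_mult algebra_simps)
    ultimately show ?thesis by simp
  qed
  have "(\<integral>y. exp (- (w * y\<^sup>2 / 2)) \<partial>std_normal_distribution) = (\<integral>y. std_normal_density y * exp (- (w * y\<^sup>2 / 2)) \<partial>lborel)"
    by (subst integral_density) auto
  also have "\<dots> = s" unfolding eq using s(1) by simp
  finally show ?thesis by (simp add: s_def)
qed

text \<open>Independent standard normal variables, described only by their joint characteristic function.\<close>

locale gaussian_vector = prob_space M for M :: "'a measure" +
  fixes n :: nat and \<eta> :: "nat \<Rightarrow> 'a \<Rightarrow> real"
  assumes \<eta>_measurable [measurable]: "\<And>j. \<eta> j \<in> borel_measurable M"
    and joint_char: "\<And>z. expectation (\<lambda>\<omega>. iexp (\<Sum>j<n. z j * \<eta> j \<omega>)) = exp (- ((\<Sum>j<n. (z j)\<^sup>2) / 2))"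
begin

text \<open>The factors \<open>e\<^bsup>-w\<eta>\<^sup>2/2\<^esup>\<close> are brought in one at a time. Each
  of them is the characteristic function of a standard normal variable \<open>y\<close> at
  \<open>\<surd>w \<eta>\<close>, which adds \<open>\<surd>w y\<close> to one of the frequencies
  \<open>z\<close>; the remaining integral over \<open>y\<close> is Gaussian.\<close>

lemma partial_laplace:
  assumes w: "\<And>j. 0 \<le> w j"
  shows "m \<le> n \<Longrightarrow> expectation (\<lambda>\<omega>. iexp (\<Sum>j\<in>{m..<n}. z j * \<eta> j \<omega>) * complex_of_real (\<Prod>j<m. exp (- (w j * (\<eta> j \<omega>)\<^sup>2 / 2))))
     = complex_of_real (exp (- ((\<Sum>j\<in>{m..<n}. (z j)\<^sup>2) / 2)) * (\<Prod>j<m. 1 / sqrt (1 + w j)))"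
proof (induction m arbitrary: z)
  case 0
  show ?case using joint_char[of z] by (simp add: atLeast0LessThan)
next
  case (Suc m)
  interpret N: prob_space std_normal_distribution by (rule prob_space_normal_density) simp
  interpret P: pair_sigma_finite M std_normal_distribution ..
  interpret PP: pair_prob_space M std_normal_distribution ..
  define g where "g \<omega> = iexp (\<Sum>j\<in>{Suc m..<n}. z j * \<eta> j \<omega>) * complex_of_real (\<Prod>j<m. exp (- (w j * (\<eta> j \<omega>)\<^sup>2 / 2)))" for \<omega>
  have [measurable]: "g \<in> borel_measurable M" unfolding g_def by measurable
  have gb: "norm (g \<omega>) \<le> 1" for \<omega>
  proof -
    have "(\<Prod>j<m. exp (- (w j * (\<eta> j \<omega>)\<^sup>2 / 2))) \<le> 1"
      using w by (intro prod_le_1) auto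
    moreover have "0 \<le> (\<Prod>j<m. exp (- (w j * (\<eta> j \<omega>)\<^sup>2 / 2)))" by (intro prod_nonneg) auto
    moreover have "norm (g \<omega>) = \<bar>\<Prod>j<m. exp (- (w j * (\<eta> j \<omega>)\<^sup>2 / 2))\<bar>"
      unfolding g_def norm_mult norm_of_real by simp
    ultimately show ?thesis by simp
  qed
  define f where "f \<omega> y = g \<omega> * iexp (sqrt (w m) * y * \<eta> m \<omega>)" for \<omega> y
  have fi: "integrable (M \<Otimes>\<^sub>M std_normal_distribution) (case_prod f)"
  proof (rule PP.integrable_const_bound[where B=1])
    show "AE x in M \<Otimes>\<^sub>M std_normal_distribution. norm (case x of (\<omega>, y) \<Rightarrow> f \<omega> y) \<le> 1"
      using gb by (auto simp: f_def norm_mult)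
    show "case_prod f \<in> borel_measurable (M \<Otimes>\<^sub>M std_normal_distribution)"
      unfolding f_def by measurable
  qed
  have inner: "(\<integral>y. f \<omega> y \<partial>std_normal_distribution) = g \<omega> * complex_of_real (exp (- (w m * (\<eta> m \<omega>)\<^sup>2 / 2)))" for \<omega>
  proof -
    have "(\<integral>y. f \<omega> y \<partial>std_normal_distribution) = g \<omega> * (\<integral>y. iexp ((sqrt (w m) * \<eta> m \<omega>) * y) \<partial>std_normal_distribution)"
      unfolding f_def by (simp only: integral_mult_right_zero mult.commute mult.left_commute)
    also have "(\<integral>y. iexp ((sqrt (w m) * \<eta> m \<omega>) * y) \<partial>std_normal_distribution) = char std_normal_distribution (sqrt (w m) * \<eta> m \<omega>)"
      unfolding char_def ..
    also have "\<dots> = complex_of_real (exp (- (w m * (\<eta> m \<omega>)\<^sup>2 / 2)))"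
      using w[of m] by (simp add: char_std_normal_distribution power_mult_distrib)
    finally show ?thesis .
  qed
  have m: "{m..<n} = insert m {Suc m..<n}" using Suc.prems by auto
  have outer: "expectation (\<lambda>\<omega>. f \<omega> y)
      = complex_of_real (exp (- ((\<Sum>j\<in>{Suc m..<n}. (z j)\<^sup>2) / 2)) * (\<Prod>j<m. 1 / sqrt (1 + w j))) * complex_of_real (exp (- (w m * y\<^sup>2 / 2)))" for y
  proof -
    let ?z = "z(m := sqrt (w m) * y)"
    have s: "(\<Sum>j\<in>{m..<n}. ?z j * \<eta> j \<omega>) = sqrt (w m) * y * \<eta> m \<omega> + (\<Sum>j\<in>{Suc m..<n}. z j * \<eta> j \<omega>)" for \<omega>
      unfolding m by (subst sum.insert) auto
    have s2: "(\<Sum>j\<in>{m..<n}. (?z j)\<^sup>2) = w m * y\<^sup>2 + (\<Sum>j\<in>{Suc m..<n}. (z j)\<^sup>2)"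
      unfolding m using w[of m] by (subst sum.insert) (auto simp: power_mult_distrib)
    have "f \<omega> y = iexp (\<Sum>j\<in>{m..<n}. ?z j * \<eta> j \<omega>) * complex_of_real (\<Prod>j<m. exp (- (w j * (\<eta> j \<omega>)\<^sup>2 / 2)))" for \<omega>
      unfolding s f_def g_def by (simp add: distrib_left exp_add mult_ac)
    then have "expectation (\<lambda>\<omega>. f \<omega> y) = complex_of_real (exp (- ((\<Sum>j\<in>{m..<n}. (?z j)\<^sup>2) / 2)) * (\<Prod>j<m. 1 / sqrt (1 + w j)))"
      using Suc.IH[of ?z] Suc.prems by simp
    also have "exp (- ((\<Sum>j\<in>{m..<n}. (?z j)\<^sup>2) / 2)) = exp (- ((\<Sum>j\<in>{Suc m..<n}. (z j)\<^sup>2) / 2)) * exp (- (w m * y\<^sup>2 / 2))"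
      unfolding s2 by (simp add: add_divide_distrib flip: exp_add)
    finally show ?thesis by (simp add: mult_ac)
  qed
  have "expectation (\<lambda>\<omega>. iexp (\<Sum>j\<in>{Suc m..<n}. z j * \<eta> j \<omega>) * complex_of_real (\<Prod>j<Suc m. exp (- (w j * (\<eta> j \<omega>)\<^sup>2 / 2))))
    = expectation (\<lambda>\<omega>. \<integral>y. f \<omega> y \<partial>std_normal_distribution)"
    unfolding inner g_def by (simp add: mult.assoc)
  also have "\<dots> = (\<integral>y. expectation (\<lambda>\<omega>. f \<omega> y) \<partial>std_normal_distribution)"
    by (rule P.Fubini_integral[OF fi, symmetric])
  also have "\<dots> = complex_of_real (exp (- ((\<Sum>j\<in>{Suc m..<n}. (z j)\<^sup>2) / 2)) * (\<Prod>j<m. 1 / sqrt (1 + w j)))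
      * complex_of_real (\<integral>y. exp (- (w m * y\<^sup>2 / 2)) \<partial>std_normal_distribution)"
    unfolding outer by (simp only: integral_mult_right_zero integral_complex_of_real)
  also have "\<dots> = complex_of_real (exp (- ((\<Sum>j\<in>{Suc m..<n}. (z j)\<^sup>2) / 2)) * (\<Prod>j<Suc m. 1 / sqrt (1 + w j)))"
    unfolding integral_exp_square_std_normal[OF w] by simp
  finally show ?case .
qed

definition energy :: "(nat \<Rightarrow> real) \<Rightarrow> 'a \<Rightarrow> real" where
  "energy l \<omega> = (\<Sum>j<n. l j * (\<eta> j \<omega>)\<^sup>2)"

lemma energy_measurable [measurable]: "energy l \<in> borel_measurable M"
  unfolding energy_def[abs_def] by measurable

lemma energy_nonneg: "(\<And>j. 0 \<le> l j) \<Longrightarrow> 0 \<le> energy l \<omega>"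
  unfolding energy_def by (intro sum_nonneg mult_nonneg_nonneg) auto

lemma laplace_energy:
  assumes l: "\<And>j. 0 \<le> l j" and s: "0 \<le> s"
  shows "expectation (\<lambda>\<omega>. exp (- complex_of_real s * complex_of_real (energy l \<omega>)))
    = complex_of_real (\<Prod>j<n. 1 / sqrt (1 + 2 * s * l j))"
proof -
  have "exp (- complex_of_real s * complex_of_real (energy l \<omega>)) = complex_of_real (\<Prod>j<n. exp (- ((2 * s * l j) * (\<eta> j \<omega>)\<^sup>2 / 2)))" for \<omega>
  proof -
    have "- (s * energy l \<omega>) = (\<Sum>j<n. - ((2 * s * l j) * (\<eta> j \<omega>)\<^sup>2 / 2))"
      by (simp add: energy_def sum_distrib_left sum_negf mult.assoc)
    then have "exp (- (s * energy l \<omega>)) = (\<Prod>j<n. exp (- ((2 * s * l j) * (\<eta> j \<omega>)\<^sup>2 / 2)))"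
      by (simp only: exp_sum[OF finite_lessThan])
    moreover have "exp (- complex_of_real s * complex_of_real (energy l \<omega>)) = complex_of_real (exp (- (s * energy l \<omega>)))"
      by (simp add: exp_of_real[symmetric])
    ultimately show ?thesis by simp
  qed
  then show ?thesis
    using partial_laplace[of "\<lambda>j. 2 * s * l j" n "\<lambda>_. 0"] l s by simp
qed

lemma norm_exp_minus_energy:
  assumes "\<And>j. 0 \<le> l j"
  shows "norm (exp (- s * complex_of_real (energy l \<omega>))) = exp (- (Re s * energy l \<omega>))"
  by (simp add: norm_exp_eq_Re)

text \<open>The exponential factor absorbs the first two powers of the energy, so the difference quotient has
  an error of order \<open>h\<close>.\<close>

lemma laplace_energy_holomorphic:
  assumes l: "\<And>j. 0 \<le> l j"
  shows "(\<lambda>s. expectation (\<lambda>\<omega>. exp (- s * complex_of_real (energy l \<omega>)))) holomorphic_on {s. 0 < Re s}"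
proof -
  let ?Y = "energy l"
  let ?H = "\<lambda>s. expectation (\<lambda>\<omega>. exp (- s * complex_of_real (?Y \<omega>)))"
  let ?D = "\<lambda>s. expectation (\<lambda>\<omega>. complex_of_real (?Y \<omega>) * exp (- s * complex_of_real (?Y \<omega>)))"
  have Y: "0 \<le> ?Y \<omega>" for \<omega> by (rule energy_nonneg[OF l])
  have poly: "y * exp (- (r * y)) \<le> 1 / r" "y\<^sup>2 * exp (- (r * y)) \<le> 2 / r\<^sup>2" if "0 < r" "0 \<le> y" for r y :: real
  proof -
    have ry: "0 \<le> r * y" using that by simp
    have "r * y \<le> exp (r * y)" using exp_ge_add_one_self[of "r * y"] by linarith
    moreover have "(r * y)\<^sup>2 / 2 \<le> exp (r * y)" using exp_lower_Taylor_quadratic[OF ry] ry by simp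
    ultimately show "y * exp (- (r * y)) \<le> 1 / r" "y\<^sup>2 * exp (- (r * y)) \<le> 2 / r\<^sup>2"
      using that by (simp_all add: exp_minus field_simps)
  qed
  have "(?H has_field_derivative (- ?D s)) (at s)" if s: "0 < Re s" for s
  proof -
    define r where "r = Re s"
    have r: "0 < r" using s by (simp add: r_def)
    have i0: "integrable M (\<lambda>\<omega>. exp (- z * complex_of_real (?Y \<omega>)))" if "0 \<le> Re z" for z
    proof (rule integrable_const_bound[where B=1])
      show "AE \<omega> in M. norm (exp (- z * complex_of_real (?Y \<omega>))) \<le> 1"
        unfolding norm_exp_minus_energy[OF l] using that Y by (intro AE_I2) simp
    qed measurable
    have i1: "integrable M (\<lambda>\<omega>. complex_of_real (?Y \<omega>) * exp (- s * complex_of_real (?Y \<omega>)))"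
    proof (rule integrable_const_bound[where B="1 / r"])
      show "AE \<omega> in M. norm (complex_of_real (?Y \<omega>) * exp (- s * complex_of_real (?Y \<omega>))) \<le> 1 / r"
        unfolding norm_mult norm_exp_minus_energy[OF l] norm_of_real using poly(1)[OF r Y] Y
        by (intro AE_I2) (simp add: r_def)
    qed measurable
    have bound: "norm (?H (s + h) - ?H s - (- ?D s) * h) \<le> 8 / r\<^sup>2 * (norm h)\<^sup>2" if h: "norm h \<le> r / 2" for h
    proof -
      have "0 \<le> Re (s + h)" using abs_Re_le_cmod[of h] h r by (simp add: r_def)
      note ints = i0[OF this] i0[of s] i1
      have "?H (s + h) - ?H s - (- ?D s) * h = expectation (\<lambda>\<omega>. exp (- (s + h) * complex_of_real (?Y \<omega>)) - exp (- s * complex_of_real (?Y \<omega>))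
          + h * (complex_of_real (?Y \<omega>) * exp (- s * complex_of_real (?Y \<omega>))))"
        using ints s by (subst Bochner_Integration.integral_add) (auto simp: mult.commute)
      also have "norm \<dots> \<le> expectation (\<lambda>\<omega>. 8 / r\<^sup>2 * (norm h)\<^sup>2)"
      proof (rule order_trans[OF integral_norm_bound], rule integral_mono)
        show "integrable M (\<lambda>\<omega>. norm (exp (- (s + h) * complex_of_real (?Y \<omega>)) - exp (- s * complex_of_real (?Y \<omega>))
          + h * (complex_of_real (?Y \<omega>) * exp (- s * complex_of_real (?Y \<omega>)))))"
          using ints s by (intro integrable_norm Bochner_Integration.integrable_add Bochner_Integration.integrable_diff integrable_mult_right) auto
        fix \<omega>
        define y where "y = ?Y \<omega>"
        have y: "0 \<le> y" using Y by (simp add: y_def)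
        have "exp (- (s + h) * complex_of_real y) - exp (- s * complex_of_real y) + h * (complex_of_real y * exp (- s * complex_of_real y))
          = exp (- s * complex_of_real y) * (exp (- h * complex_of_real y) - (1 + (- h * complex_of_real y)))"
          by (simp add: algebra_simps flip: exp_add)
        then have "norm (exp (- (s + h) * complex_of_real y) - exp (- s * complex_of_real y) + h * (complex_of_real y * exp (- s * complex_of_real y)))
          = exp (- (r * y)) * norm (exp (- h * complex_of_real y) - (1 + (- h * complex_of_real y)))"
          by (simp add: norm_mult norm_exp_eq_Re r_def)
        also have "\<dots> \<le> exp (- (r * y)) * (exp (norm h * y) * (norm h * y)\<^sup>2)"
          using Taylor_exp_field[of "- h * complex_of_real y" 1] y
          by (intro mult_left_mono) (simp_all add: norm_mult power2_eq_square)
        also have "\<dots> \<le> exp (- (r * y)) * (exp (r / 2 * y) * (norm h * y)\<^sup>2)"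
          using mult_right_mono[OF h y] by (intro mult_left_mono mult_right_mono) auto
        also have "\<dots> = (norm h)\<^sup>2 * (y\<^sup>2 * exp (- (r / 2 * y)))"
          by (simp add: power_mult_distrib mult_ac flip: exp_add)
        also have "\<dots> \<le> (norm h)\<^sup>2 * (2 / (r / 2)\<^sup>2)"
          using r y by (intro mult_left_mono poly(2)) auto
        also have "\<dots> = 8 / r\<^sup>2 * (norm h)\<^sup>2" by (simp add: power_divide)
        finally show "norm (exp (- (s + h) * complex_of_real (?Y \<omega>)) - exp (- s * complex_of_real (?Y \<omega>))
          + h * (complex_of_real (?Y \<omega>) * exp (- s * complex_of_real (?Y \<omega>)))) \<le> 8 / r\<^sup>2 * (norm h)\<^sup>2"
          by (simp add: y_def)
      qed simp
      finally show ?thesis by (simp add: prob_space)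
    qed
    show ?thesis
      unfolding has_field_derivative_def has_derivative_at
    proof (intro conjI bounded_linear_mult_right)
      have ev: "\<forall>\<^sub>F h in at 0. norm (?H (s + h) - ?H s - (- ?D s) * h) / norm h \<le> 8 / r\<^sup>2 * norm h"
      proof -
        have "\<forall>\<^sub>F h :: complex in at 0. norm h \<le> r / 2"
          unfolding eventually_at using r by (intro exI[of _ "r / 2"]) auto
        moreover have "\<forall>\<^sub>F h :: complex in at 0. h \<noteq> 0" by (simp add: eventually_at_filter)
        ultimately show ?thesis
        proof eventually_elim
          case (elim h)
          then show ?case using bound[OF elim(1)] by (simp add: pos_divide_le_eq power2_eq_square mult.assoc)
        qed
      qed
      have "((\<lambda>h :: complex. 8 / r\<^sup>2 * norm h) \<longlongrightarrow> 8 / r\<^sup>2 * norm (0 :: complex)) (at 0)"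
        by (intro tendsto_intros)
      then have "((\<lambda>h :: complex. 8 / r\<^sup>2 * norm h) \<longlongrightarrow> 0) (at 0)" by simp
      then show "(\<lambda>h. norm (?H (s + h) - ?H s - (- ?D s) * h) / norm h) \<midarrow>0\<rightarrow> 0"
        by (rule Lim_null_comparison[rotated]) (use ev in simp)
    qed
  qed
  then show ?thesis
    unfolding holomorphic_on_def field_differentiable_def by (blast intro: has_field_derivative_at_within)
qed

text \<open>Both sides are holomorphic on the right half-plane and agree on the positive reals. All the
  arguments of the square roots have positive real part, so the principal branch is the right one.\<close>

lemma laplace_energy_complex:
  assumes l: "\<And>j. 0 \<le> l j" and s: "0 < Re s"
  shows "expectation (\<lambda>\<omega>. exp (- s * complex_of_real (energy l \<omega>))) = (\<Prod>j<n. 1 / csqrt (1 + 2 * s * l j))"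
proof -
  let ?S = "{s. 0 < Re s}"
  have re: "0 < Re (1 + 2 * z * complex_of_real (l j))" if "0 < Re z" for z j
    using l[of j] that by (simp add: add_pos_nonneg)
  define f where "f s = expectation (\<lambda>\<omega>. exp (- s * complex_of_real (energy l \<omega>))) - (\<Prod>j<n. 1 / csqrt (1 + 2 * s * l j))" for s
  have "f s = 0"
  proof (rule analytic_continuation[of f ?S "complex_of_real ` {0<..}" 1 s])
    show "f holomorphic_on ?S"
      unfolding f_def
    proof (intro holomorphic_on_diff laplace_energy_holomorphic l holomorphic_on_prod holomorphic_on_divide
        holomorphic_on_csqrt' holomorphic_intros)
      fix z j assume z: "z \<in> ?S"
      show "1 + 2 * z * complex_of_real (l j) \<notin> \<real>\<^sub>\<le>\<^sub>0"
        using re[of z j] z by (auto simp: complex_nonpos_Reals_iff)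
      show "csqrt (1 + 2 * z * complex_of_real (l j)) \<noteq> 0"
        using re[of z j] z by (metis csqrt_eq_0 less_irrefl mem_Collect_eq zero_complex.sel(1))
    qed
    show "open ?S" by (rule open_halfspace_Re_gt)
    show "connected ?S" by (intro convex_connected convex_halfspace_Re_gt)
    show "(1 :: complex) islimpt complex_of_real ` {0<..}"
      unfolding islimpt_approachable
    proof (intro allI impI)
      fix e :: real assume "0 < e"
      then have "complex_of_real (1 + e / 2) \<in> complex_of_real ` {0<..}" by (intro imageI) simp
      then show "\<exists>x'\<in>complex_of_real ` {0<..}. x' \<noteq> 1 \<and> dist x' 1 < e"
        using \<open>0 < e\<close> by (intro bexI[of _ "complex_of_real (1 + e / 2)"]) (auto simp: dist_norm)
    qed
    fix z assume "z \<in> complex_of_real ` {0<..}"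
    then obtain x where x: "0 < x" "z = complex_of_real x" by auto
    have "csqrt (1 + 2 * z * complex_of_real (l j)) = complex_of_real (sqrt (1 + 2 * x * l j))" for j
      using x l[of j] csqrt_of_real_nonneg[of "1 + 2 * complex_of_real x * complex_of_real (l j)"] by (simp add: x(2) complex_eq_iff)
    then show "f z = 0"
      using laplace_energy[OF l, of x] x by (simp add: f_def)
  qed (use s in auto)
  then show ?thesis by (simp add: f_def)
qed

text \<open>The boundary value of the Laplace transform at \<open>- iu\<close>, approached from the right.\<close>

theorem energy_char:
  assumes l: "\<And>j. 0 \<le> l j"
  shows "expectation (\<lambda>\<omega>. iexp (u * energy l \<omega>)) = (\<Prod>j<n. 1 / csqrt (1 - 2 * \<i> * u * l j))"
proof -
  \<comment> \<open>points of the open half-plane that converge to \<open>- iu\<close>\<close>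
  define s where "s k = complex_of_real (inverse (real (Suc k))) - \<i> * u" for k
  have s0: "s \<longlonglongrightarrow> 0 - \<i> * u"
    unfolding s_def by (intro tendsto_intros) (metis LIMSEQ_inverse_real_of_nat of_real_0 tendsto_of_real_iff)
  have "(\<lambda>k. expectation (\<lambda>\<omega>. exp (- s k * complex_of_real (energy l \<omega>)))) \<longlonglongrightarrow> expectation (\<lambda>\<omega>. iexp (u * energy l \<omega>))"
  proof (rule integral_dominated_convergence[where w="\<lambda>_. 1"])
    show "AE \<omega> in M. (\<lambda>k. exp (- s k * complex_of_real (energy l \<omega>))) \<longlonglongrightarrow> iexp (u * energy l \<omega>)"
    proof (intro AE_I2)
      fix \<omega>
      have "(\<lambda>k. exp (- s k * complex_of_real (energy l \<omega>))) \<longlonglongrightarrow> exp (- (0 - \<i> * u) * complex_of_real (energy l \<omega>))"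
        by (intro tendsto_intros s0)
      then show "(\<lambda>k. exp (- s k * complex_of_real (energy l \<omega>))) \<longlonglongrightarrow> iexp (u * energy l \<omega>)" by (simp add: mult.assoc)
    qed
    show "AE \<omega> in M. norm (exp (- s k * complex_of_real (energy l \<omega>))) \<le> 1" for k
      unfolding norm_exp_minus_energy[OF l] using energy_nonneg[OF l] by (intro AE_I2) (simp add: s_def)
  qed simp_all
  moreover have "(\<lambda>k. \<Prod>j<n. 1 / csqrt (1 + 2 * s k * l j)) \<longlonglongrightarrow> (\<Prod>j<n. 1 / csqrt (1 + 2 * (0 - \<i> * u) * l j))"
  proof (intro tendsto_prod tendsto_divide tendsto_const)
    fix j
    have z: "1 + 2 * (0 - \<i> * u) * complex_of_real (l j) \<notin> \<real>\<^sub>\<le>\<^sub>0" by (simp add: complex_nonpos_Reals_iff)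
    show "(\<lambda>k. csqrt (1 + 2 * s k * complex_of_real (l j))) \<longlonglongrightarrow> csqrt (1 + 2 * (0 - \<i> * u) * complex_of_real (l j))"
      by (rule isCont_tendsto_compose[OF continuous_at_csqrt[OF z]]) (intro tendsto_intros s0)
    show "csqrt (1 + 2 * (0 - \<i> * u) * complex_of_real (l j)) \<noteq> 0"
      unfolding csqrt_eq_0 by (simp add: complex_eq_iff)
  qed
  moreover have "expectation (\<lambda>\<omega>. exp (- s k * complex_of_real (energy l \<omega>))) = (\<Prod>j<n. 1 / csqrt (1 + 2 * s k * l j))" for k
    by (rule laplace_energy_complex[OF l]) (simp add: s_def)
  ultimately show ?thesis using LIMSEQ_unique by (simp add: mult.assoc)
qed

end

text \<open>The characteristic function of \<open>\<Sum>j<n. l\<^sub>j (\<eta>\<^sub>j\<^sup>2 - 1)\<close>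
  for independent standard normal \<open>\<eta>\<^sub>j\<close>.\<close>

definition chi :: "(nat \<Rightarrow> real) \<Rightarrow> nat \<Rightarrow> real \<Rightarrow> complex" where
  "chi l n u = (\<Prod>j<n. exp (- (\<i> * u * l j)) / csqrt (1 - 2 * \<i> * u * l j))"

lemma norm_chi_factor: "norm (exp (- (\<i> * complex_of_real u * complex_of_real l)) / csqrt (1 - 2 * \<i> * u * l)) ^ 4 = 1 / (1 + 4 * u\<^sup>2 * l\<^sup>2)"
proof -
  have "norm (exp (- (\<i> * complex_of_real u * complex_of_real l))) = 1" by (simp add: norm_exp_eq_Re)
  moreover have "norm (csqrt (1 - 2 * \<i> * u * l)) ^ 4 = (norm (1 - 2 * \<i> * complex_of_real u * complex_of_real l))\<^sup>2"
  proof -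
    have "sqrt y ^ 4 = y\<^sup>2" if "0 \<le> y" for y :: real
      using that by (simp add: power4_eq_xxxx power2_eq_square)
    then show ?thesis by simp
  qed
  moreover have "(norm (1 - 2 * \<i> * complex_of_real u * complex_of_real l))\<^sup>2 = 1 + 4 * u\<^sup>2 * l\<^sup>2"
    unfolding cmod_power2 by (simp add: power_mult_distrib)
  ultimately show ?thesis by (simp only: norm_divide power_divide power_one)
qed

lemma norm_chi: "norm (chi l n u) ^ 4 = (\<Prod>j<n. 1 / (1 + 4 * u\<^sup>2 * (l j)\<^sup>2))"
  unfolding chi_def prod_norm[symmetric] prod_power_distrib norm_chi_factor ..

lemma norm_chi_antimono:
  assumes "\<bar>u\<bar> \<le> \<bar>v\<bar>"
  shows "norm (chi l n v) \<le> norm (chi l n u)"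
proof -
  have "u\<^sup>2 \<le> v\<^sup>2" using assms by (simp add: abs_le_square_iff)
  then have "norm (chi l n v) ^ 4 \<le> norm (chi l n u) ^ 4"
    unfolding norm_chi by (intro prod_mono conjI divide_left_mono add_left_mono mult_right_mono mult_left_mono mult_pos_pos add_pos_nonneg) auto
  then show ?thesis by (subst (asm) power_mono_iff) auto
qed

lemma chi_0 [simp]: "chi l n 0 = 1"
  by (simp add: chi_def)

lemma chi_uminus: "chi l n (- u) = chi (\<lambda>j. - l j) n u"
  by (simp add: chi_def)

lemma norm_chi_count:
  assumes "m \<le> card {j. j < n \<and> t \<le> l j}" "0 \<le> t"
  shows "norm (chi l n u) ^ 4 \<le> (1 / (1 + 4 * u\<^sup>2 * t\<^sup>2)) ^ m"
proof -
  let ?J = "{j. j < n \<and> t \<le> l j}"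
  have f: "0 \<le> 1 / (1 + 4 * u\<^sup>2 * (l j)\<^sup>2)" "1 / (1 + 4 * u\<^sup>2 * (l j)\<^sup>2) \<le> 1" for j
    by (auto simp: divide_le_eq_1 add_pos_nonneg)
  have "norm (chi l n u) ^ 4 \<le> (\<Prod>j\<in>?J. 1 / (1 + 4 * u\<^sup>2 * (l j)\<^sup>2))"
    unfolding norm_chi
  proof -
    have "(\<Prod>j<n. 1 / (1 + 4 * u\<^sup>2 * (l j)\<^sup>2)) = (\<Prod>j\<in>?J. 1 / (1 + 4 * u\<^sup>2 * (l j)\<^sup>2)) * (\<Prod>j\<in>{..<n} - ?J. 1 / (1 + 4 * u\<^sup>2 * (l j)\<^sup>2))"
      by (subst mult.commute, rule prod.subset_diff) auto
    also have "\<dots> \<le> (\<Prod>j\<in>?J. 1 / (1 + 4 * u\<^sup>2 * (l j)\<^sup>2)) * 1"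
      using f by (intro mult_left_mono prod_le_1 prod_nonneg) auto
    finally show "(\<Prod>j<n. 1 / (1 + 4 * u\<^sup>2 * (l j)\<^sup>2)) \<le> (\<Prod>j\<in>?J. 1 / (1 + 4 * u\<^sup>2 * (l j)\<^sup>2))" by simp
  qed
  also have "\<dots> \<le> (\<Prod>j\<in>?J. 1 / (1 + 4 * u\<^sup>2 * t\<^sup>2))"
  proof (intro prod_mono conjI f)
    fix j assume "j \<in> ?J"
    then have "t\<^sup>2 \<le> (l j)\<^sup>2" using assms(2) by (intro power_mono) auto
    then show "1 / (1 + 4 * u\<^sup>2 * (l j)\<^sup>2) \<le> 1 / (1 + 4 * u\<^sup>2 * t\<^sup>2)"
      by (intro divide_left_mono add_left_mono mult_left_mono mult_pos_pos add_pos_nonneg) auto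
  qed
  also have "\<dots> = (1 / (1 + 4 * u\<^sup>2 * t\<^sup>2)) ^ card ?J" by simp
  also have "\<dots> \<le> (1 / (1 + 4 * u\<^sup>2 * t\<^sup>2)) ^ m"
    using assms(1) by (intro power_decreasing) (auto simp: divide_le_eq_1 add_pos_nonneg)
  finally show ?thesis .
qed

text \<open>The logarithmic derivative at \<open>u\<close> of one factor of \<^const>\<open>chi\<close>.\<close>

definition log_slope :: "real \<Rightarrow> real \<Rightarrow> complex" where
  "log_slope u l = - 2 * complex_of_real u * (complex_of_real l)\<^sup>2 / (1 - 2 * \<i> * complex_of_real u * complex_of_real l)"

lemma chi_factor_derivative:
  fixes l :: real
  shows "((\<lambda>u. exp (- (\<i> * complex_of_real u * complex_of_real l)) / csqrt (1 - 2 * \<i> * u * l)) has_vector_derivative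
     exp (- (\<i> * complex_of_real u * complex_of_real l)) / csqrt (1 - 2 * \<i> * u * l) * log_slope u l) (at u)"
proof -
  let ?z = "complex_of_real u" and ?l = "complex_of_real l"
  let ?w = "1 - 2 * \<i> * ?z * ?l"
  have w: "?w \<notin> \<real>\<^sub>\<le>\<^sub>0" by (simp add: complex_nonpos_Reals_iff)
  have w0: "?w \<noteq> 0" by (simp add: complex_eq_iff)
  then have c0: "csqrt ?w \<noteq> 0" by simp
  have cc: "csqrt ?w * csqrt ?w = ?w" using power2_csqrt[of ?w] by (simp only: power2_eq_square)
  have C: "((\<lambda>z. csqrt (1 - 2 * \<i> * z * ?l)) has_field_derivative (- 2 * \<i> * ?l) / (2 * csqrt ?w)) (at ?z)"
  proof -
    have "((\<lambda>z. 1 - 2 * \<i> * z * ?l) has_field_derivative - 2 * \<i> * ?l) (at ?z)"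
      by (auto intro!: derivative_eq_intros)
    from DERIV_chain2[where f=csqrt and g="\<lambda>z. 1 - 2 * \<i> * z * ?l", OF has_field_derivative_csqrt[OF w] this]
    show ?thesis by (simp only: divide_inverse mult.commute)
  qed
  have E: "((\<lambda>z. exp (- (\<i> * z * ?l))) has_field_derivative exp (- (\<i> * ?z * ?l)) * (- (\<i> * ?l))) (at ?z)"
    by (auto intro!: derivative_eq_intros)
  have "((\<lambda>z. exp (- (\<i> * z * ?l)) / csqrt (1 - 2 * \<i> * z * ?l)) has_field_derivative
     (exp (- (\<i> * ?z * ?l)) * (- (\<i> * ?l)) * csqrt ?w - exp (- (\<i> * ?z * ?l)) * ((- 2 * \<i> * ?l) / (2 * csqrt ?w))) / (csqrt ?w * csqrt ?w)) (at ?z)"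
    by (rule DERIV_divide[OF E C c0])
  also have "(exp (- (\<i> * ?z * ?l)) * (- (\<i> * ?l)) * csqrt ?w - exp (- (\<i> * ?z * ?l)) * ((- 2 * \<i> * ?l) / (2 * csqrt ?w))) / (csqrt ?w * csqrt ?w)
     = exp (- (\<i> * ?z * ?l)) / csqrt ?w * ((- (\<i> * ?l)) + \<i> * ?l / (csqrt ?w * csqrt ?w))"
    using c0 by (simp add: field_simps)
  also have "(- (\<i> * ?l)) + \<i> * ?l / (csqrt ?w * csqrt ?w) = - 2 * ?z * ?l\<^sup>2 / ?w"
    unfolding cc using w0 by (simp add: field_simps power2_eq_square)
  finally show ?thesis
    by (intro has_vector_derivative_real_field) (simp add: log_slope_def)
qed

lemma has_vector_derivative_prod_log:
  fixes f d :: "nat \<Rightarrow> real \<Rightarrow> complex"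
  assumes "\<And>j. (f j has_vector_derivative f j u * d j u) (at u)"
  shows "((\<lambda>u. \<Prod>j<n. f j u) has_vector_derivative (\<Prod>j<n. f j u) * (\<Sum>j<n. d j u)) (at u)"
proof (induction n)
  case (Suc n)
  from has_vector_derivative_mult[OF Suc assms[of n]]
  show ?case by (simp add: algebra_simps)
qed simp

lemma chi_derivative:
  "(chi l n has_vector_derivative chi l n u * (\<Sum>j<n. log_slope u (l j))) (at u)"
  unfolding chi_def[abs_def] by (rule has_vector_derivative_prod_log) (rule chi_factor_derivative)

lemma norm_one_minus_imaginary: "1 \<le> norm (1 - 2 * \<i> * complex_of_real u * complex_of_real l)"
  using abs_Re_le_cmod[of "1 - 2 * \<i> * complex_of_real u * complex_of_real l"] by simp

text \<open>A bound for the difference of the logarithmic derivatives of \<^const>\<open>chi\<close> and of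
  the Gaussian \<open>e\<^bsup>-su\<^sup>2\<^esup>\<close>.\<close>

definition drift :: "(nat \<Rightarrow> real) \<Rightarrow> nat \<Rightarrow> real \<Rightarrow> real \<Rightarrow> real" where
  "drift l n s u = 2 * u * \<bar>s - (\<Sum>j<n. (l j)\<^sup>2)\<bar> + 4 * u\<^sup>2 * (\<Sum>j<n. \<bar>l j\<bar> ^ 3)"

lemma drift_mono: "0 \<le> u \<Longrightarrow> u \<le> v \<Longrightarrow> drift l n s u \<le> drift l n s v"
  unfolding drift_def by (intro add_mono mult_right_mono mult_left_mono power_mono sum_nonneg) auto

lemma drift_nonneg: "0 \<le> u \<Longrightarrow> 0 \<le> drift l n s u"
  unfolding drift_def by (intro add_nonneg_nonneg mult_nonneg_nonneg sum_nonneg) auto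

lemma log_derivative_bound:
  assumes u: "0 \<le> u"
  shows "norm ((\<Sum>j<n. log_slope u (l j)) + complex_of_real (2 * s * u)) \<le> drift l n s u"
proof -
  let ?S = "\<Sum>j<n. (l j)\<^sup>2"
  have "(\<Sum>j<n. log_slope u (l j)) + complex_of_real (2 * s * u)
    = complex_of_real (2 * u * (s - ?S)) + (\<Sum>j<n. 2 * complex_of_real u * (l j)\<^sup>2 + log_slope u (l j))"
    by (simp add: sum.distrib algebra_simps sum_distrib_left)
  also have "norm \<dots> \<le> 2 * u * \<bar>s - ?S\<bar> + (\<Sum>j<n. norm (2 * complex_of_real u * (l j)\<^sup>2 + log_slope u (l j)))"
  proof (intro order_trans[OF norm_triangle_ineq] add_mono norm_sum)
    have "norm (complex_of_real (2 * u * (s - ?S))) = \<bar>2 * u * (s - ?S)\<bar>" by (rule norm_of_real)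
    then show "norm (complex_of_real (2 * u * (s - ?S))) \<le> 2 * u * \<bar>s - ?S\<bar>" using u by (simp add: abs_mult)
  qed
  also have "(\<Sum>j<n. norm (2 * complex_of_real u * (l j)\<^sup>2 + log_slope u (l j))) \<le> (\<Sum>j<n. 4 * u\<^sup>2 * \<bar>l j\<bar> ^ 3)"
  proof (rule sum_mono)
    fix j
    let ?w = "1 - 2 * \<i> * complex_of_real u * complex_of_real (l j)"
    have w: "?w \<noteq> 0" by (simp add: complex_eq_iff)
    have "2 * complex_of_real u * (l j)\<^sup>2 + log_slope u (l j) = - 4 * \<i> * u\<^sup>2 * (l j) ^ 3 / ?w"
    proof -
      have "a + - a / w = a * (w - 1) / w" if "w \<noteq> 0" for a w :: complex using that by (simp add: field_simps)
      note key = this[OF w, of "2 * complex_of_real u * (l j)\<^sup>2"]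
      have num: "2 * complex_of_real u * (l j)\<^sup>2 * (?w - 1) = - 4 * \<i> * u\<^sup>2 * (l j) ^ 3"
        by (simp add: power2_eq_square power3_eq_cube mult_ac)
      have ls: "log_slope u (l j) = - (2 * complex_of_real u * (l j)\<^sup>2) / ?w"
        unfolding log_slope_def by (simp only: mult_minus_left of_real_power)
      show ?thesis unfolding ls using key unfolding num .
    qed
    then have "norm (2 * complex_of_real u * (l j)\<^sup>2 + log_slope u (l j)) = 4 * u\<^sup>2 * \<bar>l j\<bar> ^ 3 / norm ?w"
      by (simp add: norm_divide norm_mult norm_power)
    also have "\<dots> \<le> 4 * u\<^sup>2 * \<bar>l j\<bar> ^ 3 / 1"
    proof (intro divide_left_mono norm_one_minus_imaginary mult_pos_pos)
      show "0 < norm ?w" by (rule less_le_trans[OF zero_less_one norm_one_minus_imaginary])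
    qed auto
    finally show "norm (2 * complex_of_real u * (l j)\<^sup>2 + log_slope u (l j)) \<le> 4 * u\<^sup>2 * \<bar>l j\<bar> ^ 3" by simp
  qed
  finally show ?thesis by (simp add: drift_def sum_distrib_left)
qed

text \<open>The mean value inequality for \<open>chi u e\<^bsup>su\<^sup>2\<^esup>\<close>, whose derivative
  is controlled by the drift.\<close>

lemma chi_gaussian_increment:
  assumes s: "0 \<le> s" and a: "0 \<le> a" "a \<le> b"
  shows "norm (chi l n b * exp (s * b\<^sup>2) - chi l n a * exp (s * a\<^sup>2))
     \<le> norm (chi l n a) * exp (s * b\<^sup>2) * drift l n s b * (b - a)"
proof (cases "a = b")
  case False
  let ?g = "\<lambda>u. chi l n u * complex_of_real (exp (s * u\<^sup>2))"
  let ?D = "\<lambda>u. \<Sum>j<n. log_slope u (l j)"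
  have d: "(?g has_vector_derivative ?g u * (?D u + complex_of_real (2 * s * u))) (at u)" for u
  proof -
    have "((\<lambda>u. complex_of_real (exp (s * u\<^sup>2))) has_vector_derivative complex_of_real (exp (s * u\<^sup>2) * (2 * s * u))) (at u)"
      by (rule has_vector_derivative_of_real) (auto intro!: derivative_eq_intros simp: has_real_derivative_iff_has_vector_derivative[symmetric])
    from has_vector_derivative_mult[OF chi_derivative[of l n u] this]
    show ?thesis by (simp add: algebra_simps)
  qed
  have "continuous_on {a..b} ?g"
    using d by (meson continuous_at_imp_continuous_on has_vector_derivative_continuous)
  moreover have "(?g has_derivative (\<lambda>h. h *\<^sub>R (?g u * (?D u + complex_of_real (2 * s * u))))) (at u)" for u
    using d unfolding has_vector_derivative_def .
  ultimately obtain u where u: "u \<in> {a<..<b}" "norm (?g b - ?g a) \<le> norm ((b - a) *\<^sub>R (?g u * (?D u + complex_of_real (2 * s * u))))"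
    using mvt_general[of a b ?g "\<lambda>u h. h *\<^sub>R (?g u * (?D u + complex_of_real (2 * s * u)))"] a False by auto
  have "norm (?g u * (?D u + complex_of_real (2 * s * u))) \<le> (norm (chi l n a) * exp (s * b\<^sup>2)) * drift l n s b"
    unfolding norm_mult
  proof (intro mult_mono)
    show "norm (chi l n u) \<le> norm (chi l n a)" using u a by (intro norm_chi_antimono) auto
    show "norm (complex_of_real (exp (s * u\<^sup>2))) \<le> exp (s * b\<^sup>2)" using u a s by (auto intro!: mult_left_mono power_mono)
    show "norm (?D u + complex_of_real (2 * s * u)) \<le> drift l n s b"
      using log_derivative_bound[where u=u and l=l and n=n and s=s] drift_mono[of u b l n s] u a by auto
  qed auto
  then have "(b - a) * norm (?g u * (?D u + complex_of_real (2 * s * u))) \<le> (b - a) * ((norm (chi l n a) * exp (s * b\<^sup>2)) * drift l n s b)"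
    using a by (intro mult_left_mono) auto
  then show ?thesis using u(2) a by (simp add: mult_ac)
qed (use drift_nonneg[of b] a in auto)

text \<open>The increment is split at \<open>u / 2\<close>. On the first half the weight
  \<open>e\<^bsup>su\<^sup>2/4\<^esup>\<close> leaves Gaussian decay after division by
  \<open>e\<^bsup>su\<^sup>2\<^esup>\<close>; on the second half the decay comes from
  \<^const>\<open>chi\<close> itself.\<close>

lemma chi_gaussian_nonneg:
  assumes s: "0 \<le> s" and u: "0 \<le> u"
  shows "norm (chi l n u - exp (- (s * u\<^sup>2))) \<le> u / 2 * drift l n s u * (exp (- (3 / 4 * s * u\<^sup>2)) + norm (chi l n (u / 2)))"
proof -
  have E: "exp (s * u\<^sup>2) * exp (- (s * u\<^sup>2)) = (1 :: real)" by (simp flip: exp_add)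
  have "norm (chi l n u * exp (s * u\<^sup>2) - 1) \<le> norm (chi l n u * exp (s * u\<^sup>2) - chi l n (u / 2) * exp (s * (u / 2)\<^sup>2))
      + norm (chi l n (u / 2) * exp (s * (u / 2)\<^sup>2) - chi l n 0 * exp (s * 0\<^sup>2))"
    by (rule order_trans[OF _ norm_triangle_ineq]) simp
  also have "\<dots> \<le> norm (chi l n (u / 2)) * exp (s * u\<^sup>2) * drift l n s u * (u - u / 2)
     + norm (chi l n 0) * exp (s * (u / 2)\<^sup>2) * drift l n s (u / 2) * (u / 2 - 0)"
    using s u by (intro add_mono chi_gaussian_increment) auto
  also have "\<dots> \<le> u / 2 * drift l n s u * (exp (s * (u / 2)\<^sup>2) + norm (chi l n (u / 2)) * exp (s * u\<^sup>2))"
    using mult_left_mono[OF drift_mono[of "u / 2" u l n s], of "exp (s * (u / 2)\<^sup>2) * (u / 2)"] u by (simp add: algebra_simps)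
  finally have 1: "norm (chi l n u * exp (s * u\<^sup>2) - 1) \<le> u / 2 * drift l n s u * (exp (s * (u / 2)\<^sup>2) + norm (chi l n (u / 2)) * exp (s * u\<^sup>2))" .
  have "chi l n u - complex_of_real (exp (- (s * u\<^sup>2))) = complex_of_real (exp (- (s * u\<^sup>2))) * (chi l n u * exp (s * u\<^sup>2) - 1)"
    using E by (simp add: right_diff_distrib mult.left_commute flip: of_real_mult) (simp add: mult.commute)
  then have "norm (chi l n u - complex_of_real (exp (- (s * u\<^sup>2)))) = exp (- (s * u\<^sup>2)) * norm (chi l n u * exp (s * u\<^sup>2) - 1)"
    by (simp only: norm_mult norm_of_real) simp
  also have "\<dots> \<le> exp (- (s * u\<^sup>2)) * (u / 2 * drift l n s u * (exp (s * (u / 2)\<^sup>2) + norm (chi l n (u / 2)) * exp (s * u\<^sup>2)))"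
    using 1 by (intro mult_left_mono) auto
  also have "\<dots> = u / 2 * drift l n s u * (exp (- (s * u\<^sup>2)) * exp (s * (u / 2)\<^sup>2) + norm (chi l n (u / 2)) * (exp (s * u\<^sup>2) * exp (- (s * u\<^sup>2))))"
    by (simp add: algebra_simps)
  also have "exp (- (s * u\<^sup>2)) * exp (s * (u / 2)\<^sup>2) = exp (- (3 / 4 * s * u\<^sup>2))"
    by (simp add: power_divide flip: exp_add)
  finally show ?thesis using E by simp
qed

theorem chi_gaussian:
  assumes s: "0 \<le> s"
  shows "norm (chi l n u - exp (- (s * u\<^sup>2))) \<le> \<bar>u\<bar> / 2 * drift l n s \<bar>u\<bar> * (exp (- (3 / 4 * s * u\<^sup>2)) + norm (chi l n (u / 2)))"
proof (cases "0 \<le> u")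
  case False
  then have "norm (chi (\<lambda>j. - l j) n (- u) - exp (- (s * (- u)\<^sup>2)))
     \<le> (- u) / 2 * drift (\<lambda>j. - l j) n s (- u) * (exp (- (3 / 4 * s * (- u)\<^sup>2)) + norm (chi (\<lambda>j. - l j) n (- u / 2)))"
    using s by (intro chi_gaussian_nonneg) auto
  then show ?thesis using False chi_uminus[of l n "- u"] chi_uminus[of l n "- u / 2"] by (simp add: drift_def)
qed (use chi_gaussian_nonneg[OF s, of u l n] in simp)

lemma (in gaussian_vector) quadratic_char:
  assumes l: "\<And>j. j < n \<Longrightarrow> 0 \<le> l j"
  shows "expectation (\<lambda>\<omega>. iexp (u * (\<Sum>j<n. l j * ((\<eta> j \<omega>)\<^sup>2 - 1)))) = chi l n u"
proof -
  \<comment> \<open>outside \<open>{..<n}\<close> the weights are arbitrary, but \<open>energy_char\<close> asks for nonnegative ones\<close>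
  define l' where "l' j = (if j < n then l j else 0)" for j
  have e: "(\<Sum>j<n. l j * ((\<eta> j \<omega>)\<^sup>2 - 1)) = energy l' \<omega> - (\<Sum>j<n. l j)" for \<omega>
    by (simp add: energy_def l'_def right_diff_distrib sum_subtractf)
  have "iexp (u * (\<Sum>j<n. l j * ((\<eta> j \<omega>)\<^sup>2 - 1))) = iexp (u * energy l' \<omega>) * exp (\<Sum>j<n. - (\<i> * u * l j))" for \<omega>
    unfolding e by (simp add: sum_negf sum_distrib_left algebra_simps exp_diff exp_minus divide_inverse)
  then have "expectation (\<lambda>\<omega>. iexp (u * (\<Sum>j<n. l j * ((\<eta> j \<omega>)\<^sup>2 - 1)))) = expectation (\<lambda>\<omega>. iexp (u * energy l' \<omega>)) * exp (\<Sum>j<n. - (\<i> * u * l j))"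
    by (simp only: integral_mult_left_zero)
  also have "expectation (\<lambda>\<omega>. iexp (u * energy l' \<omega>)) = (\<Prod>j<n. 1 / csqrt (1 - 2 * \<i> * u * l' j))"
    by (rule energy_char) (use l in \<open>simp add: l'_def\<close>)
  also have "\<dots> * exp (\<Sum>j<n. - (\<i> * u * l j)) = chi l n u"
    unfolding chi_def exp_sum[OF finite_lessThan] prod.distrib[symmetric] by (intro prod.cong refl) (simp add: l'_def)
  finally show ?thesis .
qed

section \<open>The eigenvalues of the discretised kernel\<close>

text \<open>Up to a factor, the covariance matrix of a stationary autoregressive process of order one.\<close>

definition ar :: "real \<Rightarrow> nat \<Rightarrow> nat \<Rightarrow> real" where
  "ar q i m = q ^ (if i \<le> m then m - i else i - m)"

lemma ar_sym: "ar q i m = ar q m i"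
  by (auto simp: ar_def)

definition amplitude :: "real \<Rightarrow> real \<Rightarrow> real" where
  "amplitude \<gamma> T = \<gamma>\<^sup>2 / (2 * sqrt T)"

lemma kernel_matrix_ar:
  assumes "0 < T"
  shows "kernel_matrix \<theta> \<gamma> T n i m = T / n * amplitude \<gamma> T * ar (exp (- \<theta> * (T / n))) i m"
proof -
  have "\<bar>T * real i / n - T * real m / n\<bar> = T / n * real (if i \<le> m then m - i else i - m)"
  proof -
    have "T * real i / n - T * real m / n = T / n * (real i - real m)" by (simp add: algebra_simps diff_divide_distrib)
    then show ?thesis using assms by (simp add: abs_mult of_nat_diff)
  qed
  then have "exp (- \<theta> * \<bar>T * real i / n - T * real m / n\<bar>) = ar (exp (- \<theta> * (T / n))) i m"
    unfolding ar_def by (simp add: mult_ac flip: exp_of_nat_mult)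
  then show ?thesis by (simp add: kernel_matrix_def exp_kernel_def amplitude_def)
qed

lemma geometric_partial_le:
  fixes q :: real
  assumes "0 \<le> q" "q < 1"
  shows "(\<Sum>k<n. q ^ k) \<le> 1 / (1 - q)"
proof -
  have "(\<Sum>k<n. q ^ k) = (1 - q ^ n) / (1 - q)" using assms by (simp add: sum_gp_strict)
  also have "\<dots> \<le> 1 / (1 - q)" using assms by (intro divide_right_mono) auto
  finally show ?thesis .
qed

lemma ar_row_sum:
  assumes q: "0 \<le> q" "q < 1"
  shows "(\<Sum>m<n. ar q i m) \<le> 2 / (1 - q)"
proof -
  have "(\<Sum>m<n. ar q i m) \<le> (\<Sum>m<n. (if m \<le> i then q ^ (i - m) else 0) + (if i \<le> m then q ^ (m - i) else 0))"
    by (intro sum_mono) (auto simp: ar_def q)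
  also have "\<dots> = (\<Sum>m | m < n \<and> m \<le> i. q ^ (i - m)) + (\<Sum>m | m < n \<and> i \<le> m. q ^ (m - i))"
    by (simp add: sum.distrib sum.If_cases Int_def)
  also have "(\<Sum>m | m < n \<and> m \<le> i. q ^ (i - m)) \<le> (\<Sum>k<Suc i. q ^ k)"
  proof -
    have "(\<Sum>m | m < n \<and> m \<le> i. q ^ (i - m)) = (\<Sum>k\<in>(\<lambda>m. i - m) ` {m. m < n \<and> m \<le> i}. q ^ k)"
      by (subst sum.reindex) (auto simp: inj_on_def)
    also have "\<dots> \<le> (\<Sum>k<Suc i. q ^ k)" by (rule sum_mono2) (auto simp: q)
    finally show ?thesis .
  qed
  also have "(\<Sum>m | m < n \<and> i \<le> m. q ^ (m - i)) \<le> (\<Sum>k<n. q ^ k)"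
  proof -
    have "(\<Sum>m | m < n \<and> i \<le> m. q ^ (m - i)) = (\<Sum>k\<in>(\<lambda>m. m - i) ` {m. m < n \<and> i \<le> m}. q ^ k)"
      by (subst sum.reindex) (auto simp: inj_on_def)
    also have "\<dots> \<le> (\<Sum>k<n. q ^ k)" by (rule sum_mono2) (auto simp: q)
    finally show ?thesis .
  qed
  also have "(\<Sum>k<Suc i. q ^ k) + (\<Sum>k<n. q ^ k) \<le> 1 / (1 - q) + 1 / (1 - q)"
    by (intro add_mono geometric_partial_le q)
  finally show ?thesis by simp
qed

lemma sum_border:
  fixes f :: "nat \<Rightarrow> nat \<Rightarrow> real"
  assumes "\<And>i j. f i j = f j i"
  shows "(\<Sum>i<Suc n. \<Sum>j<Suc n. f i j) = (\<Sum>i<n. \<Sum>j<n. f i j) + 2 * (\<Sum>i<n. f i n) + f n n"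
proof -
  have "(\<Sum>j<n. f n j) = (\<Sum>i<n. f i n)" by (intro sum.cong refl assms)
  then show ?thesis by (simp add: sum.distrib)
qed

lemma ar_total_sum:
  "(1 - q)\<^sup>2 * (\<Sum>i<n. \<Sum>m<n. ar q i m) = n * (1 - q\<^sup>2) - 2 * q * (1 - q ^ n)"
proof (induction n)
  case (Suc n)
  have "(\<Sum>i<n. ar q i n) = q * (\<Sum>i<n. q ^ i)"
  proof -
    have "(\<Sum>i<n. ar q i n) = (\<Sum>i<n. q ^ Suc (n - Suc i))"
      by (intro sum.cong refl) (auto simp: ar_def simp flip: power_Suc intro!: arg_cong[where f="\<lambda>k. q ^ k"])
    also have "\<dots> = (\<Sum>i<n. q ^ Suc i)" by (rule sum.nat_diff_reindex)
    finally show ?thesis by (simp add: sum_distrib_left)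
  qed
  moreover have "(1 - q) * (\<Sum>i<n. q ^ i) = 1 - q ^ n"
    using one_diff_power_eq[of q n] by simp
  ultimately have "(1 - q) * (\<Sum>i<n. ar q i n) = q * (1 - q ^ n)" by (simp add: mult.left_commute)
  note S = this
  have "(1 - q)\<^sup>2 * (2 * (\<Sum>i<n. ar q i n)) = 2 * (1 - q) * ((1 - q) * (\<Sum>i<n. ar q i n))"
    by (simp only: power2_eq_square mult_ac)
  also note S
  finally have "(1 - q)\<^sup>2 * (2 * (\<Sum>i<n. ar q i n)) = 2 * (1 - q) * (q * (1 - q ^ n))" .
  then show ?case
    unfolding sum_border[of "ar q", OF ar_sym] distrib_left Suc.IH
    by (simp add: ar_def power2_eq_square algebra_simps)
qed simp

text \<open>The autoregressive filter with input \<open>x\<close>.\<close>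

fun ar_state :: "real \<Rightarrow> (nat \<Rightarrow> real) \<Rightarrow> nat \<Rightarrow> real" where
  "ar_state q x 0 = 0"
| "ar_state q x (Suc k) = q * ar_state q x k + x k"

lemma ar_state_sum: "q * ar_state q x n = (\<Sum>k<n. ar q k n * x k)"
proof -
  have "ar_state q x n = (\<Sum>k<n. q ^ (n - Suc k) * x k)"
  proof (induction n)
    case (Suc n)
    have "q * (\<Sum>k<n. q ^ (n - Suc k) * x k) = (\<Sum>k<n. q ^ (n - k) * x k)"
      unfolding sum_distrib_left
    proof (intro sum.cong refl)
      fix k assume "k \<in> {..<n}"
      then have "n - k = Suc (n - Suc k)" by auto
      then show "q * (q ^ (n - Suc k) * x k) = q ^ (n - k) * x k" by (simp only: power_Suc mult.assoc)
    qed
    then show ?case using Suc by simp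
  qed simp
  moreover have "q * (\<Sum>k<n. q ^ (n - Suc k) * x k) = (\<Sum>k<n. ar q k n * x k)"
    unfolding sum_distrib_left
  proof (intro sum.cong refl)
    fix k assume k: "k \<in> {..<n}"
    then have "n - k = Suc (n - Suc k)" by auto
    then show "q * (q ^ (n - Suc k) * x k) = ar q k n * x k" using k by (simp add: ar_def)
  qed
  ultimately show ?thesis by simp
qed

text \<open>In terms of the filtered sequence \<open>y\<close> the form is \<open>\<Sum>k.
  y\<^sub>k\<^sub>+\<^sub>1\<^sup>2 - q\<^sup>2 y\<^sub>k\<^sup>2\<close>. This shows that the
  matrix is positive, and it allows test vectors to be designed through their filtered sequences.\<close>

lemma ar_quadratic_form:
  "(\<Sum>i<n. \<Sum>m<n. ar q i m * x i * x m) = (1 - q\<^sup>2) * (\<Sum>k<n. (ar_state q x (Suc k))\<^sup>2) + q\<^sup>2 * (ar_state q x n)\<^sup>2"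
proof (induction n)
  case (Suc n)
  have "(\<Sum>i<n. ar q i n * x i * x n) = q * ar_state q x n * x n"
    by (simp add: ar_state_sum sum_distrib_right)
  then show ?case
    using sum_border[of "\<lambda>i m. ar q i m * x i * x m" n] Suc.IH
    by (simp add: ar_sym[of q] mult_ac) (simp add: ar_def power2_eq_square algebra_simps)
qed simp

lemma underdetermined_system:
  fixes c :: "nat \<Rightarrow> nat \<Rightarrow> real"
  shows "r < m \<Longrightarrow> \<exists>x. (\<exists>b<m. x b \<noteq> 0) \<and> (\<forall>j<r. (\<Sum>b<m. c j b * x b) = 0)"
proof (induction m arbitrary: r c)
  case (Suc m)
  show ?case
  proof (cases "\<exists>j<r. c j m \<noteq> 0")
    case False
    then show ?thesis by (intro exI[of _ "\<lambda>b. if b = m then 1 else 0"]) (auto simp: if_distrib[of "(*) _"] cong: if_cong)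
  next
    case True
    then obtain p where p: "p < r" "c p m \<noteq> 0" by blast
    \<comment> \<open>eliminate the last unknown with the \<open>p\<close>-th equation; \<open>s\<close> enumerates the other equations\<close>
    define s where "s j = (if j < p then j else Suc j)" for j
    define d where "d j b = c (s j) b - c (s j) m / c p m * c p b" for j b
    have "r - 1 < m" using p Suc.prems by simp
    from Suc.IH[OF this, of d] obtain x where x: "\<exists>b<m. x b \<noteq> 0" "\<forall>j<r - 1. (\<Sum>b<m. d j b * x b) = 0" by blast
    define y where "y b = (if b = m then - (\<Sum>b<m. c p b * x b) / c p m else x b)" for b
    have sy: "(\<Sum>b<Suc m. c j b * y b) = (\<Sum>b<m. c j b * x b) - c j m * ((\<Sum>b<m. c p b * x b) / c p m)" for j
      by (simp add: y_def)
    have "(\<Sum>b<Suc m. c j b * y b) = 0" if "j < r" for j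
    proof (cases "j = p")
      case True then show ?thesis using p(2) by (simp only: sy) simp
    next
      case False
      define i where "i = (if j < p then j else j - 1)"
      have i: "i < r - 1" "s i = j" using False that p(1) by (auto simp: i_def s_def)
      have "(\<Sum>b<m. d i b * x b) = (\<Sum>b<m. c j b * x b) - c j m / c p m * (\<Sum>b<m. c p b * x b)"
        by (simp add: d_def i(2) left_diff_distrib sum_subtractf sum_distrib_left mult.assoc)
      then show ?thesis using x(2) i(1) unfolding sy by simp
    qed
    moreover have "\<exists>b<Suc m. y b \<noteq> 0" using x(1) by (auto simp: y_def less_SucI)
    ultimately show ?thesis by blast
  qed
qed simp

lemma orthonormal_parseval:
  assumes e: "orthonormal n n e"
  shows "(\<Sum>j<n. (dot n (e j) x)\<^sup>2) = dot n x x"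
proof -
  have "(\<Sum>j<n. (dot n (e j) x)\<^sup>2) = (\<Sum>j<n. \<Sum>i<n. \<Sum>m<n. (e j i * e j m) * (x i * x m))"
    by (simp add: dot_def power2_eq_square sum_product mult_ac)
  also have "\<dots> = (\<Sum>i<n. \<Sum>j<n. \<Sum>m<n. (e j i * e j m) * (x i * x m))"
    by (rule sum.swap)
  also have "\<dots> = (\<Sum>i<n. \<Sum>m<n. \<Sum>j<n. (e j i * e j m) * (x i * x m))"
    by (rule sum.cong[OF refl]) (rule sum.swap)
  also have "\<dots> = (\<Sum>i<n. \<Sum>m<n. (\<Sum>j<n. e j i * e j m) * (x i * x m))"
    by (simp only: sum_distrib_right)
  also have "\<dots> = (\<Sum>i<n. \<Sum>m<n. if m = i then x i * x i else 0)"
    by (intro sum.cong refl) (simp add: orthonormal_complete[OF e])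
  finally show ?thesis by (simp add: dot_def)
qed

lemma spectral_quadratic_form:
  assumes a: "\<And>i m. i < n \<Longrightarrow> m < n \<Longrightarrow> a i m = (\<Sum>j<n. l j * e j i * e j m)"
  shows "(\<Sum>i<n. \<Sum>m<n. a i m * x i * x m) = (\<Sum>j<n. l j * (dot n (e j) x)\<^sup>2)"
proof -
  have "(\<Sum>i<n. \<Sum>m<n. a i m * x i * x m) = (\<Sum>i<n. \<Sum>m<n. \<Sum>j<n. l j * ((e j i * x i) * (e j m * x m)))"
    by (intro sum.cong refl) (simp add: a sum_distrib_left sum_distrib_right mult_ac)
  also have "\<dots> = (\<Sum>j<n. \<Sum>i<n. \<Sum>m<n. l j * ((e j i * x i) * (e j m * x m)))"
    by (subst (2) sum.swap, subst sum.swap, simp)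
  also have "\<dots> = (\<Sum>j<n. l j * (dot n (e j) x)\<^sup>2)"
    unfolding dot_def power2_eq_square sum_product
    by (rule sum.cong[OF refl]) (simp only: sum_distrib_left)
  finally show ?thesis .
qed

lemma eigenvalue_as_form:
  assumes e: "orthonormal n n e" and a: "\<And>i m. i < n \<Longrightarrow> m < n \<Longrightarrow> a i m = (\<Sum>j<n. l j * e j i * e j m)"
    and j: "j < n"
  shows "l j = (\<Sum>i<n. \<Sum>m<n. a i m * e j i * e j m)"
proof -
  have "(\<Sum>i<n. \<Sum>m<n. a i m * e j i * e j m) = (\<Sum>k<n. l k * (dot n (e k) (e j))\<^sup>2)"
    by (rule spectral_quadratic_form[OF a])
  also have "\<dots> = (\<Sum>k<n. if k = j then l j else 0)"
    using e j by (intro sum.cong refl) (auto simp: orthonormal_def)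
  finally show ?thesis using j by simp
qed

text \<open>The elementary half of the min-max principle. If fewer than \<open>m\<close> eigenvalues were at
  least \<open>t\<close>, a nonzero combination of the \<open>m\<close> test vectors would be
  orthogonal to all their eigenvectors, and its form would be smaller than \<open>t\<close> times
  its squared length.\<close>

lemma eigenvalue_count:
  assumes e: "orthonormal n n e" and a: "\<And>i m. i < n \<Longrightarrow> m < n \<Longrightarrow> a i m = (\<Sum>j<n. l j * e j i * e j m)"
    and v: "\<And>x i. v x i = (\<Sum>b<m. x b * w b i)"
    and big: "\<And>x. (\<exists>b<m. x b \<noteq> 0) \<Longrightarrow> 0 < dot n (v x) (v x) \<and>
       t * dot n (v x) (v x) \<le> (\<Sum>i<n. \<Sum>k<n. a i k * v x i * v x k)"
  shows "m \<le> card {j. j < n \<and> t \<le> l j}"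
proof (rule ccontr)
  let ?J = "{j. j < n \<and> t \<le> l j}"
  assume "\<not> m \<le> card ?J"
  then have lt: "card ?J < m" by simp
  obtain f where f: "bij_betw f {..<card ?J} ?J" using ex_bij_betw_nat_finite[of ?J] by (auto simp: atLeast0LessThan)
  obtain x where x: "\<exists>b<m. x b \<noteq> 0" "\<forall>j<card ?J. (\<Sum>b<m. dot n (e (f j)) (w b) * x b) = 0"
    using underdetermined_system[OF lt, of "\<lambda>j b. dot n (e (f j)) (w b)"] by blast
  have "v x = (\<lambda>i. \<Sum>b<m. x b * w b i)" using v by auto
  then have d: "dot n (e j) (v x) = (\<Sum>b<m. dot n (e j) (w b) * x b)" for j
    by (simp add: dot_simps mult.commute)
  have z: "dot n (e j) (v x) = 0" if "j \<in> ?J" for j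
  proof -
    have "j \<in> f ` {..<card ?J}" using bij_betw_imp_surj_on[OF f] that by simp
    then obtain i where "i < card ?J" "f i = j" by blast
    then show ?thesis using x(2) d by auto
  qed
  have pos: "0 < dot n (v x) (v x)" using big[OF x(1)] by blast
  have "\<exists>j<n. dot n (e j) (v x) \<noteq> 0"
  proof (rule ccontr)
    assume "\<not> ?thesis"
    then have "(\<Sum>j<n. (dot n (e j) (v x))\<^sup>2) = 0" by simp
    then show False using pos orthonormal_parseval[OF e, of "v x"] by simp
  qed
  then obtain j0 where j0: "j0 < n" "dot n (e j0) (v x) \<noteq> 0" by blast
  have "(\<Sum>j<n. l j * (dot n (e j) (v x))\<^sup>2) < (\<Sum>j<n. t * (dot n (e j) (v x))\<^sup>2)"
  proof (rule sum_strict_mono_ex1)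
    show "\<forall>j\<in>{..<n}. l j * (dot n (e j) (v x))\<^sup>2 \<le> t * (dot n (e j) (v x))\<^sup>2"
    proof
      fix j assume "j \<in> {..<n}"
      then show "l j * (dot n (e j) (v x))\<^sup>2 \<le> t * (dot n (e j) (v x))\<^sup>2"
        using z[of j] by (cases "t \<le> l j") (auto intro: mult_right_mono)
    qed
    have "l j0 < t" using z[of j0] j0 by force
    then show "\<exists>j\<in>{..<n}. l j * (dot n (e j) (v x))\<^sup>2 < t * (dot n (e j) (v x))\<^sup>2"
      using j0 by (intro bexI[of _ j0]) (auto intro: mult_strict_right_mono)
  qed simp
  also have "\<dots> = t * dot n (v x) (v x)" using orthonormal_parseval[OF e, of "v x"] by (simp flip: sum_distrib_left)
  also have "\<dots> \<le> (\<Sum>j<n. l j * (dot n (e j) (v x))\<^sup>2)"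
    using big[OF x(1)] spectral_quadratic_form[of n a l e "v x"] a by simp
  finally show False by simp
qed

lemma amplitude_nonneg: "0 < T \<Longrightarrow> 0 \<le> amplitude \<gamma> T"
  by (simp add: amplitude_def)

lemma eigval_as_form:
  "j < n \<Longrightarrow> eigval \<theta> \<gamma> T n j = (\<Sum>i<n. \<Sum>m<n. kernel_matrix \<theta> \<gamma> T n i m * eigvec \<theta> \<gamma> T n j i * eigvec \<theta> \<gamma> T n j m)"
  by (rule eigenvalue_as_form[OF eigvec_orthonormal kernel_matrix_spectral])

lemma kernel_form_eq:
  assumes "0 < T"
  shows "(\<Sum>i<n. \<Sum>m<n. kernel_matrix \<theta> \<gamma> T n i m * x i * x m)
    = T / n * amplitude \<gamma> T * (\<Sum>i<n. \<Sum>m<n. ar (exp (- \<theta> * (T / n))) i m * x i * x m)"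
  unfolding kernel_matrix_ar[OF assms] by (simp add: sum_distrib_left mult.assoc)

lemma eigval_nonneg:
  assumes "0 < T" "0 < \<theta>" "j < n"
  shows "0 \<le> eigval \<theta> \<gamma> T n j"
proof -
  let ?q = "exp (- \<theta> * (T / n))"
  have "?q\<^sup>2 \<le> 1" using assms by (intro power_le_one) auto
  then show ?thesis
    unfolding eigval_as_form[OF assms(3)] kernel_form_eq[OF assms(1)] ar_quadratic_form
    using assms amplitude_nonneg[of T \<gamma>] by (intro mult_nonneg_nonneg add_nonneg_nonneg sum_nonneg) auto
qed

lemma one_minus_exp_ge:
  fixes x :: real
  assumes "0 \<le> x"
  shows "x / (1 + x) \<le> 1 - exp (- x)"
proof -
  have "exp (- x) \<le> 1 / (1 + x)"
    using exp_ge_add_one_self[of x] assms by (simp add: exp_minus field_simps)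
  then show ?thesis using assms by (simp add: field_simps)
qed

text \<open>Schur's test: an eigenvalue of a nonnegative symmetric matrix is at most the largest row sum.\<close>

lemma eigval_le:
  assumes T: "0 < T" and \<theta>: "0 < \<theta>" and j: "j < n"
  shows "eigval \<theta> \<gamma> T n j \<le> 2 * amplitude \<gamma> T * (1 / \<theta> + T / n)"
proof -
  let ?A = "kernel_matrix \<theta> \<gamma> T n" and ?e = "eigvec \<theta> \<gamma> T n j" and ?q = "exp (- \<theta> * (T / n))"
  \<comment> \<open>a bound for the row sums\<close>
  define R where "R = T / n * amplitude \<gamma> T * (2 / (1 - ?q))"
  have n: "0 < n" using j by simp
  have x: "0 < \<theta> * (T / n)" using T \<theta> n by simp
  have q: "0 \<le> ?q" "?q < 1" using x by auto
  have c: "0 \<le> T / n * amplitude \<gamma> T" using T amplitude_nonneg[of T \<gamma>] by simp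
  have A: "0 \<le> ?A i m" for i m
    unfolding kernel_matrix_ar[OF T] by (rule mult_nonneg_nonneg[OF c]) (simp add: ar_def)
  have row: "(\<Sum>m<n. ?A i m) \<le> R" for i
    unfolding kernel_matrix_ar[OF T] sum_distrib_left[symmetric] R_def
    by (intro mult_left_mono ar_row_sum q c)
  have "eigval \<theta> \<gamma> T n j \<le> (\<Sum>i<n. \<Sum>m<n. ?A i m * (?e i)\<^sup>2 / 2 + ?A i m * (?e m)\<^sup>2 / 2)"
    unfolding eigval_as_form[OF j]
  proof (intro sum_mono)
    fix i m
    have "?A i m * (2 * ?e i * ?e m) \<le> ?A i m * ((?e i)\<^sup>2 + (?e m)\<^sup>2)"
      by (intro mult_left_mono sum_squares_bound A)
    then show "?A i m * ?e i * ?e m \<le> ?A i m * (?e i)\<^sup>2 / 2 + ?A i m * (?e m)\<^sup>2 / 2"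
      by (simp add: distrib_left)
  qed
  also have "\<dots> = (\<Sum>i<n. \<Sum>m<n. ?A i m * (?e i)\<^sup>2 / 2) + (\<Sum>i<n. \<Sum>m<n. ?A i m * (?e m)\<^sup>2 / 2)"
    by (simp add: sum.distrib)
  also have "(\<Sum>i<n. \<Sum>m<n. ?A i m * (?e m)\<^sup>2 / 2) = (\<Sum>i<n. \<Sum>m<n. ?A i m * (?e i)\<^sup>2 / 2)"
    by (subst sum.swap) (simp add: kernel_matrix_sym)
  also have "(\<Sum>i<n. \<Sum>m<n. ?A i m * (?e i)\<^sup>2 / 2) + (\<Sum>i<n. \<Sum>m<n. ?A i m * (?e i)\<^sup>2 / 2) = (\<Sum>i<n. (\<Sum>m<n. ?A i m) * (?e i)\<^sup>2)"
    by (simp add: sum_distrib_right flip: sum.distrib)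
  also have "\<dots> \<le> (\<Sum>i<n. R * (?e i)\<^sup>2)"
    by (intro sum_mono mult_right_mono row) auto
  also have "\<dots> = R * dot n ?e ?e" by (simp add: dot_def power2_eq_square sum_distrib_left)
  also have "\<dots> = R" using eigvec_orthonormal[of n \<theta> \<gamma> T] j by (simp add: orthonormal_def)
  also have "R \<le> T / n * amplitude \<gamma> T * (2 / (\<theta> * (T / n) / (1 + \<theta> * (T / n))))"
  proof -
    define X where "X = \<theta> * (T / n)"
    have X: "0 < X" using x by (simp add: X_def)
    then have "0 < X / (1 + X)" by simp
    moreover have "X / (1 + X) \<le> 1 - exp (- X)" by (rule one_minus_exp_ge) (use X in simp)
    ultimately have "2 / (1 - exp (- X)) \<le> 2 / (X / (1 + X))"
      using X by (intro divide_left_mono mult_pos_pos) auto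
    then have "2 / (1 - ?q) \<le> 2 / (\<theta> * (T / n) / (1 + \<theta> * (T / n)))" unfolding X_def by simp
    then show ?thesis unfolding R_def by (rule mult_left_mono[OF _ c])
  qed
  also have "\<dots> = 2 * amplitude \<gamma> T * (1 / \<theta> + T / n)"
    using T \<theta> n by (simp add: field_simps)
  finally show ?thesis .
qed

text \<open>Both sides are the trace of the squared matrix.\<close>

lemma eigval_sum_squares:
  "(\<Sum>j<n. (eigval \<theta> \<gamma> T n j)\<^sup>2) = (\<Sum>i<n. \<Sum>m<n. (kernel_matrix \<theta> \<gamma> T n i m)\<^sup>2)"
proof -
  let ?A = "kernel_matrix \<theta> \<gamma> T n" and ?e = "eigvec \<theta> \<gamma> T n" and ?l = "eigval \<theta> \<gamma> T n"
  have "(\<Sum>i<n. \<Sum>m<n. (?A i m)\<^sup>2) = (\<Sum>i<n. \<Sum>m<n. \<Sum>j<n. ?l j * (?A i m * ?e j i * ?e j m))"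
  proof (intro sum.cong refl)
    fix i m assume "i \<in> {..<n}" "m \<in> {..<n}"
    then have "(?A i m)\<^sup>2 = ?A i m * (\<Sum>j<n. ?l j * ?e j i * ?e j m)"
      using kernel_matrix_spectral[of i n m \<theta> \<gamma> T] by (simp add: power2_eq_square)
    then show "(?A i m)\<^sup>2 = (\<Sum>j<n. ?l j * (?A i m * ?e j i * ?e j m))"
      by (simp add: sum_distrib_left mult_ac)
  qed
  also have "\<dots> = (\<Sum>i<n. \<Sum>j<n. \<Sum>m<n. ?l j * (?A i m * ?e j i * ?e j m))"
    by (rule sum.cong[OF refl]) (rule sum.swap)
  also have "\<dots> = (\<Sum>j<n. \<Sum>i<n. \<Sum>m<n. ?l j * (?A i m * ?e j i * ?e j m))"
    by (rule sum.swap)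
  also have "\<dots> = (\<Sum>j<n. ?l j * ?l j)"
  proof (rule sum.cong[OF refl])
    fix j assume "j \<in> {..<n}"
    then show "(\<Sum>i<n. \<Sum>m<n. ?l j * (?A i m * ?e j i * ?e j m)) = ?l j * ?l j"
      using eigval_as_form[of j n \<theta> \<gamma> T] by (simp flip: sum_distrib_left)
  qed
  finally show ?thesis by (simp add: power2_eq_square)
qed

lemma eigval_sum_squares_closed:
  assumes T: "0 < T" and \<theta>: "0 < \<theta>" and n: "0 < n"
  defines "q \<equiv> exp (- 2 * \<theta> * T / n)"
  shows "(\<Sum>j<n. (eigval \<theta> \<gamma> T n j)\<^sup>2) =
     (amplitude \<gamma> T)\<^sup>2 * ((T / n)\<^sup>2 * (n * (1 - q\<^sup>2) - 2 * q * (1 - exp (- 2 * \<theta> * T))) / (1 - q)\<^sup>2)"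
proof -
  have q1: "q < 1" unfolding q_def using T \<theta> n by (simp add: divide_neg_pos)
  have sq: "(exp (- \<theta> * (T / n)))\<^sup>2 = q"
    by (simp add: q_def power2_eq_square flip: exp_add)
  have qn: "q ^ n = exp (- 2 * \<theta> * T)"
    using n by (simp add: q_def flip: exp_of_nat_mult)
  have "(\<Sum>i<n. \<Sum>m<n. (kernel_matrix \<theta> \<gamma> T n i m)\<^sup>2) = (\<Sum>i<n. \<Sum>m<n. (T / n * amplitude \<gamma> T)\<^sup>2 * ar q i m)"
    unfolding kernel_matrix_ar[OF T] power_mult_distrib ar_def
    by (simp add: sq power_even_eq flip: power_mult sq)
  also have "\<dots> = (T / n * amplitude \<gamma> T)\<^sup>2 * (\<Sum>i<n. \<Sum>m<n. ar q i m)"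
    by (simp add: sum_distrib_left)
  also have "(\<Sum>i<n. \<Sum>m<n. ar q i m) = (n * (1 - q\<^sup>2) - 2 * q * (1 - exp (- 2 * \<theta> * T))) / (1 - q)\<^sup>2"
    using ar_total_sum[of q n] q1 unfolding qn by (simp add: eq_divide_eq mult.commute)
  finally show ?thesis unfolding eigval_sum_squares by (simp add: power_mult_distrib power_divide mult_ac)
qed

text \<open>The squared norm of the kernel on the square.\<close>

definition limit_sum_squares :: "real \<Rightarrow> real \<Rightarrow> real \<Rightarrow> real" where
  "limit_sum_squares \<theta> \<gamma> T = \<gamma> ^ 4 / (4 * \<theta>) - \<gamma> ^ 4 * (1 - exp (- 2 * \<theta> * T)) / (8 * \<theta>\<^sup>2 * T)"

lemma amplitude_square: "0 < T \<Longrightarrow> (amplitude \<gamma> T)\<^sup>2 = \<gamma> ^ 4 / (4 * T)"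
  by (simp add: amplitude_def power_divide power_mult_distrib flip: power_mult)

lemma eigval_sum_squares_tendsto:
  assumes T: "0 < T" and \<theta>: "0 < \<theta>"
  shows "(\<lambda>n. \<Sum>j<n. (eigval \<theta> \<gamma> T n j)\<^sup>2) \<longlonglongrightarrow> limit_sum_squares \<theta> \<gamma> T"
proof -
  define E where "E = 1 - exp (- 2 * \<theta> * T)"
  define b where "b = 2 * \<theta> * T"
  have b: "0 < b" using T \<theta> by (simp add: b_def)
  have l1: "(\<lambda>n::nat. real n * (1 - (exp (- b / real n))\<^sup>2) / (real n * (1 - exp (- b / real n)))\<^sup>2) \<longlonglongrightarrow> 2 / b"
    using b by (real_asymp simp: field_simps power2_eq_square)
  have l2: "(\<lambda>n::nat. exp (- b / real n) / (real n * (1 - exp (- b / real n)))\<^sup>2) \<longlonglongrightarrow> 1 / b\<^sup>2"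
    using b by (real_asymp simp: field_simps power2_eq_square)
  have "(\<lambda>n::nat. (amplitude \<gamma> T)\<^sup>2 * T\<^sup>2 * (real n * (1 - (exp (- b / real n))\<^sup>2) / (real n * (1 - exp (- b / real n)))\<^sup>2
      - 2 * E * (exp (- b / real n) / (real n * (1 - exp (- b / real n)))\<^sup>2)))
     \<longlonglongrightarrow> (amplitude \<gamma> T)\<^sup>2 * T\<^sup>2 * (2 / b - 2 * E * (1 / b\<^sup>2))"
    by (rule tendsto_mult[OF tendsto_const tendsto_diff[OF l1 tendsto_mult[OF tendsto_const l2]]])
  also have "(amplitude \<gamma> T)\<^sup>2 * T\<^sup>2 * (2 / b - 2 * E * (1 / b\<^sup>2)) = limit_sum_squares \<theta> \<gamma> T"
    using T \<theta> unfolding amplitude_square[OF T] limit_sum_squares_def b_def E_def[symmetric]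
    by (simp add: field_simps power2_eq_square)
  finally show ?thesis
  proof (rule Lim_transform_eventually)
    show "\<forall>\<^sub>F n in sequentially. (amplitude \<gamma> T)\<^sup>2 * T\<^sup>2 * (real n * (1 - (exp (- b / real n))\<^sup>2) / (real n * (1 - exp (- b / real n)))\<^sup>2
      - 2 * E * (exp (- b / real n) / (real n * (1 - exp (- b / real n)))\<^sup>2)) = (\<Sum>j<n. (eigval \<theta> \<gamma> T n j)\<^sup>2)"
      using eventually_gt_at_top[of 0]
    proof eventually_elim
      case (elim n)
      have q: "exp (- b / real n) = exp (- 2 * \<theta> * T / n)" by (simp add: b_def)
      show ?case
        unfolding eigval_sum_squares_closed[OF T \<theta> elim] q[symmetric] E_def[symmetric]
        unfolding power_mult_distrib power_divide by (simp add: diff_divide_distrib right_diff_distrib mult_ac)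
    qed
  qed
qed

lemma limit_sum_squares_close:
  assumes T: "0 < T" and \<theta>: "0 < \<theta>"
  shows "\<bar>\<gamma> ^ 4 / (4 * \<theta>) - limit_sum_squares \<theta> \<gamma> T\<bar> \<le> \<gamma> ^ 4 / (8 * \<theta>\<^sup>2) / T"
proof -
  have g: "0 \<le> \<gamma> ^ 4" by simp
  have "0 \<le> \<gamma> ^ 4 * (1 - exp (- 2 * \<theta> * T)) / (8 * \<theta>\<^sup>2 * T)"
    using T \<theta> by (intro divide_nonneg_pos mult_nonneg_nonneg g) auto
  moreover have "\<gamma> ^ 4 * (1 - exp (- 2 * \<theta> * T)) / (8 * \<theta>\<^sup>2 * T) \<le> \<gamma> ^ 4 * 1 / (8 * \<theta>\<^sup>2 * T)"
    using T \<theta> by (intro divide_right_mono mult_left_mono g) auto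
  ultimately show ?thesis by (simp add: limit_sum_squares_def)
qed

subsection \<open>Many eigenvalues of the order of the amplitude\<close>

lemma sum_div_mod:
  fixes f :: "nat \<Rightarrow> nat \<Rightarrow> real"
  assumes "0 < L"
  shows "(\<Sum>k<m * L. f (k div L) (k mod L)) = (\<Sum>b<m. \<Sum>i<L. f b i)"
proof -
  have "(\<Sum>k<m * L. f (k div L) (k mod L)) = (\<Sum>b<m. \<Sum>k = b * L..<b * L + L. f (k div L) (k mod L))"
    by (rule sum.nat_group[symmetric])
  also have "\<dots> = (\<Sum>b<m. \<Sum>i<L. f b i)"
  proof (rule sum.cong[OF refl])
    fix b
    have "(\<Sum>k = b * L..<b * L + L. f (k div L) (k mod L)) = (\<Sum>i = 0..<L. f ((i + b * L) div L) ((i + b * L) mod L))"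
      using sum.shift_bounds_nat_ivl[of "\<lambda>k. f (k div L) (k mod L)" 0 "b * L" L] by (simp add: add.commute)
    also have "\<dots> = (\<Sum>i<L. f b i)" using assms by (simp add: atLeast0LessThan)
    finally show "(\<Sum>k = b * L..<b * L + L. f (k div L) (k mod L)) = (\<Sum>i<L. f b i)" .
  qed
  finally show ?thesis .
qed

text \<open>The profile of a test vector after filtering, on a block of \<open>4 r\<close> cells. It vanishes
  at both ends of the block.\<close>

definition tent :: "nat \<Rightarrow> nat \<Rightarrow> real" where
  "tent r i = real (min i (4 * r - i))"

text \<open>The input that produces one tent as its filtered sequence.\<close>

definition bump :: "real \<Rightarrow> nat \<Rightarrow> nat \<Rightarrow> real" where
  "bump q r i = tent r (Suc i) - q * tent r i"

text \<open>Bumps with coefficients \<open>x\<close> in \<open>m\<close> consecutive blocks. As every tent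
  returns to zero at the end of its block, there is no interaction between blocks, and both the form
  and the length are diagonal in \<open>x\<close>.\<close>

definition block_vector :: "real \<Rightarrow> nat \<Rightarrow> nat \<Rightarrow> (nat \<Rightarrow> real) \<Rightarrow> nat \<Rightarrow> real" where
  "block_vector q r m x i = (\<Sum>b<m. x b * (if i div (4 * r) = b then bump q r (i mod (4 * r)) else 0))"

lemma block_vector_eq:
  assumes "0 < r" "i < m * (4 * r)"
  shows "block_vector q r m x i = x (i div (4 * r)) * bump q r (i mod (4 * r))"
proof -
  have "i div (4 * r) < m" using assms by (simp add: less_mult_imp_div_less)
  moreover have "block_vector q r m x i = (\<Sum>b<m. if b = i div (4 * r) then x (i div (4 * r)) * bump q r (i mod (4 * r)) else 0)"
    unfolding block_vector_def by (intro sum.cong) auto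
  ultimately show ?thesis by simp
qed

lemma ar_state_block_vector:
  assumes r: "0 < r"
  shows "k < m * (4 * r) \<Longrightarrow>
    ar_state q (block_vector q r m x) (Suc k) = x (k div (4 * r)) * tent r (Suc (k mod (4 * r)))"
proof (induction k)
  case 0
  then show ?case using block_vector_eq[OF r, of 0 m q x] by (simp add: bump_def tent_def)
next
  case (Suc k)
  have "ar_state q (block_vector q r m x) (Suc k) = x (Suc k div (4 * r)) * tent r (Suc k mod (4 * r))"
  proof (cases "Suc (k mod (4 * r)) = 4 * r")
    case True
    then show ?thesis using Suc by (simp add: mod_Suc tent_def)
  next
    case False
    then have "Suc k mod (4 * r) = Suc (k mod (4 * r))" "Suc k div (4 * r) = k div (4 * r)"
      by (simp_all add: mod_Suc div_Suc)
    then show ?thesis using Suc by simp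
  qed
  then show ?case
    using block_vector_eq[OF r Suc.prems, of q x]
    by (simp add: bump_def algebra_simps)
qed

lemma block_vector_norm:
  assumes r: "0 < r"
  shows "dot (m * (4 * r)) (block_vector q r m x) (block_vector q r m x)
    = (\<Sum>b<m. (x b)\<^sup>2) * (\<Sum>i<4 * r. (bump q r i)\<^sup>2)"
proof -
  have "dot (m * (4 * r)) (block_vector q r m x) (block_vector q r m x)
    = (\<Sum>k<m * (4 * r). (x (k div (4 * r)))\<^sup>2 * (bump q r (k mod (4 * r)))\<^sup>2)"
    unfolding dot_def by (intro sum.cong refl) (simp add: block_vector_eq[OF r] power2_eq_square mult_ac)
  also have "\<dots> = (\<Sum>b<m. \<Sum>i<4 * r. (x b)\<^sup>2 * (bump q r i)\<^sup>2)"
    using r by (intro sum_div_mod) simp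
  finally show ?thesis by (simp add: sum_product)
qed

lemma block_vector_form:
  assumes r: "0 < r" and q: "0 \<le> q" "q \<le> 1"
  shows "(1 - q\<^sup>2) * ((\<Sum>b<m. (x b)\<^sup>2) * (\<Sum>i<4 * r. (tent r (Suc i))\<^sup>2))
    \<le> (\<Sum>i<m * (4 * r). \<Sum>k<m * (4 * r). ar q i k * block_vector q r m x i * block_vector q r m x k)"
proof -
  have "(\<Sum>k<m * (4 * r). (ar_state q (block_vector q r m x) (Suc k))\<^sup>2)
     = (\<Sum>k<m * (4 * r). (x (k div (4 * r)))\<^sup>2 * (tent r (Suc (k mod (4 * r))))\<^sup>2)"
    by (intro sum.cong refl) (simp only: ar_state_block_vector[OF r] lessThan_iff power_mult_distrib)
  also have "\<dots> = (\<Sum>b<m. \<Sum>i<4 * r. (x b)\<^sup>2 * (tent r (Suc i))\<^sup>2)"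
    using r by (intro sum_div_mod[where f="\<lambda>b i. (x b)\<^sup>2 * (tent r (Suc i))\<^sup>2"]) simp
  finally have "(\<Sum>k<m * (4 * r). (ar_state q (block_vector q r m x) (Suc k))\<^sup>2)
    = (\<Sum>b<m. (x b)\<^sup>2) * (\<Sum>i<4 * r. (tent r (Suc i))\<^sup>2)" by (simp add: sum_product)
  then show ?thesis unfolding ar_quadratic_form by simp
qed

lemma tent_sum_squares: "2 * real r ^ 3 \<le> (\<Sum>i<4 * r. (tent r (Suc i))\<^sup>2)"
proof -
  have "2 * real r ^ 3 = (\<Sum>i\<in>{r..<3 * r}. (real r)\<^sup>2)" by (simp add: power3_eq_cube power2_eq_square)
  also have "\<dots> \<le> (\<Sum>i\<in>{r..<3 * r}. (tent r (Suc i))\<^sup>2)"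
    by (intro sum_mono power_mono) (auto simp: tent_def)
  also have "\<dots> \<le> (\<Sum>i<4 * r. (tent r (Suc i))\<^sup>2)"
    by (intro sum_mono2) auto
  finally show ?thesis .
qed

lemma bump_sum_squares:
  assumes q: "0 \<le> q" "q \<le> 1" and r: "0 < r"
  shows "0 < (\<Sum>i<4 * r. (bump q r i)\<^sup>2)" "(\<Sum>i<4 * r. (bump q r i)\<^sup>2) \<le> 4 * real r * (1 + 2 * real r * (1 - q))\<^sup>2"
proof -
  have "bump q r 0 = 1" using r by (auto simp: bump_def tent_def min_def)
  then have "0 < (bump q r 0)\<^sup>2" by simp
  also have "\<dots> \<le> (\<Sum>i<4 * r. (bump q r i)\<^sup>2)" using r by (intro member_le_sum) auto
  finally show "0 < (\<Sum>i<4 * r. (bump q r i)\<^sup>2)" .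
  have "\<bar>bump q r i\<bar> \<le> 1 + 2 * real r * (1 - q)" for i
  proof -
    have t: "0 \<le> tent r i" "tent r i \<le> 2 * r" "\<bar>tent r (Suc i) - tent r i\<bar> \<le> 1" by (auto simp: tent_def)
    have "bump q r i = (tent r (Suc i) - tent r i) + (1 - q) * tent r i" by (simp add: bump_def algebra_simps)
    then have "\<bar>bump q r i\<bar> \<le> 1 + (1 - q) * tent r i" using t q by (simp add: abs_le_iff) (smt (verit) mult_nonneg_nonneg)
    also have "(1 - q) * tent r i \<le> (1 - q) * (2 * r)" using t q by (intro mult_left_mono) auto
    finally show ?thesis by (simp add: mult_ac)
  qed
  then have "(bump q r i)\<^sup>2 \<le> (1 + 2 * real r * (1 - q))\<^sup>2" for i
    by (metis abs_ge_zero power2_abs power_mono)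
  then have "(\<Sum>i<4 * r. (bump q r i)\<^sup>2) \<le> (\<Sum>i<4 * r. (1 + 2 * real r * (1 - q))\<^sup>2)" by (intro sum_mono)
  then show "(\<Sum>i<4 * r. (bump q r i)\<^sup>2) \<le> 4 * real r * (1 + 2 * real r * (1 - q))\<^sup>2" by simp
qed

text \<open>The parameter \<open>\<kappa>\<close> is a quarter of the length of a block. The lower bound
  depends on \<open>r\<close>, that is on the fineness of the grid, only through
  \<open>\<kappa>\<close>.\<close>

theorem eigval_count:
  assumes T: "0 < T" and \<theta>: "0 < \<theta>" and r: "0 < r" and m: "0 < m"
  defines "n \<equiv> m * (4 * r)" and "\<kappa> \<equiv> T / (4 * m)"
  shows "m \<le> card {j. j < n \<and> amplitude \<gamma> T * \<theta> * \<kappa>\<^sup>2 / (1 + 2 * \<theta> * \<kappa>) ^ 3 \<le> eigval \<theta> \<gamma> T n j}"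
proof (rule eigenvalue_count[OF eigvec_orthonormal kernel_matrix_spectral])
  define d where "d = T / n"
  define q where "q = exp (- \<theta> * d)"
  define t where "t = amplitude \<gamma> T * \<theta> * \<kappa>\<^sup>2 / (1 + 2 * \<theta> * \<kappa>) ^ 3"
  show "block_vector q r m x i = (\<Sum>b<m. x b * (\<lambda>b i. if i div (4 * r) = b then bump q r (i mod (4 * r)) else 0) b i)" for x i
    by (simp add: block_vector_def)
  fix x :: "nat \<Rightarrow> real" assume x: "\<exists>b<m. x b \<noteq> 0"
  let ?v = "block_vector q r m x" and ?X = "\<Sum>b<m. (x b)\<^sup>2"
    and ?V = "\<Sum>i<4 * r. (bump q r i)\<^sup>2" and ?P = "\<Sum>i<4 * r. (tent r (Suc i))\<^sup>2"
  have n: "0 < n" using r m by (simp add: n_def)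
  have d: "0 < d" using T n by (simp add: d_def)
  have dr: "d * r = \<kappa>" using r m by (simp add: d_def n_def \<kappa>_def field_simps)
  have \<kappa>: "0 < \<kappa>" using T m by (simp add: \<kappa>_def)
  have d\<kappa>: "d \<le> \<kappa>" using dr r d by (metis One_nat_def Suc_leI mult.right_neutral mult_left_mono less_imp_le of_nat_1 of_nat_mono)
  have q: "0 \<le> q" "q \<le> 1" using d \<theta> by (auto simp: q_def)
  have G: "0 \<le> amplitude \<gamma> T" by (rule amplitude_nonneg[OF T])
  have X: "0 < ?X"
  proof -
    obtain b where b: "b < m" "x b \<noteq> 0" using x by blast
    then have "0 < (x b)\<^sup>2" by simp
    also have "\<dots> \<le> ?X" using b by (intro member_le_sum) auto
    finally show ?thesis .
  qed
  have "t * ?V \<le> d * amplitude \<gamma> T * ((1 - q\<^sup>2) * ?P)"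
  proof -
    have "1 - q \<le> \<theta> * d" using exp_ge_add_one_self[of "- \<theta> * d"] by (simp add: q_def)
    then have "2 * real r * (1 - q) \<le> 2 * real r * (\<theta> * d)" by (intro mult_left_mono) auto
    also have "\<dots> = 2 * \<theta> * \<kappa>" using dr by (simp add: mult_ac)
    finally have "?V \<le> 4 * real r * (1 + 2 * \<theta> * \<kappa>)\<^sup>2"
      using q by (intro order_trans[OF bump_sum_squares(2)[OF q r]] mult_left_mono power_mono) auto
    then have "t * ?V \<le> t * (4 * real r * (1 + 2 * \<theta> * \<kappa>)\<^sup>2)"
      using G \<theta> \<kappa> by (intro mult_left_mono) (auto simp: t_def)
    also have "\<dots> = 4 * real r * amplitude \<gamma> T * \<theta> * \<kappa>\<^sup>2 / (1 + 2 * \<theta> * \<kappa>)"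
    proof -
      have "0 < 1 + 2 * \<theta> * \<kappa>" using \<theta> \<kappa> by (simp add: add_pos_pos)
      then show ?thesis by (simp add: t_def power2_eq_square power3_eq_cube)
    qed
    also have "\<dots> \<le> 4 * real r * amplitude \<gamma> T * \<theta> * \<kappa>\<^sup>2 / (1 + 2 * \<theta> * d)"
      using G \<theta> \<kappa> d d\<kappa> by (intro divide_left_mono mult_pos_pos add_pos_pos add_left_mono mult_left_mono) auto
    also have "\<dots> = d * amplitude \<gamma> T * ((2 * \<theta> * d / (1 + 2 * \<theta> * d)) * (2 * real r ^ 3))"
      unfolding dr[symmetric] by (simp add: power2_eq_square power3_eq_cube)
    also have "\<dots> \<le> d * amplitude \<gamma> T * ((1 - q\<^sup>2) * ?P)"
    proof (intro mult_left_mono mult_mono tent_sum_squares)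
      have "q\<^sup>2 = exp (- (2 * \<theta> * d))" by (simp add: q_def power2_eq_square flip: exp_add)
      then show "2 * \<theta> * d / (1 + 2 * \<theta> * d) \<le> 1 - q\<^sup>2" using one_minus_exp_ge[of "2 * \<theta> * d"] \<theta> d by simp
      show "0 \<le> 1 - q\<^sup>2" using q by (simp add: power_le_one)
    qed (use d G in auto)
    finally show ?thesis .
  qed
  then have "t * ?V * ?X \<le> d * amplitude \<gamma> T * ((1 - q\<^sup>2) * ?P) * ?X"
    using X by (intro mult_right_mono) auto
  also have "\<dots> = d * amplitude \<gamma> T * ((1 - q\<^sup>2) * (?X * ?P))" by (simp add: mult_ac)
  also have "\<dots> \<le> d * amplitude \<gamma> T * (\<Sum>i<n. \<Sum>k<n. ar q i k * ?v i * ?v k)"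
    unfolding n_def using d G by (intro mult_left_mono block_vector_form r q) auto
  also have "\<dots> = (\<Sum>i<n. \<Sum>k<n. kernel_matrix \<theta> \<gamma> T n i k * ?v i * ?v k)"
    unfolding kernel_form_eq[OF T] d_def q_def by simp
  finally have "t * dot n ?v ?v \<le> (\<Sum>i<n. \<Sum>k<n. kernel_matrix \<theta> \<gamma> T n i k * ?v i * ?v k)"
    unfolding n_def block_vector_norm[OF r] by (simp add: mult_ac)
  moreover have "0 < dot n ?v ?v"
    unfolding n_def block_vector_norm[OF r] using X bump_sum_squares(1)[OF q r] by simp
  ultimately show "0 < dot n ?v ?v \<and> amplitude \<gamma> T * \<theta> * \<kappa>\<^sup>2 / (1 + 2 * \<theta> * \<kappa>) ^ 3 * dot n ?v ?v
     \<le> (\<Sum>i<n. \<Sum>k<n. kernel_matrix \<theta> \<gamma> T n i k * ?v i * ?v k)" by (simp add: t_def)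
qed

section \<open>Fourier inversion\<close>

text \<open>The \<open>k\<close>-th derivative of the inverse Fourier transform, differentiated under the
  integral.\<close>

definition inv_fourier :: "(real \<Rightarrow> complex) \<Rightarrow> nat \<Rightarrow> real \<Rightarrow> complex" where
  "inv_fourier f k x = 1 / (2 * pi) * (\<integral>u. (- \<i> * u) ^ k * iexp (- (u * x)) * f u \<partial>lborel)"

locale rapid_char =
  fixes f :: "real \<Rightarrow> complex"
  assumes f_measurable [measurable]: "f \<in> borel_measurable borel"
    and f_moments: "\<And>k. integrable lborel (\<lambda>u. \<bar>u\<bar> ^ k * norm (f u))"
begin

lemma integrable_inv_fourier:
  "integrable lborel (\<lambda>u. (- \<i> * complex_of_real u) ^ k * iexp (- (u * x)) * f u)"
proof (rule Bochner_Integration.integrable_bound[OF f_moments[of k]])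
  show "AE u in lborel. norm ((- \<i> * complex_of_real u) ^ k * iexp (- (u * x)) * f u) \<le> norm (\<bar>u\<bar> ^ k * norm (f u))"
    by (auto simp: norm_mult norm_power)
qed measurable

text \<open>The second-order Taylor estimate of the exponential bounds the remainder by
  \<open>h\<^sup>2\<close> times a moment of order \<open>k + 2\<close>.\<close>

lemma inv_fourier_derivative:
  "(inv_fourier f k has_vector_derivative inv_fourier f (Suc k) x) (at x)"
proof -
  let ?c = "1 / (2 * pi) * (\<integral>u. \<bar>u\<bar> ^ (k + 2) * norm (f u) \<partial>lborel)"
  have bound: "norm (inv_fourier f k (x + h) - inv_fourier f k x - h *\<^sub>R inv_fourier f (Suc k) x) \<le> ?c * h\<^sup>2" for h
  proof -
    let ?F = "\<lambda>k x u. (- \<i> * complex_of_real u) ^ k * iexp (- (u * x)) * f u"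
    have eq: "?F k (x + h) u - ?F k x u - h *\<^sub>R ?F (Suc k) x u = ?F k x u * (iexp (- (u * h)) - (1 + \<i> * complex_of_real (- (u * h))))" for u
      by (simp add: scaleR_conv_of_real algebra_simps flip: exp_add)
    have "inv_fourier f k (x + h) - inv_fourier f k x - h *\<^sub>R inv_fourier f (Suc k) x
        = 1 / (2 * pi) * (\<integral>u. ?F k (x + h) u - ?F k x u - h *\<^sub>R ?F (Suc k) x u \<partial>lborel)"
      unfolding inv_fourier_def using integrable_inv_fourier[of k "x + h"] integrable_inv_fourier[of k x] integrable_inv_fourier[of "Suc k" x]
      by (simp add: Bochner_Integration.integral_diff scaleR_conv_of_real algebra_simps del: power_Suc)
    then have "norm (inv_fourier f k (x + h) - inv_fourier f k x - h *\<^sub>R inv_fourier f (Suc k) x)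
        = 1 / (2 * pi) * norm (\<integral>u. ?F k (x + h) u - ?F k x u - h *\<^sub>R ?F (Suc k) x u \<partial>lborel)"
      by (simp add: norm_mult norm_divide)
    also have "\<dots> \<le> 1 / (2 * pi) * (\<integral>u. h\<^sup>2 * (\<bar>u\<bar> ^ (k + 2) * norm (f u)) \<partial>lborel)"
    proof (rule mult_left_mono[OF order_trans[OF integral_norm_bound integral_mono]])
      show "integrable lborel (\<lambda>u. norm (?F k (x + h) u - ?F k x u - h *\<^sub>R ?F (Suc k) x u))"
        by (intro integrable_norm Bochner_Integration.integrable_diff integrable_scaleR_right integrable_inv_fourier)
      show "integrable lborel (\<lambda>u. h\<^sup>2 * (\<bar>u\<bar> ^ (k + 2) * norm (f u)))"
        by (intro integrable_mult_right f_moments)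
      fix u
      have "norm (iexp (- (u * h)) - (1 + \<i> * complex_of_real (- (u * h)))) \<le> \<bar>u * h\<bar>\<^sup>2"
        using iexp_approx1[of "- (u * h)" 1] by (simp add: power2_eq_square) (smt (verit) zero_le_square abs_ge_zero mult_nonneg_nonneg)
      then have "norm (?F k x u) * norm (iexp (- (u * h)) - (1 + \<i> * complex_of_real (- (u * h)))) \<le> (\<bar>u\<bar> ^ k * norm (f u)) * \<bar>u * h\<bar>\<^sup>2"
        by (intro mult_mono) (auto simp: norm_mult norm_power)
      also have "\<dots> = h\<^sup>2 * (\<bar>u\<bar> ^ (k + 2) * norm (f u))"
        by (simp add: abs_mult power_mult_distrib power_add power2_eq_square mult_ac)
      finally show "norm (?F k (x + h) u - ?F k x u - h *\<^sub>R ?F (Suc k) x u) \<le> h\<^sup>2 * (\<bar>u\<bar> ^ (k + 2) * norm (f u))"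
        unfolding eq norm_mult .
    qed simp
    also have "(\<integral>u. h\<^sup>2 * (\<bar>u\<bar> ^ (k + 2) * norm (f u)) \<partial>lborel) = h\<^sup>2 * (\<integral>u. \<bar>u\<bar> ^ (k + 2) * norm (f u) \<partial>lborel)"
      by (rule integral_mult_right_zero)
    finally show ?thesis by (simp only: mult_ac)
  qed
  show ?thesis
    unfolding has_vector_derivative_def has_derivative_at
  proof (rule conjI, rule bounded_linear_scaleR_left, rule Lim_null_comparison)
    have "((\<lambda>h::real. ?c * \<bar>h\<bar>) \<longlongrightarrow> ?c * \<bar>0\<bar>) (at 0)"
      by (intro tendsto_mult tendsto_const tendsto_rabs tendsto_ident_at)
    then show "((\<lambda>h. ?c * \<bar>h\<bar>) \<longlongrightarrow> 0) (at 0)" by (simp only: abs_zero mult_zero_right)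
    have "\<forall>\<^sub>F h :: real in at 0. h \<noteq> 0" by (simp add: eventually_at_filter)
    then show "\<forall>\<^sub>F h in at 0. norm (norm (inv_fourier f k (x + h) - inv_fourier f k x - h *\<^sub>R inv_fourier f (Suc k) x) / norm h) \<le> ?c * \<bar>h\<bar>"
    proof eventually_elim
      case (elim h)
      have "norm (a / norm h) \<le> c * \<bar>h\<bar>" if "0 \<le> a" "a \<le> c * h\<^sup>2" for a c :: real
        using that elim by (simp add: pos_divide_le_eq power2_eq_square mult.assoc)
      from this[OF norm_ge_zero bound[of h]] show ?case .
    qed
  qed
qed

definition fourier_density :: "real \<Rightarrow> real" where
  "fourier_density x = Re (inv_fourier f 0 x)"

lemma fourier_density_higher_deriv: "(deriv ^^ k) fourier_density = (\<lambda>x. Re (inv_fourier f k x))"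
proof (induction k)
  case 0 then show ?case by (auto simp: fourier_density_def)
next
  case (Suc k)
  have "((\<lambda>x. Re (inv_fourier f k x)) has_real_derivative Re (inv_fourier f (Suc k) x)) (at x)" for x
    using bounded_linear.has_vector_derivative[OF bounded_linear_Re inv_fourier_derivative]
    by (simp add: has_real_derivative_iff_has_vector_derivative)
  then have "deriv (\<lambda>x. Re (inv_fourier f k x)) = (\<lambda>x. Re (inv_fourier f (Suc k) x))"
    by (intro ext DERIV_imp_deriv)
  then show ?case using Suc by simp
qed

lemma fourier_density_smooth: "smooth fourier_density"
  unfolding smooth_def fourier_density_higher_deriv
proof (intro allI)
  fix k x
  have "((\<lambda>x. Re (inv_fourier f k x)) has_real_derivative Re (inv_fourier f (Suc k) x)) (at x)"
    using bounded_linear.has_vector_derivative[OF bounded_linear_Re inv_fourier_derivative]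
    by (simp add: has_real_derivative_iff_has_vector_derivative)
  then show "(\<lambda>x. Re (inv_fourier f k x)) field_differentiable at x"
    by (auto simp: field_differentiable_def)
qed

lemma inv_fourier_continuous: "continuous_on A (inv_fourier f k)"
  using inv_fourier_derivative by (meson continuous_at_imp_continuous_on has_vector_derivative_continuous)

lemma fourier_density_continuous: "continuous_on A fourier_density"
  unfolding fourier_density_def[abs_def] by (intro continuous_intros inv_fourier_continuous)

end

lemma inv_fourier_diff:
  assumes "rapid_char f" "rapid_char g"
  shows "\<bar>(deriv ^^ k) (rapid_char.fourier_density f) x - (deriv ^^ k) (rapid_char.fourier_density g) x\<bar>
    \<le> (\<integral>u. \<bar>u\<bar> ^ k * norm (f u - g u) \<partial>lborel)"
proof -
  interpret f: rapid_char f by fact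
  interpret g: rapid_char g by fact
  let ?F = "\<lambda>f u. (- \<i> * complex_of_real u) ^ k * iexp (- (u * x)) * f u"
  have "(deriv ^^ k) f.fourier_density x - (deriv ^^ k) g.fourier_density x = Re (inv_fourier f k x - inv_fourier g k x)"
    unfolding f.fourier_density_higher_deriv g.fourier_density_higher_deriv by simp
  then have "\<bar>(deriv ^^ k) f.fourier_density x - (deriv ^^ k) g.fourier_density x\<bar> \<le> norm (inv_fourier f k x - inv_fourier g k x)"
    using abs_Re_le_cmod[of "inv_fourier f k x - inv_fourier g k x"] by simp
  also have "inv_fourier f k x - inv_fourier g k x = 1 / (2 * pi) * (\<integral>u. ?F f u - ?F g u \<partial>lborel)"
    unfolding inv_fourier_def using f.integrable_inv_fourier[of k x] g.integrable_inv_fourier[of k x]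
    by (simp add: right_diff_distrib)
  also have "norm \<dots> = 1 / (2 * pi) * norm (\<integral>u. ?F f u - ?F g u \<partial>lborel)" by (simp add: norm_mult norm_divide)
  also have "\<dots> \<le> 1 * norm (\<integral>u. ?F f u - ?F g u \<partial>lborel)"
    using pi_gt3 by (intro mult_right_mono) auto
  also have "\<dots> \<le> (\<integral>u. norm (?F f u - ?F g u) \<partial>lborel)" using integral_norm_bound by simp
  also have "(\<lambda>u. norm (?F f u - ?F g u)) = (\<lambda>u. \<bar>u\<bar> ^ k * norm (f u - g u))"
    by (simp add: norm_mult norm_power flip: right_diff_distrib)
  finally show ?thesis .
qed

locale rapid_distribution = real_distribution \<mu> for \<mu> :: "real measure" +
  assumes rapid: "rapid_char (char \<mu>)"
begin

sublocale rapid_char "char \<mu>" by (rule rapid)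

lemma char_integrable: "integrable lborel (\<lambda>u. norm (char \<mu> u))"
  using f_moments[of 0] by simp

lemma indicator_exp_integral:
  assumes "a \<le> b" "t \<noteq> 0"
  shows "(\<integral>x. indicator {a..b} x *\<^sub>R iexp (- (t * x)) \<partial>lborel) = (iexp (- (t * a)) - iexp (- (t * b))) / (\<i> * t)"
proof -
  have "(\<integral>x. indicator {a..b} x *\<^sub>R iexp (- (t * x)) \<partial>lborel) = iexp (- (t * b)) / (- \<i> * t) - iexp (- (t * a)) / (- \<i> * t)"
  proof (rule integral_FTC_Icc[OF assms(1)])
    fix x
    have "((\<lambda>z. exp (\<i> * (- (t * z))) / (- \<i> * t)) has_field_derivative exp (\<i> * (- (t * complex_of_real x)))) (at (complex_of_real x))"
    proof -
      have "((\<lambda>z. exp (\<i> * (- (t * z)))) has_field_derivative exp (\<i> * (- (t * complex_of_real x))) * (\<i> * (- t))) (at (complex_of_real x))"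
        by (auto intro!: derivative_eq_intros)
      from DERIV_cdivide[OF this, of "- \<i> * t"] show ?thesis using assms(2) by simp
    qed
    from has_vector_derivative_real_field[OF this]
    show "((\<lambda>x. iexp (- (t * x)) / (- \<i> * t)) has_vector_derivative iexp (- (t * x))) (at x within {a..b})"
      by (auto intro: has_vector_derivative_at_within)
  qed (auto intro!: continuous_intros)
  then show ?thesis by (simp add: diff_divide_distrib)
qed

lemma product_integrable:
  "integrable (lborel \<Otimes>\<^sub>M lborel) (\<lambda>(x, t). indicator {a..b} x *\<^sub>R (iexp (- (t * x)) * char \<mu> t))"
proof (rule Bochner_Integration.integrable_bound)
  show "integrable (lborel \<Otimes>\<^sub>M lborel) (\<lambda>(x, t). indicator {a..b} x * norm (char \<mu> t))"
    by (rule lborel_pair.integrable_tensor(1))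
       (use char_integrable in \<open>auto simp: integrable_indicator_iff emeasure_lborel_Icc_eq\<close>)
  show "(\<lambda>(x, t). indicator {a..b} x *\<^sub>R (iexp (- (t * x)) * char \<mu> t)) \<in> borel_measurable (lborel \<Otimes>\<^sub>M lborel)"
    by measurable
  show "AE p in lborel \<Otimes>\<^sub>M lborel. norm (case p of (x, t) \<Rightarrow> indicator {a..b} x *\<^sub>R (iexp (- (t * x)) * char \<mu> t))
      \<le> norm (case p of (x, t) \<Rightarrow> indicator {a..b} x * norm (char \<mu> t))"
    by (auto simp: norm_mult)
qed

text \<open>In Levy's inversion formula the quotient is the integral of \<open>e\<^bsup>-itx\<^esup>\<close>
  over the interval. It is bounded by the length of the interval, so dominated convergence removes
  the cut-off and Fubini's theorem exchanges the integrals.\<close>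

lemma inversion_at_continuity_points:
  assumes ab: "a \<le> b" and atoms: "measure \<mu> {a} = 0" "measure \<mu> {b} = 0"
  shows "measure \<mu> {a<..b} = (\<integral>x. indicator {a..b} x * fourier_density x \<partial>lborel)"
proof -
  define G where "G t = (\<integral>x. indicator {a..b} x *\<^sub>R iexp (- (t * x)) \<partial>lborel)" for t :: real
  have G_meas [measurable]: "G \<in> borel_measurable borel" unfolding G_def by measurable
  have G_bound: "norm (G t) \<le> b - a" for t
  proof -
    have "norm (G t) \<le> (\<integral>x. norm (indicator {a..b} x *\<^sub>R iexp (- (t * x))) \<partial>lborel)"
      unfolding G_def by (rule integral_norm_bound)
    also have "\<dots> = (\<integral>x. indicator {a..b} x \<partial>lborel)" by (intro Bochner_Integration.integral_cong) auto
    also have "\<dots> = b - a" using ab by simp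
    finally show ?thesis .
  qed
  have eq: "(CLBINT t=-real T..real T. (iexp (- (t * a)) - iexp (- (t * b))) / (\<i> * t) * char \<mu> t)
      = (\<integral>t. indicator {-real T<..<real T} t *\<^sub>R (G t * char \<mu> t) \<partial>lborel)" for T :: nat
  proof -
    have "(CLBINT t=-real T..real T. (iexp (- (t * a)) - iexp (- (t * b))) / (\<i> * t) * char \<mu> t)
      = (\<integral>t. indicator {-real T<..<real T} t *\<^sub>R ((iexp (- (t * a)) - iexp (- (t * b))) / (\<i> * t) * char \<mu> t) \<partial>lborel)"
      unfolding interval_lebesgue_integral_def set_lebesgue_integral_def by simp
    also have "\<dots> = (\<integral>t. indicator {-real T<..<real T} t *\<^sub>R (G t * char \<mu> t) \<partial>lborel)"
    proof (rule integral_cong_AE)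
      have "AE t in lborel. t \<noteq> (0 :: real)" by (rule AE_lborel_singleton)
      then show "AE t in lborel. indicator {-real T<..<real T} t *\<^sub>R ((iexp (- (t * a)) - iexp (- (t * b))) / (\<i> * t) * char \<mu> t)
         = indicator {-real T<..<real T} t *\<^sub>R (G t * char \<mu> t)"
        by eventually_elim (simp only: G_def indicator_exp_integral[OF ab] not_False_eq_True)
    qed measurable
    finally show ?thesis .
  qed
  have "(\<lambda>T::nat. \<integral>t. indicator {-real T<..<real T} t *\<^sub>R (G t * char \<mu> t) \<partial>lborel) \<longlonglongrightarrow> (\<integral>t. G t * char \<mu> t \<partial>lborel)"
  proof (rule integral_dominated_convergence[where w="\<lambda>t. (b - a) * norm (char \<mu> t)"])
    show "integrable lborel (\<lambda>t. (b - a) * norm (char \<mu> t))" using char_integrable by simp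
    show "AE t in lborel. (\<lambda>T. indicator {-real T<..<real T} t *\<^sub>R (G t * char \<mu> t)) \<longlonglongrightarrow> G t * char \<mu> t"
    proof (intro AE_I2)
      fix t
      obtain N :: nat where N: "\<bar>t\<bar> < real N" using reals_Archimedean2 by blast
      have "\<forall>\<^sub>F T in sequentially. indicator {-real T<..<real T} t *\<^sub>R (G t * char \<mu> t) = G t * char \<mu> t"
        using eventually_ge_at_top[of N]
      proof eventually_elim
        case (elim T)
        then have "real N \<le> real T" by simp
        then show ?case using N by (auto simp: indicator_def abs_less_iff)
      qed
      then show "(\<lambda>T. indicator {-real T<..<real T} t *\<^sub>R (G t * char \<mu> t)) \<longlonglongrightarrow> G t * char \<mu> t"
        by (rule tendsto_eventually)
    qed
    show "AE t in lborel. norm (indicator {-real T<..<real T} t *\<^sub>R (G t * char \<mu> t)) \<le> (b - a) * norm (char \<mu> t)" for T :: nat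
      using G_bound ab by (intro AE_I2) (auto simp: norm_mult indicator_def intro: mult_right_mono)
  qed measurable
  from tendsto_mult_left[OF this, of "1 / (2 * pi)"]
  have "(\<lambda>T::nat. 1 / (2 * pi) * (CLBINT t=-real T..real T. (iexp (- (t * a)) - iexp (- (t * b))) / (\<i> * t) * char \<mu> t))
      \<longlonglongrightarrow> 1 / (2 * pi) * (\<integral>t. G t * char \<mu> t \<partial>lborel)"
    unfolding eq by simp
  then have "complex_of_real (measure \<mu> {a<..b}) = 1 / (2 * pi) * (\<integral>t. G t * char \<mu> t \<partial>lborel)"
    by (rule LIMSEQ_unique[OF Levy_Inversion[OF ab atoms, unfolded of_int_minus of_int_of_nat_eq]])
  also have "(\<integral>t. G t * char \<mu> t \<partial>lborel) = (\<integral>t. (\<integral>x. indicator {a..b} x *\<^sub>R (iexp (- (t * x)) * char \<mu> t) \<partial>lborel) \<partial>lborel)"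
    unfolding G_def by (simp flip: integral_mult_left_zero add: mult_scaleR_left)
  also have "\<dots> = (\<integral>x. (\<integral>t. indicator {a..b} x *\<^sub>R (iexp (- (t * x)) * char \<mu> t) \<partial>lborel) \<partial>lborel)"
    by (rule lborel_pair.Fubini_integral[OF product_integrable])
  also have "1 / (2 * pi) * \<dots> = (\<integral>x. indicator {a..b} x *\<^sub>R inv_fourier (char \<mu>) 0 x \<partial>lborel)"
    unfolding inv_fourier_def by (simp flip: integral_mult_right_zero)
  finally have c: "complex_of_real (measure \<mu> {a<..b}) = (\<integral>x. indicator {a..b} x *\<^sub>R inv_fourier (char \<mu>) 0 x \<partial>lborel)" .
  have "integrable lborel (\<lambda>x. indicator {a..b} x *\<^sub>R inv_fourier (char \<mu>) 0 x)"
    using borel_integrable_compact[of "{a..b}" "inv_fourier (char \<mu>) 0"] inv_fourier_continuous by (simp add: set_integrable_def)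
  then have "Re (\<integral>x. indicator {a..b} x *\<^sub>R inv_fourier (char \<mu>) 0 x \<partial>lborel) = (\<integral>x. Re (indicator {a..b} x *\<^sub>R inv_fourier (char \<mu>) 0 x) \<partial>lborel)"
    by (rule integral_Re[symmetric])
  then show ?thesis using arg_cong[OF c, of Re] by (simp add: fourier_density_def)
qed

lemma fourier_density_bound: "\<bar>fourier_density x\<bar> \<le> (\<integral>u. norm (char \<mu> u) \<partial>lborel)"
proof -
  have "\<bar>fourier_density x\<bar> \<le> norm (inv_fourier (char \<mu>) 0 x)" unfolding fourier_density_def by (rule abs_Re_le_cmod)
  also have "\<dots> = 1 / (2 * pi) * norm (\<integral>u. iexp (- (u * x)) * char \<mu> u \<partial>lborel)"
    unfolding inv_fourier_def by (simp add: norm_mult norm_divide)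
  also have "\<dots> \<le> 1 * norm (\<integral>u. iexp (- (u * x)) * char \<mu> u \<partial>lborel)"
    using pi_gt3 by (intro mult_right_mono) auto
  also have "\<dots> \<le> (\<integral>u. norm (iexp (- (u * x)) * char \<mu> u) \<partial>lborel)" using integral_norm_bound by simp
  also have "\<dots> = (\<integral>u. norm (char \<mu> u) \<partial>lborel)" by (simp add: norm_mult)
  finally show ?thesis .
qed

lemma fourier_density_measurable [measurable]: "fourier_density \<in> borel_measurable borel"
  by (intro borel_measurable_continuous_onI fourier_density_continuous)

lemma fourier_density_interval_integrable: "integrable lborel (\<lambda>x. indicator {a..b} x * fourier_density x)"
  using borel_integrable_compact[of "{a..b}" fourier_density] fourier_density_continuous by (simp add: set_integrable_def)

text \<open>An atom would lie in short intervals whose end points are not atoms, and the bounded density makes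
  the measure of such intervals small.\<close>

lemma no_atoms: "measure \<mu> {c} = 0"
proof (rule ccontr)
  assume "measure \<mu> {c} \<noteq> 0"
  then have pos: "0 < measure \<mu> {c}" by (simp add: zero_less_measure_iff)
  let ?A = "{x. measure \<mu> {x} \<noteq> 0}"
  have A: "countable ?A" by (rule countable_support)
  have ex: "\<exists>x\<in>{l<..<u}. measure \<mu> {x} = 0" if "l < u" for l u
  proof (rule ccontr)
    assume "\<not> ?thesis"
    then have "{l<..<u} \<subseteq> ?A" by auto
    then show False using A countable_subset uncountable_open_interval[of l u] that by blast
  qed
  let ?K = "\<integral>u. norm (char \<mu> u) \<partial>lborel"
  have K: "0 \<le> ?K" by simp
  \<comment> \<open>an interval of length \<open>2 e\<close> has at most half the measure of the atom; the summand 1 allows for \<open>?K = 0\<close>\<close>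
  define e where "e = measure \<mu> {c} / (4 * (?K + 1))"
  have e: "0 < e" unfolding e_def using pos K by (intro divide_pos_pos mult_pos_pos add_nonneg_pos) auto
  obtain a where a: "c - e < a" "a < c" "measure \<mu> {a} = 0" using ex[of "c - e" c] e by auto
  obtain b where b: "c < b" "b < c + e" "measure \<mu> {b} = 0" using ex[of c "c + e"] e by auto
  have "measure \<mu> {c} \<le> measure \<mu> {a<..b}" using a b by (intro finite_measure_mono) auto
  also have "\<dots> = (\<integral>x. indicator {a..b} x * fourier_density x \<partial>lborel)"
    using a b by (intro inversion_at_continuity_points) auto
  also have "\<dots> \<le> (\<integral>x. indicator {a..b} x * ?K \<partial>lborel)"
  proof (rule integral_mono[OF fourier_density_interval_integrable])
    show "integrable lborel (\<lambda>x. indicator {a..b} x * ?K)"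
      by (intro integrable_mult_left) (simp add: integrable_indicator_iff emeasure_lborel_Icc_eq)
    show "indicator {a..b} x * fourier_density x \<le> indicator {a..b} x * ?K" for x
      using fourier_density_bound[of x] by (intro mult_left_mono) auto
  qed
  also have "\<dots> = (b - a) * ?K" using a b by simp
  also have "\<dots> \<le> (2 * e) * (?K + 1)" using a b K e by (intro mult_mono) auto
  also have "\<dots> = measure \<mu> {c} / 2"
  proof -
    have "(2 * (p / (4 * k))) * k = p / 2" if "k \<noteq> 0" for p k :: real using that by (simp add: field_simps)
    then show ?thesis unfolding e_def using K by (metis add_nonneg_pos less_irrefl zero_less_one)
  qed
  finally show False using pos by simp
qed

lemma interval_measure: "a \<le> b \<Longrightarrow> measure \<mu> {a<..b} = (\<integral>x. indicator {a..b} x * fourier_density x \<partial>lborel)"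
  by (intro inversion_at_continuity_points no_atoms)

text \<open>By continuity, a negative value would give a short interval of negative measure.\<close>

lemma fourier_density_nonneg: "0 \<le> fourier_density x"
proof (rule ccontr)
  assume neg: "\<not> 0 \<le> fourier_density x"
  have "isCont fourier_density x" using fourier_density_continuous[of UNIV] by (simp add: continuous_on_eq_continuous_at)
  then have "(fourier_density \<longlongrightarrow> fourier_density x) (at x)" by (simp add: isCont_def)
  then have "\<forall>\<^sub>F y in at x. fourier_density y < fourier_density x / 2"
    using neg by (intro order_tendstoD) auto
  then obtain e where e: "0 < e" "\<And>y. y \<noteq> x \<Longrightarrow> dist y x < e \<Longrightarrow> fourier_density y < fourier_density x / 2"
    unfolding eventually_at by auto
  have small: "fourier_density y \<le> fourier_density x / 2" if "y \<in> {x..x + e / 2}" for y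
    using e(2)[of y] e(1) neg that by (cases "y = x") (auto simp: dist_real_def)
  have "0 \<le> measure \<mu> {x<..x + e / 2}" by simp
  also have "\<dots> = (\<integral>y. indicator {x..x + e / 2} y * fourier_density y \<partial>lborel)" using e(1) by (intro interval_measure) auto
  also have "\<dots> \<le> (\<integral>y. indicator {x..x + e / 2} y * (fourier_density x / 2) \<partial>lborel)"
  proof (rule integral_mono[OF fourier_density_interval_integrable])
    show "integrable lborel (\<lambda>y. indicator {x..x + e / 2} y * (fourier_density x / 2))"
      by (intro integrable_mult_left) (simp add: integrable_indicator_iff emeasure_lborel_Icc_eq)
    show "indicator {x..x + e / 2} y * fourier_density y \<le> indicator {x..x + e / 2} y * (fourier_density x / 2)" for y
      using small[of y] by (auto simp: indicator_def)
  qed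
  also have "\<dots> = (e / 2) * (fourier_density x / 2)" using e(1) by simp
  also have "\<dots> < 0" using e(1) neg by (intro mult_pos_neg) auto
  finally show False by simp
qed

lemma distribution_eq_density: "\<mu> = density lborel (\<lambda>x. ennreal (fourier_density x))"
proof (rule measure_eqI_lessThan)
  let ?N = "density lborel (\<lambda>x. ennreal (fourier_density x))"
  show "sets \<mu> = sets borel" "sets ?N = sets borel" by auto
  fix x :: real
  show "emeasure \<mu> {x<..} < \<infinity>" by (simp add: less_top[symmetric])
  have iv: "emeasure \<mu> {x<..x + real n} = emeasure ?N {x<..x + real n}" for n :: nat
  proof -
    have "emeasure ?N {x<..x + real n} = (\<integral>\<^sup>+y. ennreal (fourier_density y) * indicator {x<..x + real n} y \<partial>lborel)"
      by (rule emeasure_density) auto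
    also have "\<dots> = (\<integral>\<^sup>+y. ennreal (indicator {x..x + real n} y * fourier_density y) \<partial>lborel)"
    proof (rule nn_integral_cong_AE)
      have "AE y in lborel. y \<noteq> x" by (rule AE_lborel_singleton)
      then show "AE y in lborel. ennreal (fourier_density y) * indicator {x<..x + real n} y = ennreal (indicator {x..x + real n} y * fourier_density y)"
        by eventually_elim (auto simp: indicator_def)
    qed
    also have "\<dots> = ennreal (\<integral>y. indicator {x..x + real n} y * fourier_density y \<partial>lborel)"
      by (rule nn_integral_eq_integral[OF fourier_density_interval_integrable]) (auto simp: fourier_density_nonneg)
    also have "\<dots> = emeasure \<mu> {x<..x + real n}" by (simp add: interval_measure emeasure_eq_measure)
    finally show ?thesis by simp
  qed
  have un: "{x<..} = (\<Union>n::nat. {x<..x + real n})"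
  proof
    show "{x<..} \<subseteq> (\<Union>n::nat. {x<..x + real n})"
    proof
      fix y assume "y \<in> {x<..}"
      moreover obtain n :: nat where "y - x < real n" using reals_Archimedean2 by blast
      ultimately show "y \<in> (\<Union>n::nat. {x<..x + real n})" by (intro UN_I[of n]) auto
    qed
  qed auto
  have inc: "incseq (\<lambda>n::nat. {x<..x + real n})" by (auto simp: incseq_def)
  have "emeasure \<mu> {x<..} = (SUP n. emeasure \<mu> {x<..x + real n})"
    unfolding un by (rule SUP_emeasure_incseq[symmetric]) (use inc in auto)
  moreover have "emeasure ?N {x<..} = (SUP n. emeasure ?N {x<..x + real n})"
    unfolding un by (rule SUP_emeasure_incseq[symmetric]) (use inc in auto)
  ultimately show "emeasure \<mu> {x<..} = emeasure ?N {x<..}" unfolding iv by simp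
qed

end

lemma (in prob_space) has_smooth_density_of_rapid_char:
  assumes X: "X \<in> borel_measurable M" and rc: "rapid_char (char (distr M borel X))"
  shows "has_smooth_density M X (rapid_char.fourier_density (char (distr M borel X)))"
proof -
  interpret R: real_distribution "distr M borel X" using X by (rule real_distribution_distr)
  interpret rapid_distribution "distr M borel X"
    by (intro rapid_distribution.intro rapid_distribution_axioms.intro R.real_distribution_axioms rc)
  have "distr M lborel X = distr M borel X" by (rule distr_cong) auto
  then show ?thesis
    unfolding has_smooth_density_def distributed_def
    using fourier_density_smooth fourier_density_nonneg distribution_eq_density X by auto
qed

section \<open>Convergence of the densities\<close>

text \<open>The limit along all grids of the characteristic functions of the discretised integrals. It is
  determined by \<open>\<theta>\<close>, \<open>\<gamma>\<close> and \<open>T\<close> alone, which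
  makes the constants below independent of the Brownian motion.\<close>

definition is_kernel_char :: "real \<Rightarrow> real \<Rightarrow> real \<Rightarrow> (real \<Rightarrow> complex) \<Rightarrow> bool" where
  "is_kernel_char \<theta> \<gamma> T f \<longleftrightarrow> (\<forall>u. (\<lambda>n. chi (eigval \<theta> \<gamma> T n) n u) \<longlonglongrightarrow> f u)"

lemma (in brownian) double_wiener_char:
  assumes \<theta>: "0 < \<theta>"
  shows "is_kernel_char \<theta> \<gamma> T (char (distr M borel (double_wiener_integral M B T (exp_kernel \<theta> \<gamma> T))))"
  unfolding is_kernel_char_def
proof
  fix u
  let ?X = "double_wiener_integral M B T (exp_kernel \<theta> \<gamma> T)"
  have X [measurable]: "?X \<in> borel_measurable M" using double_wiener_integral_L2[OF \<theta>] by auto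
  have E: "expectation (\<lambda>\<omega>. iexp (u * discretised_integral \<theta> \<gamma> n \<omega>)) = chi (eigval \<theta> \<gamma> T n) n u" if n: "0 < n" for n
  proof -
    interpret gaussian_vector M n "\<lambda>j. normal_coord n (eigvec \<theta> \<gamma> T n j)"
    proof
      show "normal_coord n (eigvec \<theta> \<gamma> T n j) \<in> borel_measurable M" for j
        unfolding normal_coord_def by (rule L2_D(1)[OF step_integral_L2])
    qed (rule normal_coord_joint_char[OF n eigvec_orthonormal])
    show ?thesis
      unfolding discretised_integral_def by (rule quadratic_char) (rule eigval_nonneg[OF T_pos \<theta>])
  qed
  have "\<forall>\<^sub>F n in sequentially. expectation (\<lambda>\<omega>. iexp (u * discretised_integral \<theta> \<gamma> n \<omega>)) = chi (eigval \<theta> \<gamma> T n) n u"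
    by (rule eventually_mono[OF eventually_gt_at_top[of 0]]) (rule E)
  from Lim_transform_eventually[OF discretised_char_tendsto[OF \<theta>] this]
  have "(\<lambda>n. chi (eigval \<theta> \<gamma> T n) n u) \<longlonglongrightarrow> expectation (\<lambda>\<omega>. iexp (u * ?X \<omega>))" .
  also have "expectation (\<lambda>\<omega>. iexp (u * ?X \<omega>)) = char (distr M borel ?X) u"
    unfolding char_def by (subst integral_distr) auto
  finally show "(\<lambda>n. chi (eigval \<theta> \<gamma> T n) n u) \<longlonglongrightarrow> char (distr M borel ?X) u" .
qed

text \<open>The value that results from \<^const>\<open>amplitude\<close> and from bounding the block
  parameter of \<open>eigval_count\<close> between \<open>T0 / (32 K)\<close> and \<open>T0 / (16
  K)\<close>.\<close>

definition decay_rate :: "real \<Rightarrow> real \<Rightarrow> nat \<Rightarrow> real \<Rightarrow> real" where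
  "decay_rate \<theta> \<gamma> K T0 = \<gamma> ^ 4 * (\<theta> * (T0 / (32 * K))\<^sup>2 / (1 + 2 * \<theta> * (T0 / (16 * K))) ^ 3)\<^sup>2 / T0"

lemma decay_rate_pos: "0 < \<theta> \<Longrightarrow> 0 < \<gamma> \<Longrightarrow> 0 < T0 \<Longrightarrow> 0 < K \<Longrightarrow> 0 < decay_rate \<theta> \<gamma> K T0"
  unfolding decay_rate_def by (intro divide_pos_pos mult_pos_pos zero_less_power add_pos_pos) auto

text \<open>With \<open>q\<close> of the order of \<open>T / T0\<close> and \<open>4 K q\<close> blocks, each
  of the \<open>4 K q\<close> large eigenvalues contributes a factor \<open>1 + O(u\<^sup>2 /
  T)\<close>. By Bernoulli's inequality, \<open>q\<close> such factors amount to \<open>1 +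
  O(u\<^sup>2 / T0)\<close>, uniformly in \<open>T\<close>.\<close>

lemma kernel_char_decay:
  assumes \<theta>: "0 < \<theta>" and T0: "0 < T0" and T: "T0 \<le> T" and K: "0 < K"
    and F: "is_kernel_char \<theta> \<gamma> T F"
  shows "norm (F u) \<le> (1 / (1 + decay_rate \<theta> \<gamma> K T0 * u\<^sup>2)) ^ K"
proof -
  \<comment> \<open>between \<open>T / T0\<close> and \<open>2 T / T0\<close>, so that the length of a block is comparable to \<open>T0 / K\<close>\<close>
  define q where "q = nat \<lceil>T / T0\<rceil>"
  have T': "0 < T" using T0 T by simp
  have r1: "1 \<le> T / T0" using T0 T by simp
  have q1: "T / T0 \<le> q" unfolding q_def using real_nat_ceiling_ge by simp
  have q2: "real q \<le> 2 * (T / T0)"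
  proof -
    have "real q = real_of_int \<lceil>T / T0\<rceil>" unfolding q_def using r1 by simp
    then have "real q < T / T0 + 1" by linarith
    then show ?thesis using r1 by linarith
  qed
  have q: "0 < q" using q1 r1 by (cases "q = 0") auto
  \<comment> \<open>the factor 4 compensates for the fourth power in \<open>norm_chi_count\<close>\<close>
  define m where "m = 4 * (K * q)"
  define \<kappa> where "\<kappa> = T / (4 * m)"
  define c where "c = \<theta> * (T0 / (32 * K))\<^sup>2 / (1 + 2 * \<theta> * (T0 / (16 * K))) ^ 3"
  define t where "t = amplitude \<gamma> T * \<theta> * \<kappa>\<^sup>2 / (1 + 2 * \<theta> * \<kappa>) ^ 3"
  have m: "0 < m" using K q by (simp add: m_def)
  have k0: "0 < real K" "0 < real q" using K q by auto
  have \<kappa>: "T0 / (32 * K) \<le> \<kappa>" "\<kappa> \<le> T0 / (16 * K)"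
  proof -
    have e: "\<kappa> = (T / q) / (16 * K)" by (simp add: \<kappa>_def m_def)
    have "T0 / 2 \<le> T / q" using q2 T0 k0 by (simp add: field_simps)
    then have "(T0 / 2) / (16 * K) \<le> (T / q) / (16 * K)" using k0 by (intro divide_right_mono) auto
    then show "T0 / (32 * K) \<le> \<kappa>" unfolding e by simp
    have "T / q \<le> T0" using q1 T0 k0 by (simp add: field_simps)
    then show "\<kappa> \<le> T0 / (16 * K)" unfolding e using k0 by (intro divide_right_mono) auto
  qed
  have \<kappa>0: "0 < T0 / (32 * K)" using T0 k0 by simp
  have G: "0 \<le> amplitude \<gamma> T" by (rule amplitude_nonneg[OF T'])
  have "\<theta> * (T0 / (32 * K))\<^sup>2 / (1 + 2 * \<theta> * (T0 / (16 * K))) ^ 3 \<le> \<theta> * \<kappa>\<^sup>2 / (1 + 2 * \<theta> * \<kappa>) ^ 3"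
  proof (rule frac_le)
    show "\<theta> * (T0 / (32 * K))\<^sup>2 \<le> \<theta> * \<kappa>\<^sup>2" using \<theta> \<kappa> \<kappa>0 by (intro mult_left_mono power_mono) auto
    show "(1 + 2 * \<theta> * \<kappa>) ^ 3 \<le> (1 + 2 * \<theta> * (T0 / (16 * K))) ^ 3"
      using \<theta> \<kappa> \<kappa>0 by (intro power_mono add_left_mono mult_left_mono) auto
    show "0 < (1 + 2 * \<theta> * \<kappa>) ^ 3" using \<theta> \<kappa> \<kappa>0 by (intro zero_less_power add_pos_pos mult_pos_pos) auto
  qed (use \<theta> in auto)
  from mult_left_mono[OF this G] have tc: "amplitude \<gamma> T * c \<le> t" by (simp add: c_def t_def)
  have c0: "0 \<le> c" unfolding c_def using \<theta> T0 by (intro divide_nonneg_nonneg) auto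
  have t0: "0 \<le> t" using tc G c0 by (meson mult_nonneg_nonneg order_trans)
  have "(amplitude \<gamma> T * c)\<^sup>2 \<le> t\<^sup>2" using tc G c0 by (intro power_mono) auto
  then have t2: "\<gamma> ^ 4 * c\<^sup>2 / T \<le> 4 * t\<^sup>2"
    using T' by (simp add: power_mult_distrib amplitude_square)
  have bern: "1 + decay_rate \<theta> \<gamma> K T0 * u\<^sup>2 \<le> (1 + 4 * u\<^sup>2 * t\<^sup>2) ^ q"
  proof -
    have "decay_rate \<theta> \<gamma> K T0 * u\<^sup>2 = (1 / T0) * (\<gamma> ^ 4 * c\<^sup>2 * u\<^sup>2)" by (simp add: decay_rate_def c_def)
    also have "\<dots> \<le> (q / T) * (\<gamma> ^ 4 * c\<^sup>2 * u\<^sup>2)"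
      using q1 T0 T' by (intro mult_right_mono) (auto simp: field_simps)
    also have "\<dots> = q * ((\<gamma> ^ 4 * c\<^sup>2 / T) * u\<^sup>2)" by simp
    also have "\<dots> \<le> q * ((4 * t\<^sup>2) * u\<^sup>2)" by (intro mult_left_mono mult_right_mono t2) auto
    finally have "1 + decay_rate \<theta> \<gamma> K T0 * u\<^sup>2 \<le> 1 + q * (4 * u\<^sup>2 * t\<^sup>2)" by (simp add: mult_ac)
    also have "\<dots> \<le> (1 + 4 * u\<^sup>2 * t\<^sup>2) ^ q" by (intro Bernoulli_inequality) (simp add: order_trans[of "-1" 0])
    finally show ?thesis .
  qed
  have bd: "norm (chi (eigval \<theta> \<gamma> T (m * (4 * Suc r))) (m * (4 * Suc r)) u) \<le> (1 / (1 + decay_rate \<theta> \<gamma> K T0 * u\<^sup>2)) ^ K" for r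
  proof -
    let ?n = "m * (4 * Suc r)" and ?y = "1 / (1 + 4 * u\<^sup>2 * t\<^sup>2)"
    have "norm (chi (eigval \<theta> \<gamma> T ?n) ?n u) ^ 4 \<le> ?y ^ m"
      by (rule norm_chi_count[OF _ t0]) (unfold t_def \<kappa>_def, rule eigval_count[OF T' \<theta> _ m], simp)
    also have "\<dots> = (?y ^ (K * q)) ^ 4" by (simp add: m_def mult.commute flip: power_mult)
    finally have "norm (chi (eigval \<theta> \<gamma> T ?n) ?n u) \<le> ?y ^ (K * q)"
      by (subst (asm) power_mono_iff) auto
    also have "\<dots> = (1 / (1 + 4 * u\<^sup>2 * t\<^sup>2) ^ q) ^ K" by (simp add: power_one_over mult.commute flip: power_mult)
    also have "\<dots> \<le> (1 / (1 + decay_rate \<theta> \<gamma> K T0 * u\<^sup>2)) ^ K"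
    proof (intro power_mono divide_left_mono bern mult_pos_pos)
      have "0 \<le> decay_rate \<theta> \<gamma> K T0" unfolding decay_rate_def using T0 by simp
      then show p: "0 < 1 + decay_rate \<theta> \<gamma> K T0 * u\<^sup>2" by (simp add: add_pos_nonneg)
      then show "0 < (1 + 4 * u\<^sup>2 * t\<^sup>2) ^ q" using bern by linarith
    qed auto
    finally show ?thesis .
  qed
  have sm: "strict_mono (\<lambda>r. m * (4 * Suc r))" using m by (intro strict_monoI) simp
  have "(\<lambda>r. norm (chi (eigval \<theta> \<gamma> T (m * (4 * Suc r))) (m * (4 * Suc r)) u)) \<longlonglongrightarrow> norm (F u)"
    using F LIMSEQ_subseq_LIMSEQ[OF _ sm, of "\<lambda>n. chi (eigval \<theta> \<gamma> T n) n u"]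
    unfolding is_kernel_char_def by (intro tendsto_norm) (simp add: o_def)
  then show ?thesis by (rule LIMSEQ_le_const2) (use bd in blast)
qed

text \<open>The limit of \<open>chi_gaussian\<close> along the grids. The sum of cubes is at most the largest
  eigenvalue times the sum of squares.\<close>

lemma kernel_char_gaussian:
  assumes \<theta>: "0 < \<theta>" and T: "0 < T" and F: "is_kernel_char \<theta> \<gamma> T F"
  defines "s \<equiv> \<gamma> ^ 4 / (4 * \<theta>)"
  shows "norm (F u - exp (- (s * u\<^sup>2))) \<le> \<bar>u\<bar> / 2 * (2 * \<bar>u\<bar> * (\<gamma> ^ 4 / (8 * \<theta>\<^sup>2) / T) + 4 * u\<^sup>2 * (2 * amplitude \<gamma> T / \<theta> * s))
     * (exp (- (3 / 4 * s * u\<^sup>2)) + norm (F (u / 2)))"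
proof -
  let ?l = "eigval \<theta> \<gamma> T"
  let ?S = "\<lambda>n. \<Sum>j<n. (?l n j)\<^sup>2"
  let ?L = "\<lambda>n. 2 * amplitude \<gamma> T * (1 / \<theta> + T / real n)"
  have s: "0 \<le> s" unfolding s_def using \<theta> by simp
  have cube: "(\<Sum>j<n. \<bar>?l n j\<bar> ^ 3) \<le> ?L n * ?S n" for n
    unfolding sum_distrib_left
  proof (rule sum_mono)
    fix j assume "j \<in> {..<n}"
    then have "0 \<le> ?l n j" "?l n j \<le> ?L n" using eigval_nonneg[OF T \<theta>] eigval_le[OF T \<theta>] by auto
    then show "\<bar>?l n j\<bar> ^ 3 \<le> ?L n * (?l n j)\<^sup>2"
      by (simp add: power3_eq_cube power2_eq_square mult_right_mono flip: mult.assoc)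
  qed
  have bn: "norm (chi (?l n) n u - exp (- (s * u\<^sup>2))) \<le> \<bar>u\<bar> / 2 * (2 * \<bar>u\<bar> * \<bar>s - ?S n\<bar> + 4 * u\<^sup>2 * (?L n * ?S n))
     * (exp (- (3 / 4 * s * u\<^sup>2)) + norm (chi (?l n) n (u / 2)))" for n
  proof -
    have "drift (?l n) n s \<bar>u\<bar> \<le> 2 * \<bar>u\<bar> * \<bar>s - ?S n\<bar> + 4 * u\<^sup>2 * (?L n * ?S n)"
      unfolding drift_def power2_abs using cube[of n] by (intro add_left_mono mult_left_mono) auto
    then have "\<bar>u\<bar> / 2 * drift (?l n) n s \<bar>u\<bar> * (exp (- (3 / 4 * s * u\<^sup>2)) + norm (chi (?l n) n (u / 2)))
      \<le> \<bar>u\<bar> / 2 * (2 * \<bar>u\<bar> * \<bar>s - ?S n\<bar> + 4 * u\<^sup>2 * (?L n * ?S n)) * (exp (- (3 / 4 * s * u\<^sup>2)) + norm (chi (?l n) n (u / 2)))"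
      by (intro mult_right_mono mult_left_mono add_nonneg_nonneg) auto
    then show ?thesis using chi_gaussian[OF s, of "?l n" n u] by (rule order_trans[rotated])
  qed
  define S where "S = limit_sum_squares \<theta> \<gamma> T"
  have St: "?S \<longlonglongrightarrow> S" unfolding S_def by (rule eigval_sum_squares_tendsto[OF T \<theta>])
  have Lt: "?L \<longlonglongrightarrow> 2 * amplitude \<gamma> T * (1 / \<theta> + 0)"
    by (intro tendsto_mult tendsto_add tendsto_const lim_const_over_n)
  have Ft: "(\<lambda>n. chi (?l n) n v) \<longlonglongrightarrow> F v" for v using F by (simp add: is_kernel_char_def)
  have "norm (F u - exp (- (s * u\<^sup>2))) \<le> \<bar>u\<bar> / 2 * (2 * \<bar>u\<bar> * \<bar>s - S\<bar> + 4 * u\<^sup>2 * (2 * amplitude \<gamma> T * (1 / \<theta> + 0) * S))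
     * (exp (- (3 / 4 * s * u\<^sup>2)) + norm (F (u / 2)))"
  proof (rule LIMSEQ_le)
    show "(\<lambda>n. norm (chi (?l n) n u - exp (- (s * u\<^sup>2)))) \<longlonglongrightarrow> norm (F u - exp (- (s * u\<^sup>2)))"
      by (intro tendsto_norm tendsto_diff tendsto_const Ft)
    show "(\<lambda>n. \<bar>u\<bar> / 2 * (2 * \<bar>u\<bar> * \<bar>s - ?S n\<bar> + 4 * u\<^sup>2 * (?L n * ?S n)) * (exp (- (3 / 4 * s * u\<^sup>2)) + norm (chi (?l n) n (u / 2))))
      \<longlonglongrightarrow> \<bar>u\<bar> / 2 * (2 * \<bar>u\<bar> * \<bar>s - S\<bar> + 4 * u\<^sup>2 * (2 * amplitude \<gamma> T * (1 / \<theta> + 0) * S)) * (exp (- (3 / 4 * s * u\<^sup>2)) + norm (F (u / 2)))"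
      by (rule tendsto_mult[OF tendsto_mult[OF tendsto_const tendsto_add[OF tendsto_mult[OF tendsto_const tendsto_rabs[OF tendsto_diff[OF tendsto_const St]]]
         tendsto_mult[OF tendsto_const tendsto_mult[OF Lt St]]]] tendsto_add[OF tendsto_const tendsto_norm[OF Ft]]])
  qed (use bn in blast)
  also have "\<dots> \<le> \<bar>u\<bar> / 2 * (2 * \<bar>u\<bar> * (\<gamma> ^ 4 / (8 * \<theta>\<^sup>2) / T) + 4 * u\<^sup>2 * (2 * amplitude \<gamma> T / \<theta> * s))
     * (exp (- (3 / 4 * s * u\<^sup>2)) + norm (F (u / 2)))"
  proof (intro mult_right_mono mult_left_mono add_mono)
    show "\<bar>s - S\<bar> \<le> \<gamma> ^ 4 / (8 * \<theta>\<^sup>2) / T" unfolding s_def S_def by (rule limit_sum_squares_close[OF T \<theta>])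
    have "S \<le> s"
    proof -
      have "0 \<le> \<gamma> ^ 4 * (1 - exp (- 2 * \<theta> * T)) / (8 * \<theta>\<^sup>2 * T)"
        using T \<theta> by (intro divide_nonneg_pos mult_nonneg_nonneg) auto
      then show ?thesis by (simp add: s_def S_def limit_sum_squares_def)
    qed
    then show "2 * amplitude \<gamma> T * (1 / \<theta> + 0) * S \<le> 2 * amplitude \<gamma> T / \<theta> * s"
      using amplitude_nonneg[OF T, of \<gamma>] \<theta> by (simp add: mult_left_mono divide_right_mono)
  qed auto
  finally show ?thesis .
qed

lemma integrable_cauchy: "integrable lborel (\<lambda>u::real. 1 / (1 + u\<^sup>2))"
  using integrable_inverse_1_plus_square by (simp add: set_integrable_def inverse_eq_divide)

text \<open>The integrable majorant \<open>1 / (1 + u\<^sup>2)\<close> costs one power of the rational factor;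
  the others absorb the polynomial.\<close>

lemma rational_decay_bound:
  fixes b u :: real
  assumes b: "0 < b" and jK: "j < K"
  shows "\<bar>u\<bar> ^ j * (1 / (1 + b * u\<^sup>2)) ^ K \<le> (1 / min 1 b) ^ K * (1 / (1 + u\<^sup>2))"
proof -
  define w where "w = 1 + u\<^sup>2"
  define a where "a = min 1 b"
  have w: "1 \<le> w" by (simp add: w_def)
  have a: "0 < a" "a \<le> 1" "a \<le> b" using b by (auto simp: a_def)
  have "\<bar>u\<bar> \<le> w"
  proof -
    have "0 \<le> (\<bar>u\<bar> - 1)\<^sup>2" by simp
    then have "2 * \<bar>u\<bar> \<le> w" by (simp add: w_def power2_eq_square algebra_simps)
    then show ?thesis by linarith
  qed
  then have "\<bar>u\<bar> ^ j \<le> w ^ j" by (intro power_mono) auto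
  also have "\<dots> \<le> w ^ (K - 1)" using w jK by (intro power_increasing) auto
  finally have 1: "\<bar>u\<bar> ^ j \<le> w ^ (K - 1)" .
  have aw: "a * w \<le> 1 + b * u\<^sup>2"
    using a mult_right_mono[OF a(3), of "u\<^sup>2"] by (simp add: w_def distrib_left)
  have "1 / (1 + b * u\<^sup>2) \<le> 1 / (a * w)"
    using a w aw b by (intro divide_left_mono mult_pos_pos) (auto intro: add_pos_nonneg)
  then have 2: "(1 / (1 + b * u\<^sup>2)) ^ K \<le> (1 / (a * w)) ^ K"
    using b by (intro power_mono) (auto simp: add_nonneg_nonneg)
  have "\<bar>u\<bar> ^ j * (1 / (1 + b * u\<^sup>2)) ^ K \<le> w ^ (K - 1) * (1 / (a * w)) ^ K"
    using 1 2 w b by (intro mult_mono) auto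
  also have "\<dots> = (1 / a) ^ K * (1 / w)"
  proof -
    obtain K' where K': "K = Suc K'" using jK by (cases K) auto
    have "(w * (1 / (a * w))) ^ K' = (1 / a) ^ K'" using w by simp
    then have e: "w ^ K' * (1 / (a * w)) ^ K' = (1 / a) ^ K'" by (simp only: power_mult_distrib)
    have "w ^ (K - 1) * (1 / (a * w)) ^ K = (w ^ K' * (1 / (a * w)) ^ K') * (1 / (a * w))"
      by (simp only: K' diff_Suc_1 power_Suc mult_ac)
    then show ?thesis unfolding e by (simp add: K')
  qed
  finally show ?thesis by (simp only: a_def w_def)
qed

lemma rapid_char_of_decay:
  assumes m: "f \<in> borel_measurable borel"
    and d: "\<And>K. \<exists>b>0. \<forall>u. norm (f u) \<le> (1 / (1 + b * u\<^sup>2)) ^ Suc K"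
  shows "rapid_char f"
proof
  fix k :: nat
  obtain b where b: "b > 0" "\<And>u. norm (f u) \<le> (1 / (1 + b * u\<^sup>2)) ^ Suc k" using d by blast
  show "integrable lborel (\<lambda>u. \<bar>u\<bar> ^ k * norm (f u))"
  proof (rule Bochner_Integration.integrable_bound)
    show "integrable lborel (\<lambda>u. (1 / min 1 b) ^ Suc k * (1 / (1 + u\<^sup>2)))"
      by (intro integrable_mult_right integrable_cauchy)
    show "AE u in lborel. norm (\<bar>u\<bar> ^ k * norm (f u)) \<le> norm ((1 / min 1 b) ^ Suc k * (1 / (1 + u\<^sup>2)))"
    proof (intro AE_I2)
      fix u :: real
      have "\<bar>u\<bar> ^ k * norm (f u) \<le> \<bar>u\<bar> ^ k * (1 / (1 + b * u\<^sup>2)) ^ Suc k" using b(2) by (intro mult_left_mono) auto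
      also have "\<dots> \<le> (1 / min 1 b) ^ Suc k * (1 / (1 + u\<^sup>2))" by (rule rational_decay_bound[OF b(1)]) simp
      finally have q: "\<bar>u\<bar> ^ k * norm (f u) \<le> (1 / min 1 b) ^ Suc k * (1 / (1 + u\<^sup>2))" .
      have nn: "0 \<le> \<bar>u\<bar> ^ k * norm (f u)" by simp
      show "norm (\<bar>u\<bar> ^ k * norm (f u)) \<le> norm ((1 / min 1 b) ^ Suc k * (1 / (1 + u\<^sup>2)))"
        unfolding real_norm_def abs_of_nonneg[OF nn] using q by (rule order_trans) (rule abs_ge_self)
    qed
  qed (use m in measurable)
qed (rule m)

lemma exp_minus_le_rational:
  fixes x :: real
  assumes "0 \<le> x" "0 < K"
  shows "exp (- x) \<le> (1 / (1 + x / real K)) ^ K"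
proof -
  have p: "0 < 1 + x / K" using assms by (simp add: add_pos_nonneg)
  have "(1 + x / K) ^ K \<le> exp (x / K) ^ K" using assms p by (intro power_mono exp_ge_add_one_self) auto
  also have "\<dots> = exp x" using assms by (simp flip: exp_of_nat_mult)
  finally have "1 / exp x \<le> 1 / (1 + x / K) ^ K" using p by (intro divide_left_mono mult_pos_pos) auto
  then show ?thesis by (simp add: exp_minus inverse_eq_divide power_one_over)
qed

lemma rapid_char_gaussian:
  assumes s: "0 < s"
  shows "rapid_char (\<lambda>u. complex_of_real (exp (- (s * u\<^sup>2))))"
proof (rule rapid_char_of_decay)
  fix K
  have "norm (complex_of_real (exp (- (s * u\<^sup>2)))) \<le> (1 / (1 + s / real (Suc K) * u\<^sup>2)) ^ Suc K" for u
    using exp_minus_le_rational[of "s * u\<^sup>2" "Suc K"] s by simp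
  then show "\<exists>b>0. \<forall>u. norm (complex_of_real (exp (- (s * u\<^sup>2)))) \<le> (1 / (1 + b * u\<^sup>2)) ^ Suc K"
    using s by (intro exI[of _ "s / real (Suc K)"]) simp
qed measurable

text \<open>After rescaling, the normal density is its own Fourier transform.\<close>

lemma density_gaussian:
  assumes \<sigma>: "0 < \<sigma>"
  shows "rapid_char.fourier_density (\<lambda>u. complex_of_real (exp (- (\<sigma>\<^sup>2 / 2 * u\<^sup>2)))) = normal_density 0 \<sigma>"
proof
  fix x
  interpret rapid_char "\<lambda>u. complex_of_real (exp (- (\<sigma>\<^sup>2 / 2 * u\<^sup>2)))" by (rule rapid_char_gaussian) (use \<sigma> in simp)
  let ?f = "\<lambda>u. iexp (- (u * x)) * complex_of_real (exp (- (\<sigma>\<^sup>2 / 2 * u\<^sup>2)))"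
  have "(\<integral>u. ?f u \<partial>lborel) = \<bar>1 / \<sigma>\<bar> *\<^sub>R (\<integral>v. ?f (0 + 1 / \<sigma> * v) \<partial>lborel)"
    by (rule lborel_integral_real_affine) (use \<sigma> in simp)
  also have "(\<lambda>v. ?f (0 + 1 / \<sigma> * v)) = (\<lambda>v. sqrt (2 * pi) * (std_normal_density v *\<^sub>R iexp (- (x / \<sigma>) * v)))"
  proof
    fix v
    have "\<sigma>\<^sup>2 / 2 * (0 + 1 / \<sigma> * v)\<^sup>2 = v\<^sup>2 / 2" using \<sigma> by (simp add: power_divide)
    moreover have "(0 + 1 / \<sigma> * v) * x = x / \<sigma> * v" by simp
    ultimately have l: "?f (0 + 1 / \<sigma> * v) = iexp (- (x / \<sigma> * v)) * complex_of_real (exp (- (v\<^sup>2 / 2)))" by (simp only:)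
    have "sqrt (2 * pi) * std_normal_density v = exp (- (v\<^sup>2 / 2))" by (simp add: std_normal_density_def)
    moreover have "complex_of_real a * (b *\<^sub>R z) = complex_of_real (a * b) * z" for a b z
      by (simp add: scaleR_conv_of_real)
    ultimately have r: "complex_of_real (sqrt (2 * pi)) * (std_normal_density v *\<^sub>R z) = complex_of_real (exp (- (v\<^sup>2 / 2))) * z" for z
      by (simp only:)
    show "?f (0 + 1 / \<sigma> * v) = sqrt (2 * pi) * (std_normal_density v *\<^sub>R iexp (- (x / \<sigma>) * v))"
      unfolding l r by (simp add: mult.commute)
  qed
  also have "(\<integral>v. sqrt (2 * pi) * (std_normal_density v *\<^sub>R iexp (- (x / \<sigma>) * v)) \<partial>lborel) = sqrt (2 * pi) * char std_normal_distribution (- (x / \<sigma>))"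
  proof -
    have "char std_normal_distribution (- (x / \<sigma>)) = (\<integral>v. std_normal_density v *\<^sub>R iexp (- (x / \<sigma>) * v) \<partial>lborel)"
      unfolding char_def by (rule integral_density) auto
    then show ?thesis by (simp only: integral_mult_right_zero)
  qed
  also have "\<dots> = sqrt (2 * pi) * exp (- (x\<^sup>2 / (2 * \<sigma>\<^sup>2)))"
    by (simp add: char_std_normal_distribution power_divide)
  finally have "inv_fourier (\<lambda>u. complex_of_real (exp (- (\<sigma>\<^sup>2 / 2 * u\<^sup>2)))) 0 x
     = complex_of_real (1 / (2 * pi) * (1 / \<sigma> * (sqrt (2 * pi) * exp (- (x\<^sup>2 / (2 * \<sigma>\<^sup>2))))))"
    using \<sigma> unfolding inv_fourier_def by (simp add: scaleR_conv_of_real)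
  then have "fourier_density x = 1 / (2 * pi) * (1 / \<sigma> * (sqrt (2 * pi) * exp (- (x\<^sup>2 / (2 * \<sigma>\<^sup>2)))))"
    unfolding fourier_density_def by simp
  also have "\<dots> = normal_density 0 \<sigma> x"
  proof -
    define r where "r = sqrt (2 * pi)"
    have r: "r \<noteq> 0" "2 * pi = r * r" by (simp_all add: r_def)
    have "sqrt (2 * pi * \<sigma>\<^sup>2) = r * \<sigma>" using \<sigma> by (simp add: r_def real_sqrt_mult)
    then have "normal_density 0 \<sigma> x = 1 / (r * \<sigma>) * exp (- (x\<^sup>2 / (2 * \<sigma>\<^sup>2)))" by (simp add: normal_density_def)
    moreover have "1 / (r * r) * (1 / \<sigma> * (r * z)) = 1 / (r * \<sigma>) * z" for z using r(1) by simp
    ultimately show ?thesis unfolding r_def[symmetric] unfolding r(2) by (simp only:)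
  qed
  finally show "fourier_density x = normal_density 0 \<sigma> x" .
qed


lemma kernel_char_rapid:
  assumes "0 < \<theta>" "0 < \<gamma>" "0 < T" and F: "is_kernel_char \<theta> \<gamma> T F" and m: "F \<in> borel_measurable borel"
  shows "rapid_char F"
proof (rule rapid_char_of_decay[OF m])
  fix K
  show "\<exists>b>0. \<forall>u. norm (F u) \<le> (1 / (1 + b * u\<^sup>2)) ^ Suc K"
    using kernel_char_decay[OF assms(1) assms(3) order_refl _ F, of "Suc K"] decay_rate_pos[OF assms(1-3), of "Suc K"]
    by blast
qed

text \<open>The polynomial prefactor has degree \<open>k + 3\<close>, which determines the exponent
  \<open>K\<close>.\<close>

lemma kernel_char_distance:
  assumes \<theta>: "0 < \<theta>" and \<gamma>: "0 < \<gamma>" and T0: "0 < T0"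
  defines "s \<equiv> \<gamma> ^ 4 / (4 * \<theta>)"
  shows "\<exists>C. \<forall>T F. T0 \<le> T \<longrightarrow> is_kernel_char \<theta> \<gamma> T F \<longrightarrow>
    (\<forall>u. \<bar>u\<bar> ^ k * norm (F u - exp (- (s * u\<^sup>2))) \<le> C * T powr (- 1 / 2) * (1 / (1 + u\<^sup>2)))"
proof -
  \<comment> \<open>one more than the degree \<open>k + 3\<close> of the prefactor\<close>
  define K where "K = k + 4"
  have K: "0 < K" by (simp add: K_def)
  have s: "0 < s" using \<theta> \<gamma> by (simp add: s_def)
  \<comment> \<open>a common rate for \<open>F (u / 2)\<close>, whence the division by 4, and for the Gaussian factor\<close>
  define b where "b = min (decay_rate \<theta> \<gamma> K T0 / 4) (3 / 4 * s / K)"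
  have b: "0 < b" using decay_rate_pos[OF \<theta> \<gamma> T0 K] s K by (simp add: b_def)
  have bl: "b \<le> decay_rate \<theta> \<gamma> K T0 / 4" "b \<le> 3 / 4 * s / K" by (simp_all add: b_def)
  define A1 where "A1 = \<gamma> ^ 4 / (8 * \<theta>\<^sup>2) / sqrt T0"
  define A2 where "A2 = \<gamma>\<^sup>2 / \<theta> * s"
  have A: "0 \<le> A1" "0 \<le> A2" using \<theta> T0 s by (auto simp: A1_def A2_def)
  define D where "D = (1 / min 1 b) ^ K"
  show ?thesis
  proof (intro exI allI impI)
    fix T F u assume T: "T0 \<le> T" and F: "is_kernel_char \<theta> \<gamma> T F"
    have T': "0 < T" using T T0 by simp
    define p where "p = T powr (- 1 / 2)"
    have p: "p = 1 / sqrt T"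
    proof -
      have "- 1 / 2 = - (1 / 2 :: real)" by simp
      then have "p = 1 / T powr (1 / 2)" unfolding p_def by (simp only: powr_minus_divide)
      then show ?thesis using powr_half_sqrt[of T] T' by simp
    qed
    have p0: "0 \<le> p" by (simp add: p_def)
    define R where "R = (1 / (1 + b * u\<^sup>2)) ^ K"
    have R0: "0 \<le> R" using b by (simp add: R_def)
    have mono: "(1 / (1 + c * u\<^sup>2)) ^ K \<le> R" if "b \<le> c" for c
      unfolding R_def using b that by (intro power_mono divide_left_mono add_left_mono mult_right_mono mult_pos_pos add_pos_nonneg) auto
    have a1: "exp (- (3 / 4 * s * u\<^sup>2)) \<le> R"
      using exp_minus_le_rational[of "3 / 4 * s * u\<^sup>2" K] mono[OF bl(2)] s K by simp
    have a2: "norm (F (u / 2)) \<le> R"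
      using kernel_char_decay[OF \<theta> T0 T K F, of "u / 2"] mono[OF bl(1)]
      by (simp add: power_divide)
    have e1: "\<gamma> ^ 4 / (8 * \<theta>\<^sup>2) / T \<le> A1 * p"
    proof -
      have "T = sqrt T * sqrt T" using T' by simp
      then have "\<gamma> ^ 4 / (8 * \<theta>\<^sup>2) / T = \<gamma> ^ 4 / (8 * \<theta>\<^sup>2) / sqrt T * (1 / sqrt T)" by (metis divide_divide_eq_left times_divide_eq_right mult.right_neutral)
      also have "\<dots> \<le> \<gamma> ^ 4 / (8 * \<theta>\<^sup>2) / sqrt T0 * (1 / sqrt T)"
        using T T0 by (intro mult_right_mono divide_left_mono mult_pos_pos) auto
      finally show ?thesis by (simp only: A1_def p)
    qed
    have e2: "2 * amplitude \<gamma> T / \<theta> * s = A2 * p" by (simp add: amplitude_def A2_def p)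
    have "norm (F u - exp (- (s * u\<^sup>2))) \<le> \<bar>u\<bar> / 2 * (2 * \<bar>u\<bar> * (\<gamma> ^ 4 / (8 * \<theta>\<^sup>2) / T) + 4 * u\<^sup>2 * (2 * amplitude \<gamma> T / \<theta> * s))
       * (exp (- (3 / 4 * s * u\<^sup>2)) + norm (F (u / 2)))"
      unfolding s_def by (rule kernel_char_gaussian[OF \<theta> T' F])
    also have "\<dots> \<le> \<bar>u\<bar> / 2 * (2 * \<bar>u\<bar> * (A1 * p) + 4 * u\<^sup>2 * (A2 * p)) * (R + R)"
    proof -
      have h1: "2 * \<bar>u\<bar> * (\<gamma> ^ 4 / (8 * \<theta>\<^sup>2) / T) + 4 * u\<^sup>2 * (A2 * p) \<le> 2 * \<bar>u\<bar> * (A1 * p) + 4 * u\<^sup>2 * (A2 * p)"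
        by (intro add_right_mono mult_left_mono e1) simp
      have h2: "exp (- (3 / 4 * s * u\<^sup>2)) + norm (F (u / 2)) \<le> R + R" by (rule add_mono[OF a1 a2])
      have h3: "0 \<le> 2 * \<bar>u\<bar> * (A1 * p) + 4 * u\<^sup>2 * (A2 * p)" using A p0 by simp
      have h4: "0 \<le> exp (- (3 / 4 * s * u\<^sup>2)) + norm (F (u / 2))" by (rule add_nonneg_nonneg) simp_all
      have h5: "0 \<le> \<bar>u\<bar> / 2" by simp
      show ?thesis unfolding e2
        by (rule mult_mono[OF mult_left_mono[OF h1 h5] h2 mult_nonneg_nonneg[OF h5 h3] h4])
    qed
    also have "\<dots> = p * (2 * A1 * (\<bar>u\<bar> ^ 2 * R) + 4 * A2 * (\<bar>u\<bar> ^ 3 * R))"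
      by (simp add: power2_eq_square power3_eq_cube algebra_simps)
    finally have "\<bar>u\<bar> ^ k * norm (F u - exp (- (s * u\<^sup>2))) \<le> \<bar>u\<bar> ^ k * (p * (2 * A1 * (\<bar>u\<bar> ^ 2 * R) + 4 * A2 * (\<bar>u\<bar> ^ 3 * R)))"
      by (rule mult_left_mono) simp
    also have "\<dots> = p * (2 * A1 * (\<bar>u\<bar> ^ (k + 2) * R) + 4 * A2 * (\<bar>u\<bar> ^ (k + 3) * R))"
      unfolding power_add by (simp only: distrib_left mult_ac)
    also have "\<dots> \<le> p * (2 * A1 * (D * (1 / (1 + u\<^sup>2))) + 4 * A2 * (D * (1 / (1 + u\<^sup>2))))"
      unfolding R_def D_def using A p0 b by (intro mult_left_mono add_mono rational_decay_bound) (auto simp: K_def)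
    also have "\<dots> = (2 * A1 + 4 * A2) * D * p * (1 / (1 + u\<^sup>2))"
      by (simp only: distrib_left distrib_right mult_ac)
    finally show "\<bar>u\<bar> ^ k * norm (F u - exp (- (s * u\<^sup>2))) \<le> (2 * A1 + 4 * A2) * D * T powr (- 1 / 2) * (1 / (1 + u\<^sup>2))"
      unfolding p_def .
  qed
qed

lemma kernel_density_distance:
  assumes \<theta>: "0 < \<theta>" and \<gamma>: "0 < \<gamma>" and T0: "0 < T0"
  shows "\<exists>C. \<forall>T F x. T0 \<le> T \<longrightarrow> is_kernel_char \<theta> \<gamma> T F \<longrightarrow> F \<in> borel_measurable borel \<longrightarrow>
    \<bar>(deriv ^^ k) (rapid_char.fourier_density F) x - (deriv ^^ k) (normal_density 0 (sqrt (\<gamma> ^ 4 / (2 * \<theta>)))) x\<bar> \<le> C * T powr (- 1 / 2)"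
proof -
  define s where "s = \<gamma> ^ 4 / (4 * \<theta>)"
  define \<sigma> where "\<sigma> = sqrt (\<gamma> ^ 4 / (2 * \<theta>))"
  have \<sigma>: "0 < \<sigma>" "\<sigma>\<^sup>2 / 2 = s" using \<theta> \<gamma> by (auto simp: \<sigma>_def s_def)
  have s: "0 < s" using \<theta> \<gamma> by (simp add: s_def)
  obtain C where C: "\<forall>T F. T0 \<le> T \<longrightarrow> is_kernel_char \<theta> \<gamma> T F \<longrightarrow>
    (\<forall>u. \<bar>u\<bar> ^ k * norm (F u - exp (- (s * u\<^sup>2))) \<le> C * T powr (- 1 / 2) * (1 / (1 + u\<^sup>2)))"
    using kernel_char_distance[OF assms, of k] unfolding s_def by (elim exE)
  define J where "J = (\<integral>u. 1 / (1 + (u :: real)\<^sup>2) \<partial>lborel)"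
  show ?thesis
  proof (intro exI allI impI)
    fix T F x assume T: "T0 \<le> T" and F: "is_kernel_char \<theta> \<gamma> T F" and m: "F \<in> borel_measurable borel"
    let ?G = "\<lambda>u. complex_of_real (exp (- (s * u\<^sup>2)))"
    have T': "0 < T" using T T0 by simp
    have rF: "rapid_char F" by (rule kernel_char_rapid[OF \<theta> \<gamma> T' F m])
    have rG: "rapid_char ?G" by (rule rapid_char_gaussian[OF s])
    have dG: "rapid_char.fourier_density ?G = normal_density 0 \<sigma>"
      using density_gaussian[OF \<sigma>(1)] unfolding \<sigma>(2) .
    have pw: "\<bar>u\<bar> ^ k * norm (F u - ?G u) \<le> C * T powr (- 1 / 2) * (1 / (1 + u\<^sup>2))" for u
      using C T F by blast
    have "\<bar>(deriv ^^ k) (rapid_char.fourier_density F) x - (deriv ^^ k) (rapid_char.fourier_density ?G) x\<bar>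
       \<le> (\<integral>u. \<bar>u\<bar> ^ k * norm (F u - ?G u) \<partial>lborel)"
      by (rule inv_fourier_diff[OF rF rG])
    also have "\<dots> \<le> (\<integral>u. C * T powr (- 1 / 2) * (1 / (1 + u\<^sup>2)) \<partial>lborel)"
    proof (rule integral_mono'[OF integrable_mult_right[OF integrable_cauchy]])
      show "0 \<le> C * T powr (- 1 / 2) * (1 / (1 + u\<^sup>2))" for u
        by (rule order_trans[OF _ pw[of u]]) simp
    qed (rule pw)
    also have "\<dots> = C * T powr (- 1 / 2) * J" unfolding J_def by (rule integral_mult_right_zero)
    also have "\<dots> = (C * J) * T powr (- 1 / 2)" by (simp only: mult_ac)
    finally show "\<bar>(deriv ^^ k) (rapid_char.fourier_density F) x - (deriv ^^ k) (normal_density 0 (sqrt (\<gamma> ^ 4 / (2 * \<theta>)))) x\<bar> \<le> (C * J) * T powr (- 1 / 2)"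
      unfolding dG \<sigma>_def[symmetric] .
  qed
qed

theorem theorem7p5:
  fixes \<theta> \<gamma> :: real
  assumes "\<theta> > 0" and "\<gamma> > 0"
  shows "\<exists>C :: nat \<Rightarrow> real \<Rightarrow> real.
    \<forall>(M :: 'a measure) (B :: real \<Rightarrow> 'a \<Rightarrow> real). standard_brownian_motion M B \<longrightarrow>
      (\<exists>p :: real \<Rightarrow> real \<Rightarrow> real.
        (\<forall>T>0. has_smooth_density M (double_wiener_integral M B T (exp_kernel \<theta> \<gamma> T)) (p T)) \<and>
        (\<forall>k. \<forall>T\<^sub>0>0. \<forall>T\<ge>T\<^sub>0.
          (SUP x. ereal \<bar>(deriv ^^ k) (p T) x -
                        (deriv ^^ k) (normal_density 0 (sqrt (\<gamma> ^ 4 / (2 * \<theta>)))) x\<bar>)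
            \<le> ereal (C k T\<^sub>0 * T powr (- 1 / 2))))"
proof -
  have "\<forall>k T\<^sub>0. \<exists>C. 0 < T\<^sub>0 \<longrightarrow> (\<forall>T F x. T\<^sub>0 \<le> T \<longrightarrow> is_kernel_char \<theta> \<gamma> T F \<longrightarrow> F \<in> borel_measurable borel \<longrightarrow>
    \<bar>(deriv ^^ k) (rapid_char.fourier_density F) x - (deriv ^^ k) (normal_density 0 (sqrt (\<gamma> ^ 4 / (2 * \<theta>)))) x\<bar> \<le> C * T powr (- 1 / 2))"
    (is "\<forall>k T\<^sub>0. \<exists>C. 0 < T\<^sub>0 \<longrightarrow> ?P k T\<^sub>0 C")
  proof (intro allI)
    fix k T\<^sub>0
    show "\<exists>C. 0 < T\<^sub>0 \<longrightarrow> ?P k T\<^sub>0 C"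
    proof (cases "0 < T\<^sub>0")
      case True
      from kernel_density_distance[OF assms True, of k] show ?thesis by (elim exE) (intro exI impI)
    qed simp
  qed
  from this[unfolded choice_iff] obtain C where
    C: "\<forall>k T\<^sub>0. 0 < T\<^sub>0 \<longrightarrow> (\<forall>T F x. T\<^sub>0 \<le> T \<longrightarrow> is_kernel_char \<theta> \<gamma> T F \<longrightarrow> F \<in> borel_measurable borel \<longrightarrow>
    \<bar>(deriv ^^ k) (rapid_char.fourier_density F) x - (deriv ^^ k) (normal_density 0 (sqrt (\<gamma> ^ 4 / (2 * \<theta>)))) x\<bar> \<le> C k T\<^sub>0 * T powr (- 1 / 2))"
    by (elim exE)
  show ?thesis
  proof (intro exI[of _ C] allI impI)
    fix M :: "'a measure" and B :: "real \<Rightarrow> 'a \<Rightarrow> real"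
    assume bm: "standard_brownian_motion M B"
    let ?F = "\<lambda>T. char (distr M borel (double_wiener_integral M B T (exp_kernel \<theta> \<gamma> T)))"
    have facts: "is_kernel_char \<theta> \<gamma> T (?F T)" "?F T \<in> borel_measurable borel"
      "has_smooth_density M (double_wiener_integral M B T (exp_kernel \<theta> \<gamma> T)) (rapid_char.fourier_density (?F T))"
      if T: "0 < T" for T
    proof -
      interpret brownian M B T by unfold_locales (use bm T in auto)
      have X: "double_wiener_integral M B T (exp_kernel \<theta> \<gamma> T) \<in> borel_measurable M"
        using double_wiener_integral_L2[OF assms(1)] by auto
      interpret R: real_distribution "distr M borel (double_wiener_integral M B T (exp_kernel \<theta> \<gamma> T))"
        by (rule real_distribution_distr[OF X])
      show k: "is_kernel_char \<theta> \<gamma> T (?F T)" by (rule double_wiener_char[OF assms(1)])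
      show m: "?F T \<in> borel_measurable borel" by (rule R.char_measurable)
      show "has_smooth_density M (double_wiener_integral M B T (exp_kernel \<theta> \<gamma> T)) (rapid_char.fourier_density (?F T))"
        by (rule has_smooth_density_of_rapid_char[OF X kernel_char_rapid[OF assms T k m]])
    qed
    show "\<exists>p :: real \<Rightarrow> real \<Rightarrow> real.
        (\<forall>T>0. has_smooth_density M (double_wiener_integral M B T (exp_kernel \<theta> \<gamma> T)) (p T)) \<and>
        (\<forall>k. \<forall>T\<^sub>0>0. \<forall>T\<ge>T\<^sub>0.
          (SUP x. ereal \<bar>(deriv ^^ k) (p T) x -
                        (deriv ^^ k) (normal_density 0 (sqrt (\<gamma> ^ 4 / (2 * \<theta>)))) x\<bar>)
            \<le> ereal (C k T\<^sub>0 * T powr (- 1 / 2)))"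
    proof (intro exI[of _ "\<lambda>T. rapid_char.fourier_density (?F T)"] conjI allI impI SUP_least)
      fix k T\<^sub>0 T x assume T: "0 < T\<^sub>0" "(T\<^sub>0 :: real) \<le> T"
      then have "0 < T" by simp
      then show "ereal \<bar>(deriv ^^ k) (rapid_char.fourier_density (?F T)) x - (deriv ^^ k) (normal_density 0 (sqrt (\<gamma> ^ 4 / (2 * \<theta>)))) x\<bar>
          \<le> ereal (C k T\<^sub>0 * T powr (- 1 / 2))"
        unfolding ereal_less_eq using C[rule_format, OF T facts(1) facts(2)] by blast
    qed (rule facts(3))
  qed
qed

end
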